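(* Let $G$ be a profinite group such that the set of all commutators $\{[x,y]\mid x,y\in G\}$ is contained in a union of countably many procyclic subgroups. Then the whole commutator subgroup $G'$ is contained in a union of countably many procyclic subgroups (the family of procyclic subgroups covering $G'$ is not claimed to be the same as the one covering the set of commutators).
   Context: For elements $x,y$ of a group, $[x,y]=x^{-1}y^{-1}xy$. For a profinite group $G$, the commutator subgroup $G'$ is the closed subgroup of $G$ (topologically) generated by all commutators. A profinite group is procyclic if it is topologically generated by one element; procyclic subgroups are closed subgroups. "Countably many" means finitely or countably infinitely many. *)

theory Defs
  imports "HOL-Algebra.Generated_Groups" "HOL-Analysis.Analysis"
begin

locale topological_group = group G
  for G :: "('a, 'b) monoid_scheme" (structure) and T :: "'a topology" +
  assumes topspace_eq_carrier: "topspace T = carrier G"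
    and continuous_mult: "continuous_map (prod_topology T T) T (\<lambda>(x, y). x \<otimes> y)"
    and continuous_inv: "continuous_map T T (\<lambda>x. inv x)"

definition totally_disconnected_space :: "'a topology \<Rightarrow> bool" where
  "totally_disconnected_space T \<longleftrightarrow>
     (\<forall>x \<in> topspace T. connected_component_of_set T x = {x})"

locale profinite_group = topological_group +
  assumes compact: "compact_space T"
    and Hausdorff: "Hausdorff_space T"
    and totally_disconnected: "totally_disconnected_space T"

(* The subgroup topologically generated by S, i.e. for S contained in a topological group
   the smallest closed subgroup containing S. *)
definition top_generate :: "('a, 'b) monoid_scheme \<Rightarrow> 'a topology \<Rightarrow> 'a set \<Rightarrow> 'a set" where
  "top_generate G T S = T closure_of (generate G S)"

definition procyclic_subgroup :: "('a, 'b) monoid_scheme \<Rightarrow> 'a topology \<Rightarrow> 'a set \<Rightarrow> bool" where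
  "procyclic_subgroup G T H \<longleftrightarrow> (\<exists>g \<in> carrier G. H = top_generate G T {g})"

definition commutator :: "('a, 'b) monoid_scheme \<Rightarrow> 'a \<Rightarrow> 'a \<Rightarrow> 'a" where
  "commutator G x y = inv\<^bsub>G\<^esub> x \<otimes>\<^bsub>G\<^esub> inv\<^bsub>G\<^esub> y \<otimes>\<^bsub>G\<^esub> x \<otimes>\<^bsub>G\<^esub> y"

definition commutators :: "('a, 'b) monoid_scheme \<Rightarrow> 'a set" where
  "commutators G = {commutator G x y | x y. x \<in> carrier G \<and> y \<in> carrier G}"

(* The constant derived of HOL-Algebra is the abstract commutator subgroup;
   here the closed one is meant. *)
definition commutator_subgroup :: "('a, 'b) monoid_scheme \<Rightarrow> 'a topology \<Rightarrow> 'a set" where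
  "commutator_subgroup G T = top_generate G T (commutators G)"

definition covered_by_countably_many_procyclic ::
    "('a, 'b) monoid_scheme \<Rightarrow> 'a topology \<Rightarrow> 'a set \<Rightarrow> bool" where
  "covered_by_countably_many_procyclic G T S \<longleftrightarrow>
     (\<exists>\<F>. countable \<F> \<and> (\<forall>H \<in> \<F>. procyclic_subgroup G T H) \<and> S \<subseteq> \<Union>\<F>)"

end

theory Submission
  imports Defs "HOL-Algebra.Multiplicative_Group"
begin

text \<open>By Baire's theorem some box \<open>aK \<times> bK\<close> of commutators lies in one procyclic subgroup; after
  conjugation this puts \<open>[K,a]\<close>, \<open>[K,b]\<close> and \<open>[K,K]\<close> into a common procyclic subgroup, and \<open>a\<close>, \<open>b\<close> can be
  taken in prescribed cosets of a given open normal subgroup. Three successive applications give open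
  normal subgroups \<open>H \<supseteq> K \<supseteq> L\<close>, where \<open>K\<close> works for all cosets of \<open>H\<close> and \<open>L\<close> for all pairs of cosets of
  \<open>K\<close>. In every finite quotient, comparing generators modulo \<open>p\<close>-th powers for each prime \<open>p\<close> shows
  that \<open>[L,G]\<close> is cyclic, so the closure \<open>M\<close> of \<open>[L,G]\<close> is procyclic. It is centralized by the
  commutators, since automorphisms of a procyclic group commute, and \<open>G'/M\<close> is finite by Schur's
  theorem, because \<open>LM/M\<close> is central of finite index. Finally each coset \<open>dM\<close> with \<open>d \<in> G'\<close> is covered by
  countably many procyclic subgroups of the form \<open>\<langle>y\<rangle>N\<^sup>q\<close> with \<open>N \<le> M\<close>.\<close>

section \<open>Commutators and cyclic subgroups\<close>

text \<open>Three levels are needed because a box controls \<open>[k,a]\<close> only for chosen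
  representatives \<open>a\<close>. Passing to an arbitrary \<open>g = ah\<close> produces
  \<open>[l,h]\<close> and \<open>[[l,a],h]\<close>. If \<open>h\<close> lies in \<open>K\<close>,
  these vanish modulo \<open>[K,K]\<close>; if \<open>h\<close> only lies in \<open>H\<close>, they
  stay in one cyclic group containing all \<open>[h,h']\<close>. Lying in a common cyclic group is
  not a transitive relation, so elements of \<open>[L,G]\<close> are compared through elements of
  \<open>[K,K]\<close>, one prime at a time.

  The last step has to collect uncountably many groups \<open><y>\<close>, with \<open>y\<close> in
  \<open>dM\<close>, into countably many. In \<open>Z/p x Z_p\<close> with \<open>M = Z_p\<close>
  and \<open>y = (1,x)\<close>, where \<open>x\<close> has valuation \<open>k\<close>, the closed
  group \<open><y>\<close> contains \<open>p^(k+1) Z_p\<close>, so only finitely many groups occur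
  for each \<open>k\<close>; but \<open>x = 0\<close> belongs to no \<open>k\<close> and needs a
  group of its own. This is why \<open>N\<close> varies: it absorbs infinite divisibility at the
  finitely many primes dividing \<open>m\<close>, where \<open>d^m\<close> lies in
  \<open>M\<close>.\<close>

context group begin

lemma inv_cancel_left: "x \<in> carrier G \<Longrightarrow> y \<in> carrier G \<Longrightarrow> inv x \<otimes> (x \<otimes> y) = y"
  by (simp add: m_assoc [symmetric])

lemma cancel_inv_left: "x \<in> carrier G \<Longrightarrow> y \<in> carrier G \<Longrightarrow> x \<otimes> (inv x \<otimes> y) = y"
  by (simp add: m_assoc [symmetric])

lemmas group_word_simps = m_assoc inv_mult_group inv_cancel_left cancel_inv_left

lemma commutator_closed [simp, intro]:
  "x \<in> carrier G \<Longrightarrow> y \<in> carrier G \<Longrightarrow> commutator G x y \<in> carrier G"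
  by (simp add: commutator_def)

lemma inv_commutator:
  "x \<in> carrier G \<Longrightarrow> y \<in> carrier G \<Longrightarrow> inv (commutator G x y) = commutator G y x"
  by (simp add: commutator_def group_word_simps)

lemma conj_commutator:
  assumes "x \<in> carrier G" "y \<in> carrier G" "g \<in> carrier G"
  shows "g \<otimes> commutator G x y \<otimes> inv g = commutator G (g \<otimes> x \<otimes> inv g) (g \<otimes> y \<otimes> inv g)"
  using assms by (simp add: commutator_def group_word_simps)

lemma conj_int_pow:
  assumes "x \<in> carrier G" "g \<in> carrier G"
  shows "(g \<otimes> x \<otimes> inv g) [^] (k::int) = g \<otimes> x [^] k \<otimes> inv g"
proof -
  have "group_hom G G (\<lambda>x. g \<otimes> x \<otimes> inv g)"
    using assms by unfold_locales (auto simp: hom_def group_word_simps)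
  from group_hom.hom_int_pow [OF this assms(1)] show ?thesis by simp
qed

lemma mem_generate_single:
  "c \<in> carrier G \<Longrightarrow> x \<in> generate G {c} \<longleftrightarrow> (\<exists>k::int. x = c [^] k)"
  by (auto simp: generate_pow)

lemma int_pow_in_generate: "c \<in> carrier G \<Longrightarrow> c [^] (k::int) \<in> generate G {c}"
  by (auto simp: generate_pow)

lemma int_pow_commute:
  "c \<in> carrier G \<Longrightarrow> c [^] (i::int) \<otimes> c [^] (j::int) = c [^] j \<otimes> c [^] i"
  by (simp add: int_pow_mult [symmetric] add.commute)

lemma generate_single_commute:
  "\<lbrakk>c \<in> carrier G; x \<in> generate G {c}; y \<in> generate G {c}\<rbrakk> \<Longrightarrow> x \<otimes> y = y \<otimes> x"
  by (auto simp: mem_generate_single int_pow_commute)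

lemma normal_commutator_mem:
  assumes "N \<lhd> G" "k \<in> N" "g \<in> carrier G"
  shows "commutator G k g \<in> N"
proof -
  interpret N: normal N G by fact
  have "commutator G k g = inv k \<otimes> (inv g \<otimes> k \<otimes> g)"
    using assms by (simp add: commutator_def m_assoc N.mem_carrier)
  then show ?thesis
    using N.inv_op_closed1 assms by simp
qed

lemma subgroup_centralizer:
  assumes "T \<subseteq> carrier G"
  shows "subgroup {x \<in> carrier G. \<forall>y\<in>T. x \<otimes> y = y \<otimes> x} G"
proof (rule subgroupI)
  fix a assume a: "a \<in> {x \<in> carrier G. \<forall>y\<in>T. x \<otimes> y = y \<otimes> x}"
  have "inv a \<otimes> y = y \<otimes> inv a" if "y \<in> T" for y
  proof -
    have "y \<in> carrier G" "a \<otimes> y = y \<otimes> a" "a \<in> carrier G" using a that assms by auto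
    then show ?thesis
      by (metis inv_closed inv_solve_left inv_solve_right m_assoc m_closed)
  qed
  then show "inv a \<in> {x \<in> carrier G. \<forall>y\<in>T. x \<otimes> y = y \<otimes> x}" using a by auto
next
  fix a b
  assume ab: "a \<in> {x \<in> carrier G. \<forall>y\<in>T. x \<otimes> y = y \<otimes> x}"
    "b \<in> {x \<in> carrier G. \<forall>y\<in>T. x \<otimes> y = y \<otimes> x}"
  have "a \<otimes> b \<otimes> y = y \<otimes> (a \<otimes> b)" if "y \<in> T" for y
  proof -
    have [simp]: "y \<in> carrier G" "a \<in> carrier G" "b \<in> carrier G"
      and e: "a \<otimes> y = y \<otimes> a" "b \<otimes> y = y \<otimes> b" using ab that assms by auto
    have "a \<otimes> b \<otimes> y = (a \<otimes> y) \<otimes> b" by (simp add: m_assoc e(2))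
    then show ?thesis by (simp add: m_assoc e(1))
  qed
  then show "a \<otimes> b \<in> {x \<in> carrier G. \<forall>y\<in>T. x \<otimes> y = y \<otimes> x}" using ab by auto
qed (use assms in \<open>auto intro!: exI [of _ \<one>]\<close>)

lemma generate_commute:
  assumes S: "S \<subseteq> carrier G" and T: "T \<subseteq> carrier G"
    and comm: "\<And>s t. s \<in> S \<Longrightarrow> t \<in> T \<Longrightarrow> s \<otimes> t = t \<otimes> s"
    and xy: "x \<in> generate G S" "y \<in> generate G T"
  shows "x \<otimes> y = y \<otimes> x"
proof -
  have "generate G T \<subseteq> {x \<in> carrier G. \<forall>y\<in>S. x \<otimes> y = y \<otimes> x}"
    by (rule generate_subgroup_incl [OF _ subgroup_centralizer [OF S]]) (use T comm in auto)
  then have "generate G S \<subseteq> {x \<in> carrier G. \<forall>y\<in>generate G T. x \<otimes> y = y \<otimes> x}"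
    using S by (intro generate_subgroup_incl [OF _ subgroup_centralizer [OF generate_incl [OF T]]]) auto
  then show ?thesis using xy by auto
qed

text \<open>Conjugation by \<open>g\<close> raises \<open>z\<close> to some power \<open>i\<close>,
  conjugation by \<open>h\<close> to some power \<open>j\<close>; hence \<open>gh\<close> and
  \<open>hg\<close> both send \<open>z\<close> to \<open>z^(ij)\<close>.\<close>

lemma conj_by_commutator_trivial:
  assumes z: "z \<in> carrier G" and norm: "generate G {z} \<lhd> G"
    and gh: "g \<in> carrier G" "h \<in> carrier G"
  shows "commutator G g h \<otimes> z = z \<otimes> commutator G g h"
proof -
  interpret N: normal "generate G {z}" G by fact
  have conj: "\<exists>i::int. x \<otimes> z \<otimes> inv x = z [^] i" if "x \<in> carrier G" for x
    using N.inv_op_closed2 [OF that generate.incl, of z] mem_generate_single [OF z] by auto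
  obtain i j :: int where ij: "g \<otimes> z \<otimes> inv g = z [^] i" "h \<otimes> z \<otimes> inv h = z [^] j"
    using conj gh by meson
  have "(g \<otimes> h) \<otimes> z \<otimes> inv (g \<otimes> h) = g \<otimes> (h \<otimes> z \<otimes> inv h) \<otimes> inv g"
    using gh z by (simp add: group_word_simps)
  also have "\<dots> = z [^] (i * j)"
    using conj_int_pow [OF z gh(1), of j] ij by (simp add: int_pow_pow z)
  also have "\<dots> = h \<otimes> (g \<otimes> z \<otimes> inv g) \<otimes> inv h"
    using conj_int_pow [OF z gh(2), of i] ij by (simp add: int_pow_pow z mult.commute)
  also have "\<dots> = (h \<otimes> g) \<otimes> z \<otimes> inv (h \<otimes> g)"
    using gh z by (simp add: group_word_simps)
  finally have eq: "(g \<otimes> h) \<otimes> z \<otimes> inv (g \<otimes> h) = (h \<otimes> g) \<otimes> z \<otimes> inv (h \<otimes> g)" .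
  have "commutator G g h \<otimes> z = inv (h \<otimes> g) \<otimes> ((g \<otimes> h) \<otimes> z \<otimes> inv (g \<otimes> h)) \<otimes> (g \<otimes> h)"
    using gh z by (simp add: commutator_def group_word_simps)
  also have "\<dots> = z \<otimes> commutator G g h"
    unfolding eq using gh z by (simp add: commutator_def group_word_simps)
  finally show ?thesis .
qed

lemma commutator_shift:
  assumes "subgroup C G" "a \<in> carrier G" "h \<in> carrier G" "y \<in> carrier G"
    and "commutator G (a \<otimes> h) y \<in> C" "commutator G a y \<in> C"
  shows "commutator G h (inv a \<otimes> y \<otimes> a) \<in> C"
proof -
  have "commutator G h (inv a \<otimes> y \<otimes> a) = commutator G (a \<otimes> h) y \<otimes> inv (commutator G a y)"
    using assms by (simp add: commutator_def group_word_simps)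
  then show ?thesis
    using assms by (simp add: subgroup.m_closed subgroup.m_inv_closed)
qed

text \<open>Stripping \<open>a\<close> from the first entry puts \<open>[h, b^a k]\<close> into
  \<open>C\<close>, and stripping \<open>b\<close> from the inverse commutators puts
  \<open>[k, a^b]\<close> there; stripping \<open>b^a\<close> in turn leaves \<open>[k,k']\<close>.
  It remains to exchange \<open>a^b\<close> and \<open>b^a\<close> for \<open>a\<close> and
  \<open>b\<close> by one and the same conjugation.\<close>

lemma commutator_box_cyclic:
  assumes N: "N \<lhd> G" and ab [simp]: "a \<in> carrier G" "b \<in> carrier G" and c [simp]: "c \<in> carrier G"
    and box: "\<And>h k. h \<in> N \<Longrightarrow> k \<in> N \<Longrightarrow> commutator G (a \<otimes> h) (b \<otimes> k) \<in> generate G {c}"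
  shows "\<exists>d\<in>carrier G. (\<forall>k\<in>N. commutator G k a \<in> generate G {d} \<and> commutator G k b \<in> generate G {d}
            \<and> (\<forall>k'\<in>N. commutator G k k' \<in> generate G {d}))"
proof -
  interpret N: normal N G by fact
  define C where "C = generate G {c}"
  have C: "subgroup C G" unfolding C_def by (rule generate_is_subgroup) simp
  interpret C: subgroup C G by fact
  have [simp]: "x \<in> carrier G" if "x \<in> N" for x using that by (rule N.mem_carrier)
  have conjN: "inv g \<otimes> k \<otimes> g \<in> N" if "k \<in> N" "g \<in> carrier G" for k g
    using that N.inv_op_closed1 by blast
  have box: "commutator G (a \<otimes> h) (b \<otimes> k) \<in> C" if "h \<in> N" "k \<in> N" for h k
    using box that C_def by simp
  have box': "commutator G (b \<otimes> k) (a \<otimes> h) \<in> C" if "h \<in> N" "k \<in> N" for h k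
    using box [OF that] inv_commutator [of "a \<otimes> h" "b \<otimes> k"] that
    by (metis C.m_inv_closed N.mem_carrier ab m_closed)
  have abC: "commutator G a b \<in> C" using box [of \<one> \<one>] by simp
  let ?v = "inv a \<otimes> b \<otimes> a"
  have 1: "commutator G h (inv a \<otimes> (b \<otimes> k) \<otimes> a) \<in> C" if "h \<in> N" "k \<in> N" for h k
    by (rule commutator_shift [OF C]) (use that box [of h k] box [of \<one> k] in auto)
  have one_b: "commutator G k (inv b \<otimes> a \<otimes> b) \<in> C" if "k \<in> N" for k
    by (rule commutator_shift [OF C]) (use that box' [of \<one> k] box' [of \<one> \<one>] in auto)
  \<comment> \<open>Conjugation by \<open>a\<close> permutes \<open>N\<close>, so the second entry
    may be any element of the coset \<open>?v N\<close>.\<close>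
  have 2: "commutator G h (?v \<otimes> k) \<in> C" if "h \<in> N" "k \<in> N" for h k
  proof -
    have "?v \<otimes> k = inv a \<otimes> (b \<otimes> (a \<otimes> k \<otimes> inv a)) \<otimes> a"
      using that by (simp add: group_word_simps)
    then show ?thesis
      using 1 [OF that(1), of "a \<otimes> k \<otimes> inv a"] N.inv_op_closed2 [OF ab(1) that(2)] by simp
  qed
  have two_inv: "commutator G (?v \<otimes> k) h \<in> C" if "h \<in> N" "k \<in> N" for h k
    using 2 [OF that] inv_commutator [of h "?v \<otimes> k"] that
    by (metis C.m_inv_closed N.mem_carrier ab m_closed inv_closed)
  have 3: "commutator G k k' \<in> C" if "k \<in> N" "k' \<in> N" for k k'
  proof -
    have h: "?v \<otimes> k' \<otimes> inv ?v \<in> N" using that by (intro N.inv_op_closed2) auto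
    have "commutator G k (inv ?v \<otimes> (?v \<otimes> k' \<otimes> inv ?v) \<otimes> ?v) \<in> C"
      by (rule commutator_shift [OF C])
        (use that two_inv [OF h, of k] two_inv [OF h, of \<one>] in \<open>auto simp: m_assoc\<close>)
    then show ?thesis using that by (simp add: group_word_simps)
  qed
  \<comment> \<open>After conjugation by \<open>ab\<close> the two kinds of commutators land in the same cyclic subgroup,
    because \<open>[a,b]\<close> lies in the abelian group \<open>C\<close>.\<close>
  let ?g = "a \<otimes> b"
  define d where "d = ?g \<otimes> c \<otimes> inv ?g"
  have d: "d \<in> carrier G" by (simp add: d_def)
  have unconj: "x \<in> generate G {d}" if "x \<in> carrier G" "inv ?g \<otimes> x \<otimes> ?g \<in> C" for x
  proof -
    obtain k :: int where k: "inv ?g \<otimes> x \<otimes> ?g = c [^] k"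
      using \<open>inv ?g \<otimes> x \<otimes> ?g \<in> C\<close> unfolding C_def by (auto simp: mem_generate_single)
    have "x = ?g \<otimes> (inv ?g \<otimes> x \<otimes> ?g) \<otimes> inv ?g"
      using that by (simp add: group_word_simps)
    also have "\<dots> = d [^] k"
      unfolding k d_def by (simp add: conj_int_pow)
    finally show ?thesis using d int_pow_in_generate by metis
  qed
  have a: "commutator G k a \<in> generate G {d}" if "k \<in> N" for k
  proof (rule unconj)
    have "inv ?g \<otimes> commutator G k a \<otimes> ?g = commutator G (inv ?g \<otimes> k \<otimes> ?g) (inv b \<otimes> a \<otimes> b)"
      using that by (simp add: commutator_def group_word_simps)
    then show "inv ?g \<otimes> commutator G k a \<otimes> ?g \<in> C"
      using one_b [OF conjN [OF that, of ?g]] by simp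
  qed (use that in auto)
  have b: "commutator G k b \<in> generate G {d}" if "k \<in> N" for k
  proof (rule unconj)
    let ?e = "commutator G a b"
    \<comment> \<open>\<open>b\<close> conjugated by \<open>ab\<close> equals \<open>?v\<close>
      conjugated by \<open>[a,b]\<close>; with this \<open>x\<close> the conjugation by
      \<open>[a,b]\<close>, an element of \<open>C\<close>, can be pulled out of the
      commutator.\<close>
    define x where "x = ?e \<otimes> (inv ?g \<otimes> k \<otimes> ?g) \<otimes> inv ?e"
    have xN: "x \<in> N" unfolding x_def
      by (rule N.inv_op_closed2 [OF _ conjN]) (use that in auto)
    have "inv ?g \<otimes> commutator G k b \<otimes> ?g = inv ?e \<otimes> commutator G x ?v \<otimes> ?e"
      using that by (simp add: x_def commutator_def group_word_simps)
    moreover have "commutator G x ?v \<in> C" using 2 [OF xN, of \<one>] by simp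
    ultimately show "inv ?g \<otimes> commutator G k b \<otimes> ?g \<in> C"
      using abC by simp
  qed (use that in auto)
  have n: "commutator G k k' \<in> generate G {d}" if "k \<in> N" "k' \<in> N" for k k'
  proof (rule unconj)
    have "inv ?g \<otimes> commutator G k k' \<otimes> ?g = commutator G (inv ?g \<otimes> k \<otimes> ?g) (inv ?g \<otimes> k' \<otimes> ?g)"
      using that by (simp add: commutator_def group_word_simps)
    then show "inv ?g \<otimes> commutator G k k' \<otimes> ?g \<in> C"
      using 3 [OF conjN [OF that(1), of ?g] conjN [OF that(2), of ?g]] by simp
  qed (use that in auto)
  show ?thesis using d a b n by blast
qed

end

section \<open>Abelian groups modulo p-th powers\<close>

context group begin

text \<open>In an abelian group this is the subgroup \<open><x> M^n\<close>. It expresses generation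
  modulo \<open>n\<close>-th powers without a quotient, and \<open>x\<close> may lie outside
  \<open>M\<close>.\<close>

definition mod_pow_span :: "'a set \<Rightarrow> nat \<Rightarrow> 'a \<Rightarrow> 'a set" where
  "mod_pow_span M n x = {x [^] (i::int) \<otimes> b [^] n | i b. b \<in> M}"

lemma mem_mod_pow_spanI: "b \<in> M \<Longrightarrow> a = x [^] (i::int) \<otimes> b [^] n \<Longrightarrow> a \<in> mod_pow_span M n x"
  by (auto simp: mod_pow_span_def)

lemma mem_mod_pow_spanE:
  assumes "a \<in> mod_pow_span M n x"
  obtains i :: int and b where "b \<in> M" "a = x [^] i \<otimes> b [^] n"
  using assms by (auto simp: mod_pow_span_def)

lemma nat_pow_int_pow: "x \<in> carrier G \<Longrightarrow> (x [^] (i::int)) [^] (n::nat) = x [^] (i * int n)"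
  by (metis int_pow_int int_pow_pow)

lemma int_pow_nat_pow: "x \<in> carrier G \<Longrightarrow> (x [^] (n::nat)) [^] (i::int) = x [^] (int n * i)"
  by (metis int_pow_int int_pow_pow)

end

context comm_group begin

lemma subgroup_mod_pow_span_comm:
  assumes N: "subgroup N G" and x [simp]: "x \<in> carrier G"
  shows "subgroup (mod_pow_span N n x) G"
proof (rule subgroupI)
  interpret N: subgroup N G by fact
  show "mod_pow_span N n x \<subseteq> carrier G" by (auto simp: mod_pow_span_def)
  have "\<one> \<in> mod_pow_span N n x"
    by (rule mem_mod_pow_spanI [of \<one> _ _ _ 0]) auto
  then show "mod_pow_span N n x \<noteq> {}" by blast
  fix a assume "a \<in> mod_pow_span N n x"
  then obtain i :: int and b where b [simp]: "b \<in> N" and a: "a = x [^] i \<otimes> b [^] n"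
    by (rule mem_mod_pow_spanE)
  have "inv a = x [^] (-i) \<otimes> (inv b) [^] n"
    by (simp add: a inv_mult int_pow_neg nat_pow_inv)
  then show "inv a \<in> mod_pow_span N n x" by (rule mem_mod_pow_spanI [rotated]) simp
  fix a' assume "a' \<in> mod_pow_span N n x"
  then obtain j :: int and b' where [simp]: "b' \<in> N" and a': "a' = x [^] j \<otimes> b' [^] n"
    by (rule mem_mod_pow_spanE)
  have "a \<otimes> a' = x [^] (i + j) \<otimes> (b \<otimes> b') [^] n"
    by (simp add: a a' int_pow_mult nat_pow_distrib m_ac)
  then show "a \<otimes> a' \<in> mod_pow_span N n x" by (rule mem_mod_pow_spanI [rotated]) simp
qed

lemmas subgroup_mod_pow_span_carrier = subgroup_mod_pow_span_comm [OF subgroup_self]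

text \<open>Modulo \<open>q\<close>-th powers the new element is \<open>x^r\<close>, and a Bezout
  relation between \<open>r\<close> and \<open>q\<close> recovers \<open>x\<close>.\<close>

lemma mod_pow_span_coprime:
  assumes x [simp]: "x \<in> carrier G" and w [simp]: "w \<in> carrier G" and "coprime r q"
    and span: "mod_pow_span (carrier G) q x = carrier G"
  shows "mod_pow_span (carrier G) q (x [^] (r::nat) \<otimes> w [^] (q::nat)) = carrier G"
proof -
  let ?z = "x [^] r \<otimes> w [^] q"
  interpret S: subgroup "mod_pow_span (carrier G) q ?z" G
    by (rule subgroup_mod_pow_span_carrier) simp
  have pow: "b [^] q \<in> mod_pow_span (carrier G) q ?z" if "b \<in> carrier G" for b
    by (rule mem_mod_pow_spanI [OF that, of _ _ 0]) (use that in auto)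
  have z: "?z \<in> mod_pow_span (carrier G) q ?z"
    by (rule mem_mod_pow_spanI [of \<one> _ _ _ 1]) auto
  obtain u v :: int where uv: "u * int r + v * int q = 1"
    using \<open>coprime r q\<close> bezout_int [of "int r" "int q"] by auto
  have "?z \<otimes> inv (w [^] q) \<in> mod_pow_span (carrier G) q ?z"
    by (intro S.m_closed S.m_inv_closed z pow) simp
  then have xr: "x [^] r \<in> mod_pow_span (carrier G) q ?z"
    by (simp add: m_assoc)
  have "x = x [^] (u * int r + v * int q)" by (simp add: uv)
  also have "\<dots> = (x [^] r) [^] u \<otimes> (x [^] v) [^] q"
    by (simp add: int_pow_mult nat_pow_int_pow int_pow_nat_pow mult.commute)
  also have "\<dots> \<in> mod_pow_span (carrier G) q ?z"
    by (intro S.m_closed pow subgroup_int_pow_closed [OF S.subgroup_axioms] xr) simp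
  finally have xz: "x \<in> mod_pow_span (carrier G) q ?z" .
  have "a \<in> mod_pow_span (carrier G) q ?z" if "a \<in> carrier G" for a
  proof -
    obtain i :: int and b where "b \<in> carrier G" "a = x [^] i \<otimes> b [^] q"
      by (rule mem_mod_pow_spanE [of a "carrier G" q x]) (use \<open>a \<in> carrier G\<close> in \<open>auto simp: span\<close>)
    then show ?thesis
      by (simp add: S.m_closed pow subgroup_int_pow_closed [OF S.subgroup_axioms] xz)
  qed
  then show ?thesis using S.subset by blast
qed

text \<open>A Chinese remainder argument: \<open>z = x^p y^(\<Prod>P)\<close> is \<open>x^p\<close>
  up to a \<open>q\<close>-th power for each old prime \<open>q\<close>, and
  \<open>y^(\<Prod>P)\<close> up to a \<open>p\<close>-th power for the new prime
  \<open>p\<close>.\<close>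

lemma mod_pow_span_common_generator:
  assumes "finite P" "\<And>p. p \<in> P \<Longrightarrow> prime (p::nat)"
    and "\<And>p. p \<in> P \<Longrightarrow> \<exists>x\<in>carrier G. mod_pow_span (carrier G) p x = carrier G"
  shows "\<exists>x\<in>carrier G. \<forall>p\<in>P. mod_pow_span (carrier G) p x = carrier G"
  using assms
proof (induction P rule: finite_induct)
  case empty
  then show ?case by blast
next
  case (insert p P)
  obtain x where x [simp]: "x \<in> carrier G"
    and xs: "\<And>q. q \<in> P \<Longrightarrow> mod_pow_span (carrier G) q x = carrier G"
    using insert by auto
  obtain y where y [simp]: "y \<in> carrier G" and ys: "mod_pow_span (carrier G) p y = carrier G"
    using insert.prems(2) by blast
  define z where "z = x [^] p \<otimes> y [^] (\<Prod>P)"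
  have "mod_pow_span (carrier G) q z = carrier G" if "q \<in> P" for q
  proof -
    have q: "\<Prod>P = (\<Prod>P div q) * q" using that insert.hyps(1) by (metis dvd_div_mult_self dvd_prodI)
    have "z = x [^] p \<otimes> (y [^] (\<Prod>P div q)) [^] q"
      unfolding z_def by (simp add: nat_pow_pow q [symmetric])
    moreover have "coprime p q"
      using that insert.hyps(2) insert.prems(1) by (intro primes_coprime) auto
    ultimately show ?thesis
      using mod_pow_span_coprime [OF x _ _ xs [OF that], of "y [^] (\<Prod>P div q)" p] by simp
  qed
  moreover have "mod_pow_span (carrier G) p z = carrier G"
  proof -
    have "coprime (\<Prod>P) p"
      using insert.hyps(2) insert.prems(1) by (intro prod_coprime_left primes_coprime) auto
    then show ?thesis
      using mod_pow_span_coprime [OF y x _ ys, of "\<Prod>P"] by (simp add: z_def m_comm)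
  qed
  ultimately show ?case by (intro bexI [of _ z]) (auto simp: z_def)
qed

lemma mod_pow_span_mult:
  assumes x [simp]: "x \<in> carrier G"
    and m: "mod_pow_span (carrier G) m x = carrier G" and n: "mod_pow_span (carrier G) n x = carrier G"
  shows "mod_pow_span (carrier G) (m * n) x = carrier G"
proof -
  have "a \<in> mod_pow_span (carrier G) (m * n) x" if "a \<in> carrier G" for a
  proof -
    obtain i :: int and b where b [simp]: "b \<in> carrier G" and a: "a = x [^] i \<otimes> b [^] m"
      by (rule mem_mod_pow_spanE [of a "carrier G" m x]) (use \<open>a \<in> carrier G\<close> in \<open>auto simp: m\<close>)
    obtain j :: int and c where c [simp]: "c \<in> carrier G" and b': "b = x [^] j \<otimes> c [^] n"
      by (rule mem_mod_pow_spanE [of b "carrier G" n x]) (use b in \<open>auto simp: n\<close>)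
    have "a = x [^] (i + j * int m) \<otimes> c [^] (m * n)"
      unfolding a b' by (simp add: nat_pow_distrib nat_pow_int_pow nat_pow_pow int_pow_mult mult.commute m_ac)
    then show ?thesis by (rule mem_mod_pow_spanI [rotated]) simp
  qed
  then show ?thesis
    using subgroup.subset [OF subgroup_mod_pow_span_carrier [OF x]] by blast
qed

text \<open>Only the finitely many primes dividing \<open>n\<close> need a common generator.
  Generation modulo powers is multiplicative in the exponent, so it climbs along the divisors of
  \<open>n\<close> up to \<open>n\<close> itself, where the powers are trivial.\<close>

lemma cyclic_if_cyclic_mod_primes_carrier:
  assumes "n > 0" and exp: "\<And>x. x \<in> carrier G \<Longrightarrow> x [^] (n::nat) = \<one>"
    and primes: "\<And>p. prime p \<Longrightarrow> \<exists>x\<in>carrier G. mod_pow_span (carrier G) p x = carrier G"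
  shows "\<exists>x\<in>carrier G. generate G {x} = carrier G"
proof -
  obtain x where x [simp]: "x \<in> carrier G"
    and xs: "\<And>p. p \<in> prime_factors n \<Longrightarrow> mod_pow_span (carrier G) p x = carrier G"
    using mod_pow_span_common_generator [OF finite_set_mset, of "prime_factorization n"]
    by (meson in_prime_factors_imp_prime primes)
  have "mod_pow_span (carrier G) m x = carrier G" if "m dvd n" for m
    using that
  proof (induction m rule: prime_divisors_induct)
    case zero
    then show ?case using \<open>n > 0\<close> by simp
  next
    case (unit m)
    have "a \<in> mod_pow_span (carrier G) 1 x" if "a \<in> carrier G" for a
      by (rule mem_mod_pow_spanI [OF that, of _ _ 0]) (use that in auto)
    then show ?case
      using unit subgroup.subset [OF subgroup_mod_pow_span_carrier [OF x]] by auto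
  next
    case (factor p m)
    have "p \<in> prime_factors n"
      using factor \<open>n > 0\<close> by (simp add: prime_factors_dvd) (metis dvd_mult_left)
    then show ?case
      using mod_pow_span_mult [OF x xs factor.IH] factor.prems by (metis dvd_mult_right)
  qed
  then have n: "mod_pow_span (carrier G) n x = carrier G" by simp
  have "a \<in> generate G {x}" if "a \<in> carrier G" for a
  proof -
    have "a \<in> mod_pow_span (carrier G) n x" using that n by simp
    then obtain i :: int and b where "b \<in> carrier G" "a = x [^] i \<otimes> b [^] n"
      by (auto simp: mod_pow_span_def)
    then show ?thesis by (simp add: exp int_pow_in_generate)
  qed
  then show ?thesis using x generate_incl [of "{x}"] by blast
qed

end

context group begin

lemma comm_subgroup_imp_comm_group:
  assumes "subgroup M G" "\<And>x y. x \<in> M \<Longrightarrow> y \<in> M \<Longrightarrow> x \<otimes> y = y \<otimes> x"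
  shows "comm_group (G\<lparr>carrier := M\<rparr>)"
  by (rule group.group_comm_groupI [OF subgroup_imp_group [OF assms(1)]]) (use assms in auto)

lemma mod_pow_span_consistent:
  assumes E: "subgroup E G" and "x \<in> E"
  shows "group.mod_pow_span (G\<lparr>carrier := E\<rparr>) N n x = mod_pow_span N n x"
  unfolding group.mod_pow_span_def [OF subgroup_imp_group [OF E]] mod_pow_span_def
  using int_pow_consistent [OF assms] nat_pow_consistent by simp

lemma subgroup_mod_pow_span:
  assumes E: "subgroup E G" and comm: "\<And>x y. x \<in> E \<Longrightarrow> y \<in> E \<Longrightarrow> x \<otimes> y = y \<otimes> x"
    and N: "subgroup N G" "N \<subseteq> E" and "x \<in> E"
  shows "subgroup (mod_pow_span N n x) G"
proof -
  interpret E: comm_group "G\<lparr>carrier := E\<rparr>"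
    by (rule comm_subgroup_imp_comm_group [OF E comm])
  have "subgroup (mod_pow_span N n x) (G\<lparr>carrier := E\<rparr>)"
    using E.subgroup_mod_pow_span_comm [OF subgroup_incl [OF N(1) E N(2)], of x n] \<open>x \<in> E\<close>
      mod_pow_span_consistent [OF E \<open>x \<in> E\<close>] by simp
  then show ?thesis
    using incl_subgroup [OF E] by blast
qed

lemma cyclic_if_cyclic_mod_primes:
  assumes M: "subgroup M G" and comm: "\<And>x y. x \<in> M \<Longrightarrow> y \<in> M \<Longrightarrow> x \<otimes> y = y \<otimes> x"
    and n: "n > 0" "\<And>x. x \<in> M \<Longrightarrow> x [^] (n::nat) = \<one>"
    and primes: "\<And>p. prime p \<Longrightarrow> \<exists>x\<in>M. M \<subseteq> mod_pow_span M p x"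
  shows "\<exists>x\<in>M. generate G {x} = M"
proof -
  interpret M: comm_group "G\<lparr>carrier := M\<rparr>"
    by (rule comm_subgroup_imp_comm_group [OF M comm])
  have "\<exists>x\<in>M. M.mod_pow_span M p x = M" if "prime p" for p
  proof -
    obtain x where "x \<in> M" "M \<subseteq> mod_pow_span M p x" using primes [OF \<open>prime p\<close>] by blast
    then show ?thesis
      using mod_pow_span_consistent [OF M, of x M p]
        subgroup.subset [OF M.subgroup_mod_pow_span_carrier [of x p]] by auto
  qed
  then have "\<exists>x\<in>M. generate (G\<lparr>carrier := M\<rparr>) {x} = M"
    using M.cyclic_if_cyclic_mod_primes_carrier [of n] n nat_pow_consistent by simp
  then show ?thesis
    using generate_consistent [OF _ M] by auto
qed

text \<open>Both elements are powers of a generator \<open>w\<close> of \<open><x,y>\<close>, say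
  \<open>x = w^e\<close>. Since \<open>x\<close> is not a \<open>p\<close>-th power,
  \<open>p\<close> does not divide \<open>e\<close>, so modulo \<open>p\<close>-th powers
  \<open>w\<close> is a power of \<open>x\<close>, and therefore so is \<open>y\<close>.\<close>

lemma mem_mod_pow_span_if_cyclic:
  assumes M: "subgroup M G" and "prime (p::nat)" and c: "c \<in> carrier G"
    and xM: "x \<in> M" and npow: "\<And>b. b \<in> M \<Longrightarrow> x \<noteq> b [^] p" and yM: "y \<in> M"
    and cyc: "x \<in> generate G {c}" "y \<in> generate G {c}"
  shows "y \<in> mod_pow_span M p x"
proof -
  interpret M: subgroup M G by fact
  obtain i j :: int where i: "x = c [^] i" and j: "y = c [^] j"
    using cyc mem_generate_single [OF c] by auto
  \<comment> \<open>\<open>c\<close> may lie outside \<open>M\<close>, while \<open>p\<close>-th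
    roots of \<open>x\<close> are excluded only inside \<open>M\<close>; the exponent
    \<open>gcd i j\<close> gives a generator of \<open><x,y>\<close>, which does lie in
    \<open>M\<close>.\<close>
  obtain u v :: int where uv: "u * i + v * j = gcd i j" using bezout_int [of i j] by blast
  define w where "w = c [^] gcd i j"
  have "w = x [^] u \<otimes> y [^] v"
    unfolding w_def i j uv [symmetric] using c by (simp add: int_pow_mult int_pow_pow mult.commute)
  then have wM: "w \<in> M"
    using M subgroup_int_pow_closed xM yM by simp
  then have w [simp]: "w \<in> carrier G" by (rule M.mem_carrier)
  have x: "x = w [^] (i div gcd i j)" and y: "y = w [^] (j div gcd i j)"
    unfolding w_def using c by (simp_all add: int_pow_pow i j)
  let ?e = "i div gcd i j" and ?f = "j div gcd i j"
  have "\<not> int p dvd ?e"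
  proof
    assume "int p dvd ?e"
    then obtain t where "?e = t * int p" by (metis dvd_def mult.commute)
    then have "x = (w [^] t) [^] p" by (simp add: x nat_pow_int_pow)
    then show False using npow [of "w [^] t"] subgroup_int_pow_closed [OF M wM] by blast
  qed
  then have "coprime ?e (int p)"
    using \<open>prime p\<close> by (simp add: prime_imp_coprime coprime_commute)
  then obtain s t :: int where st: "s * ?e + t * int p = 1"
    using bezout_int [of ?e "int p"] by auto
  have "y = w [^] ((s * ?e + t * int p) * ?f)" using y st by simp
  also have "\<dots> = x [^] (s * ?f) \<otimes> (w [^] (t * ?f)) [^] p"
    by (simp add: x int_pow_pow nat_pow_int_pow int_pow_mult [symmetric] algebra_simps)
  finally show ?thesis
    by (rule mem_mod_pow_spanI [rotated]) (rule subgroup_int_pow_closed [OF M wM])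
qed

text \<open>Commutativity comes from the pairs. For a prime \<open>p\<close>, either
  \<open>S\<close> consists of \<open>p\<close>-th powers and the identity generates modulo
  \<open>p\<close>-th powers, or some \<open>s\<close> that is not a \<open>p\<close>-th power does,
  since every \<open>t\<close> shares a cyclic group with it.\<close>

lemma generate_cyclic_if_pairwise:
  assumes n: "n > 0" "\<And>x. x \<in> carrier G \<Longrightarrow> x [^] (n::nat) = \<one>"
    and S: "S \<subseteq> carrier G"
    and pairs: "\<And>s t. s \<in> S \<Longrightarrow> t \<in> S \<Longrightarrow> \<exists>c\<in>carrier G. s \<in> generate G {c} \<and> t \<in> generate G {c}"
  shows "\<exists>x\<in>generate G S. generate G {x} = generate G S"
proof (rule cyclic_if_cyclic_mod_primes [OF _ _ n])
  show M: "subgroup (generate G S) G" by (rule generate_is_subgroup [OF S])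
  show comm: "x \<otimes> y = y \<otimes> x" if "x \<in> generate G S" "y \<in> generate G S" for x y
    using generate_commute [OF S S _ that] pairs generate_single_commute by meson
  show "x \<in> carrier G" if "x \<in> generate G S" for x
    using that S generate_in_carrier by blast
  fix p :: nat assume p: "prime p"
  have span: "subgroup (mod_pow_span (generate G S) p x) G" if "x \<in> generate G S" for x
    by (rule subgroup_mod_pow_span [OF M comm M subset_refl that])
  show "\<exists>x\<in>generate G S. generate G S \<subseteq> mod_pow_span (generate G S) p x"
  proof (cases "\<forall>s\<in>S. \<exists>b\<in>generate G S. s = b [^] p")
    case True
    have "S \<subseteq> mod_pow_span (generate G S) p \<one>"
    proof
      fix s assume "s \<in> S"
      then obtain b where b: "b \<in> generate G S" "s = b [^] p" using True by blast
      moreover have "b \<in> carrier G" using b S generate_in_carrier by blast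
      ultimately show "s \<in> mod_pow_span (generate G S) p \<one>"
        by (intro mem_mod_pow_spanI [OF b(1), of _ _ 0]) auto
    qed
    then have "generate G S \<subseteq> mod_pow_span (generate G S) p \<one>"
      by (rule generate_subgroup_incl [OF _ span]) (rule generate.one)
    then show ?thesis using generate.one by blast
  next
    case False
    then obtain s where s: "s \<in> S" "\<And>b. b \<in> generate G S \<Longrightarrow> s \<noteq> b [^] p" by blast
    have "S \<subseteq> mod_pow_span (generate G S) p s"
    proof
      fix t assume t: "t \<in> S"
      obtain c where "c \<in> carrier G" "s \<in> generate G {c}" "t \<in> generate G {c}"
        using pairs [OF s(1) t] by blast
      then show "t \<in> mod_pow_span (generate G S) p s"
        by (intro mem_mod_pow_span_if_cyclic [OF M p]) (use s t in \<open>auto intro: generate.incl\<close>)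
    qed
    then have "generate G S \<subseteq> mod_pow_span (generate G S) p s"
      by (rule generate_subgroup_incl [OF _ span]) (rule generate.incl [OF s(1)])
    then show ?thesis using generate.incl [OF s(1)] by blast
  qed
qed

end

section \<open>Finite groups\<close>

context group begin

lemma normal_generate_commutators:
  assumes N: "N \<lhd> G"
  shows "generate G {commutator G l g | l g. l \<in> N \<and> g \<in> carrier G} \<lhd> G"
proof (rule normal_generateI)
  interpret normal N G by fact
  show "{commutator G l g | l g. l \<in> N \<and> g \<in> carrier G} \<subseteq> carrier G" by auto
  fix h g assume "h \<in> {commutator G l g | l g. l \<in> N \<and> g \<in> carrier G}" and g: "g \<in> carrier G"
  then obtain l x where "l \<in> N" "x \<in> carrier G" "h = commutator G l x" by blast
  then have "g \<otimes> h \<otimes> inv g = commutator G (g \<otimes> l \<otimes> inv g) (g \<otimes> x \<otimes> inv g)"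
    "g \<otimes> l \<otimes> inv g \<in> N" "g \<otimes> x \<otimes> inv g \<in> carrier G"
    using g conj_commutator inv_op_closed2 by auto
  then show "g \<otimes> h \<otimes> inv g \<in> {commutator G l g | l g. l \<in> N \<and> g \<in> carrier G}" by blast
qed

lemma normal_generate_self_commutators:
  assumes N: "N \<lhd> G"
  shows "generate G {commutator G k k' | k k'. k \<in> N \<and> k' \<in> N} \<lhd> G"
proof (rule normal_generateI)
  interpret normal N G by fact
  show "{commutator G k k' | k k'. k \<in> N \<and> k' \<in> N} \<subseteq> carrier G" by auto
  fix h g assume "h \<in> {commutator G k k' | k k'. k \<in> N \<and> k' \<in> N}" and g: "g \<in> carrier G"
  then obtain l x where "l \<in> N" "x \<in> N" "h = commutator G l x" by blast
  then have "g \<otimes> h \<otimes> inv g = commutator G (g \<otimes> l \<otimes> inv g) (g \<otimes> x \<otimes> inv g)"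
    "g \<otimes> l \<otimes> inv g \<in> N" "g \<otimes> x \<otimes> inv g \<in> N"
    using g conj_commutator inv_op_closed2 by auto
  then show "g \<otimes> h \<otimes> inv g \<in> {commutator G k k' | k k'. k \<in> N \<and> k' \<in> N}" by blast
qed

lemma rcoset_eq_iff:
  assumes "subgroup N G" "x \<in> carrier G" "y \<in> carrier G"
  shows "N #> x = N #> y \<longleftrightarrow> x \<otimes> inv y \<in> N"
proof
  interpret subgroup N G by fact
  assume "N #> x = N #> y"
  then have "x \<in> N #> y" using rcos_self assms by metis
  then obtain n where "n \<in> N" "x = n \<otimes> y" unfolding r_coset_def by auto
  then show "x \<otimes> inv y \<in> N" using assms by (simp add: m_assoc)
next
  interpret subgroup N G by fact
  assume "x \<otimes> inv y \<in> N"
  then have "x \<in> N #> y"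
    unfolding r_coset_def using assms by (intro UN_I [of "x \<otimes> inv y"]) (auto simp: m_assoc)
  then show "N #> x = N #> y" using repr_independence assms by metis
qed

text \<open>The usual factor \<open>[l,a]^k\<close> is written as \<open>[l,a] [[l,a],k]\<close>, so
  that all factors are commutators and can be placed in cyclic groups one by one.\<close>

lemma commutator_mult_right:
  assumes "l \<in> carrier G" "a \<in> carrier G" "k \<in> carrier G"
  shows "commutator G l (a \<otimes> k) =
    commutator G l k \<otimes> commutator G l a \<otimes> commutator G (commutator G l a) k"
  using assms by (simp add: commutator_def group_word_simps)

text \<open>Write \<open>M = [L,G]\<close>. Modulo \<open>K' = [K,K]\<close>, commutators \<open>[l,g]\<close> only depend on the coset of
  \<open>g\<close> modulo \<open>K\<close>, so by \<open>KL\<close> any two generators of \<open>M\<close> generate a cyclic group and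
  \<open>M = \<langle>c\<rangle>(M \<inter> K')\<close>. For a prime \<open>p\<close> with \<open>M \<inter> K' \<subseteq> M\<^sup>p\<close> this gives \<open>M = \<langle>c\<rangle>M\<^sup>p\<close>. Otherwise some
  \<open>z \<in> M \<inter> K'\<close> is not a \<open>p\<close>-th power, and every generator of \<open>M\<close> is a product of elements lying in
  a common cyclic group with \<open>z\<close>, so that \<open>M = \<langle>z\<rangle>M\<^sup>p\<close>.\<close>

lemma commutators_generate_cyclic:
  assumes n: "n > 0" "\<And>x. x \<in> carrier G \<Longrightarrow> x [^] (n::nat) = \<one>"
    and H: "H \<lhd> G" and K: "K \<lhd> G" and L: "L \<lhd> G" and KH: "K \<subseteq> H" and LK: "L \<subseteq> K"
    and c0: "c0 \<in> carrier G" "\<And>h h'. h \<in> H \<Longrightarrow> h' \<in> H \<Longrightarrow> commutator G h h' \<in> generate G {c0}"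
    and HK: "\<And>g. g \<in> carrier G \<Longrightarrow> \<exists>a\<in>carrier G. \<exists>c\<in>carrier G. inv a \<otimes> g \<in> H \<and>
      (\<forall>k\<in>K. commutator G k a \<in> generate G {c} \<and> (\<forall>k'\<in>K. commutator G k k' \<in> generate G {c}))"
    and KL: "\<And>g g'. g \<in> carrier G \<Longrightarrow> g' \<in> carrier G \<Longrightarrow>
      \<exists>a\<in>carrier G. \<exists>b\<in>carrier G. \<exists>c\<in>carrier G. inv a \<otimes> g \<in> K \<and> inv b \<otimes> g' \<in> K \<and>
      (\<forall>l\<in>L. commutator G l a \<in> generate G {c} \<and> commutator G l b \<in> generate G {c})"
  defines "M \<equiv> generate G {commutator G l g | l g. l \<in> L \<and> g \<in> carrier G}"
  shows "\<exists>x\<in>M. generate G {x} = M"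
proof -
  define S where "S = {commutator G l g | l g. l \<in> L \<and> g \<in> carrier G}"
  define T where "T = {commutator G k k' | k k'. k \<in> K \<and> k' \<in> K}"
  define K' where "K' = generate G T"
  interpret H: normal H G by fact
  interpret K: normal K G by fact
  interpret L: normal L G by fact
  interpret K': normal K' G
    unfolding K'_def T_def by (rule normal_generate_self_commutators [OF K])
  have S: "S \<subseteq> carrier G" unfolding S_def by auto
  have T: "T \<subseteq> carrier G" unfolding T_def by auto
  have M_S: "M = generate G S" unfolding M_def S_def ..
  have sgM: "subgroup M G" unfolding M_S by (rule generate_is_subgroup [OF S])
  interpret M: subgroup M G by (rule sgM)
  have commM: "commutator G l g \<in> M" if "l \<in> L" "g \<in> carrier G" for l g
    unfolding M_S S_def using that by (auto intro: generate.incl)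
  have M_le_L: "M \<subseteq> L"
    unfolding M_S by (rule generate_subgroup_incl [OF _ L.subgroup_axioms])
      (auto simp: S_def normal_commutator_mem [OF L])
  have K'_cyc: "\<exists>z\<in>K'. generate G {z} = K'"
    unfolding K'_def
  proof (rule generate_cyclic_if_pairwise [OF n T])
    obtain c where c: "c \<in> carrier G" "\<forall>k\<in>K. \<forall>k'\<in>K. commutator G k k' \<in> generate G {c}"
      using HK [of \<one>] by auto
    fix s t assume "s \<in> T" "t \<in> T"
    then show "\<exists>c\<in>carrier G. s \<in> generate G {c} \<and> t \<in> generate G {c}"
      using c unfolding T_def by blast
  qed
  have K'_in: "K' \<subseteq> generate G {c}"
    if "c \<in> carrier G" "\<And>k k'. k \<in> K \<Longrightarrow> k' \<in> K \<Longrightarrow> commutator G k k' \<in> generate G {c}" for c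
    unfolding K'_def using that
    by (intro generate_subgroup_incl generate_is_subgroup) (auto simp: T_def)
  \<comment> \<open>\<open>K'\<close> is cyclic and normal, so every commutator centralizes its
    generator; and \<open>M\<close> is generated by commutators.\<close>
  have central: "x \<otimes> y = y \<otimes> x" if "x \<in> M" "y \<in> K'" for x y
  proof -
    obtain z where z: "z \<in> K'" "generate G {z} = K'" using K'_cyc by blast
    have "s \<otimes> z = z \<otimes> s" if "s \<in> S" for s
      using that z conj_by_commutator_trivial [of z] K'.normal_axioms K'.mem_carrier
      unfolding S_def by auto
    then show ?thesis
      using generate_commute [OF S, of "{z}" x y] that z K'.mem_carrier M_S by auto
  qed
  have "\<exists>c\<in>M. \<forall>x\<in>M. \<exists>i::int. x \<otimes> inv (c [^] i) \<in> K'"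
  proof -
    interpret Q: group "G Mod K'" by (rule K'.factorgroup_is_group)
    let ?\<pi> = "\<lambda>x. K' #> x"
    interpret \<pi>: group_hom G "G Mod K'" ?\<pi>
      using K'.r_coset_hom_Mod by unfold_locales
    \<comment> \<open>With \<open>g = ak\<close>, the extra factors \<open>[l,k]\<close> and
      \<open>[[l,a],k]\<close> have both entries in \<open>K\<close>, because \<open>l\<close> and
      \<open>[l,a]\<close> lie in \<open>L\<close>; they disappear modulo \<open>K'\<close>.\<close>
    have shift: "?\<pi> (commutator G l g) = ?\<pi> (commutator G l a)"
      if "l \<in> L" "g \<in> carrier G" "a \<in> carrier G" "inv a \<otimes> g \<in> K" for l g a
    proof -
      let ?k = "inv a \<otimes> g" and ?w = "commutator G l a"
      have [simp]: "l \<in> carrier G" using that by auto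
      have lK: "l \<in> K" and wK: "?w \<in> K"
        using that LK normal_commutator_mem [OF L] by auto
      have g: "g = a \<otimes> ?k" using that by (simp add: cancel_inv_left)
      have "commutator G l g = commutator G l ?k \<otimes> ?w \<otimes> commutator G ?w ?k"
        by (subst g, subst commutator_mult_right) (use that in auto)
      then have "commutator G l g \<otimes> inv ?w =
          commutator G l ?k \<otimes> (?w \<otimes> commutator G ?w ?k \<otimes> inv ?w)"
        using that by (simp add: m_assoc)
      also have "\<dots> \<in> K'"
        using that lK wK unfolding K'_def T_def
        by (intro generate.eng K'.inv_op_closed2 [unfolded K'_def T_def] generate.incl) auto
      finally show ?thesis
        using that by (simp add: rcoset_eq_iff [OF K'.subgroup_axioms])
    qed
    have "\<exists>x\<in>generate (G Mod K') (?\<pi> ` S). generate (G Mod K') {x} = generate (G Mod K') (?\<pi> ` S)"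
    proof (rule Q.generate_cyclic_if_pairwise [OF n(1)])
      show "?\<pi> ` S \<subseteq> carrier (G Mod K')" using S by auto
      show "x [^]\<^bsub>G Mod K'\<^esub> n = \<one>\<^bsub>G Mod K'\<^esub>" if x: "x \<in> carrier (G Mod K')" for x
      proof -
        obtain y where "y \<in> carrier G" "x = ?\<pi> y"
          using x by (auto simp: carrier_FactGroup)
        then show ?thesis
          using \<pi>.hom_nat_pow [of y n] n(2) \<pi>.hom_one by simp
      qed
      fix s t assume "s \<in> ?\<pi> ` S" "t \<in> ?\<pi> ` S"
      then obtain l g l' g' where l: "l \<in> L" "g \<in> carrier G" "s = ?\<pi> (commutator G l g)"
        "l' \<in> L" "g' \<in> carrier G" "t = ?\<pi> (commutator G l' g')"
        unfolding S_def by blast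
      obtain a b c where abc: "a \<in> carrier G" "b \<in> carrier G" "c \<in> carrier G"
        "inv a \<otimes> g \<in> K" "inv b \<otimes> g' \<in> K"
        "\<And>l. l \<in> L \<Longrightarrow> commutator G l a \<in> generate G {c} \<and> commutator G l b \<in> generate G {c}"
        using KL [OF l(2) l(5)] by blast
      have "s \<in> ?\<pi> ` generate G {c}" "t \<in> ?\<pi> ` generate G {c}"
        unfolding l(3) l(6) shift [OF l(1,2) abc(1,4)] shift [OF l(4,5) abc(2,5)]
        using abc(6) l(1,4) by blast+
      then show "\<exists>c\<in>carrier (G Mod K'). s \<in> generate (G Mod K') {c} \<and> t \<in> generate (G Mod K') {c}"
        using abc(3) \<pi>.generate_img [of "{c}"] by (intro bexI [of _ "?\<pi> c"]) auto
    qed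
    then obtain c where c: "c \<in> M"
      "generate (G Mod K') {?\<pi> c} = ?\<pi> ` M"
      unfolding M_S using \<pi>.generate_img [OF S] by auto
    have "\<exists>i::int. x \<otimes> inv (c [^] i) \<in> K'" if "x \<in> M" for x
    proof -
      have "?\<pi> x \<in> generate (G Mod K') {?\<pi> c}" using that c by simp
      then obtain i :: int where "?\<pi> x = ?\<pi> c [^]\<^bsub>G Mod K'\<^esub> i"
        using Q.mem_generate_single [of "?\<pi> c"] c by auto
      then have "?\<pi> x = ?\<pi> (c [^] i)" using \<pi>.hom_int_pow c by simp
      then show ?thesis
        using that c by (auto simp: rcoset_eq_iff [OF K'.subgroup_axioms])
    qed
    then show ?thesis using c by blast
  qed
  then obtain c where c: "c \<in> M" "\<And>x. x \<in> M \<Longrightarrow> \<exists>i::int. x \<otimes> inv (c [^] i) \<in> K'" by blast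
  have decomp: "\<exists>(i::int) z. z \<in> M \<and> z \<in> K' \<and> x = c [^] i \<otimes> z" if x: "x \<in> M" for x
  proof -
    obtain i :: int where i: "x \<otimes> inv (c [^] i) \<in> K'" using c x by blast
    let ?z = "x \<otimes> inv (c [^] i)"
    have ci: "c [^] i \<in> M" by (rule subgroup_int_pow_closed [OF sgM c(1)])
    then have "?z \<in> M" using x by simp
    moreover have "x = ?z \<otimes> c [^] i" using x ci by (simp add: m_assoc)
    moreover have "?z \<otimes> c [^] i = c [^] i \<otimes> ?z" using central [OF ci i] by simp
    ultimately show ?thesis using i by metis
  qed
  \<comment> \<open>\<open>M\<close> is generated by the single element \<open>c\<close> and by
    \<open>M \<inter> K'\<close>, whose elements commute with all of \<open>M\<close>.\<close>
  have comm: "x \<otimes> y = y \<otimes> x" if xy: "x \<in> M" "y \<in> M" for x y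
  proof -
    have sub: "insert c (M \<inter> K') \<subseteq> carrier G" using c(1) by auto
    have gen: "u \<in> generate G (insert c (M \<inter> K'))" if u: "u \<in> M" for u
    proof -
      obtain i :: int and z where "z \<in> M" "z \<in> K'" "u = c [^] i \<otimes> z" using decomp u by blast
      moreover have "c [^] i \<in> generate G (insert c (M \<inter> K'))"
        by (intro subgroup_int_pow_closed generate_is_subgroup sub generate.incl) auto
      ultimately show ?thesis
        using generate.eng [OF _ generate.incl, of "c [^] i" G "insert c (M \<inter> K')" z] by simp
    qed
    have "s \<otimes> t = t \<otimes> s" if "s \<in> insert c (M \<inter> K')" "t \<in> insert c (M \<inter> K')" for s t
      using that central [of s t] central [of t s] c(1) by auto
    from generate_commute [OF sub sub this gen gen] xy show ?thesis by blast
  qed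
  show ?thesis
  proof (rule cyclic_if_cyclic_mod_primes [OF sgM comm n(1)])
    show "x [^] n = \<one>" if "x \<in> M" for x using that n(2) by auto
    fix p :: nat assume p: "prime p"
    show "\<exists>x\<in>M. M \<subseteq> mod_pow_span M p x"
    proof (cases "\<forall>z\<in>M \<inter> K'. \<exists>b\<in>M. z = b [^] p")
      case True
      have "M \<subseteq> mod_pow_span M p c"
      proof
        fix x assume "x \<in> M"
        then obtain i :: int and z where "z \<in> M" "z \<in> K'" "x = c [^] i \<otimes> z" using decomp by blast
        moreover then obtain b where "b \<in> M" "z = b [^] p" using True by blast
        ultimately show "x \<in> mod_pow_span M p c" by (intro mem_mod_pow_spanI) auto
      qed
      then show ?thesis using c(1) by blast
    next
      case False
      then obtain z where z: "z \<in> M" "z \<in> K'" "\<And>b. b \<in> M \<Longrightarrow> z \<noteq> b [^] p" by blast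
      interpret P: subgroup "mod_pow_span M p z" G
        by (rule subgroup_mod_pow_span [OF sgM comm sgM subset_refl z(1)])
      \<comment> \<open>A cyclic group containing all \<open>[k,k']\<close> contains
        \<open>K'\<close> and with it \<open>z\<close>, so every element of \<open>M\<close> in such
        a group can be compared with \<open>z\<close>.\<close>
      have in_span: "y \<in> mod_pow_span M p z"
        if "d \<in> carrier G" "y \<in> M" "y \<in> generate G {d}"
          "\<And>k k'. k \<in> K \<Longrightarrow> k' \<in> K \<Longrightarrow> commutator G k k' \<in> generate G {d}" for d y
        by (rule mem_mod_pow_span_if_cyclic [OF sgM p that(1)])
          (use that z K'_in [OF that(1)] in auto)
      have "S \<subseteq> mod_pow_span M p z"
      proof
        fix s assume "s \<in> S"
        then obtain l g where l: "l \<in> L" and g: "g \<in> carrier G" and s: "s = commutator G l g"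
          unfolding S_def by blast
        obtain a d where ad: "a \<in> carrier G" "d \<in> carrier G" "inv a \<otimes> g \<in> H"
          "\<And>k. k \<in> K \<Longrightarrow> commutator G k a \<in> generate G {d}"
          "\<And>k k'. k \<in> K \<Longrightarrow> k' \<in> K \<Longrightarrow> commutator G k k' \<in> generate G {d}"
          using HK [OF g] by blast
        let ?h = "inv a \<otimes> g" and ?w = "commutator G l a"
        have wL: "?w \<in> L" using l ad normal_commutator_mem [OF L] by auto
        have "g = a \<otimes> ?h" using g ad by (simp add: cancel_inv_left)
        \<comment> \<open>The outer factors have both entries in \<open>H\<close> and lie in
          \<open><c0>\<close>, the middle one lies in \<open><d>\<close>; both cyclic groups contain
          \<open>K'\<close>.\<close>
        then have s': "s = commutator G l ?h \<otimes> ?w \<otimes> commutator G ?w ?h"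
          unfolding s using commutator_mult_right [of l a ?h] l g ad by simp
        have c0K: "commutator G k k' \<in> generate G {c0}" if "k \<in> K" "k' \<in> K" for k k'
          using that KH by (intro c0(2)) auto
        have lw: "l \<in> H" "?w \<in> H" "l \<in> K" using l wL LK KH by auto
        have 1: "commutator G l ?h \<in> mod_pow_span M p z"
          by (rule in_span [OF c0(1)]) (use l g ad lw c0K c0(2) commM in simp_all)
        have 2: "?w \<in> mod_pow_span M p z"
          by (rule in_span [OF ad(2)]) (use l lw ad commM in simp_all)
        have 3: "commutator G ?w ?h \<in> mod_pow_span M p z"
          by (rule in_span [OF c0(1)]) (use wL g ad lw c0K c0(2) commM in simp_all)
        show "s \<in> mod_pow_span M p z" unfolding s' by (intro P.m_closed 1 2 3)
      qed
      then have "M \<subseteq> mod_pow_span M p z"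
        unfolding M_S by (rule generate_subgroup_incl) (rule P.subgroup_axioms [unfolded M_S])
      then show ?thesis using z by blast
    qed
  qed
qed

end

section \<open>Schur's theorem\<close>

context group begin

definition list_prod :: "'a list \<Rightarrow> 'a" where
  "list_prod xs = foldr (\<otimes>) xs \<one>"

lemma list_prod_simps [simp]:
  "list_prod [] = \<one>" "list_prod (x # xs) = x \<otimes> list_prod xs"
  by (simp_all add: list_prod_def)

lemma list_prod_closed [simp]: "set xs \<subseteq> carrier G \<Longrightarrow> list_prod xs \<in> carrier G"
  by (induction xs) auto

lemma list_prod_append:
  "set xs \<subseteq> carrier G \<Longrightarrow> set ys \<subseteq> carrier G \<Longrightarrow> list_prod (xs @ ys) = list_prod xs \<otimes> list_prod ys"
  by (induction xs) (auto simp: m_assoc)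

lemma list_prod_replicate: "x \<in> carrier G \<Longrightarrow> list_prod (replicate n x) = x [^] n"
  by (induction n) (simp_all add: nat_pow_Suc2 [symmetric])

text \<open>Pulling copies of \<open>c\<close> to the front past \<open>x\<close> replaces
  \<open>x\<close> by a conjugate, which is still in \<open>S\<close>; the number of factors does
  not change.\<close>

lemma list_prod_collect:
  assumes S: "S \<subseteq> carrier G" and conj: "\<And>s g. s \<in> S \<Longrightarrow> g \<in> carrier G \<Longrightarrow> inv g \<otimes> s \<otimes> g \<in> S"
    and "c \<in> S" "set xs \<subseteq> S" "k \<le> count_list xs c"
  shows "\<exists>ys. set ys \<subseteq> S \<and> length ys + k = length xs \<and> list_prod xs = c [^] k \<otimes> list_prod ys"
  using assms(4,5)
proof (induction xs arbitrary: k)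
  case Nil
  then show ?case by (intro exI [of _ "[]"]) auto
next
  case (Cons x xs)
  have [simp]: "c \<in> carrier G" "x \<in> carrier G" using \<open>c \<in> S\<close> Cons.prems(1) S by auto
  have xs: "list_prod xs \<in> carrier G" using Cons.prems(1) S by auto
  consider "k = 0" | k' where "k = Suc k'" "x = c" | "x \<noteq> c" by (cases k) auto
  then show ?case
  proof cases
    case 1
    then show ?thesis using Cons.prems xs by (intro exI [of _ "x # xs"]) auto
  next
    case (2 k')
    then obtain ys where ys: "set ys \<subseteq> S" "length ys + k' = length xs"
      "list_prod xs = c [^] k' \<otimes> list_prod ys"
      using Cons.IH [of k'] Cons.prems by auto
    moreover have "list_prod ys \<in> carrier G" using ys S by auto
    ultimately show ?thesis
      using 2 nat_pow_Suc2 [of c k'] by (intro exI [of _ ys]) (auto simp: m_assoc [symmetric])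
  next
    case 3
    then obtain ys where ys: "set ys \<subseteq> S" "length ys + k = length xs"
      "list_prod xs = c [^] k \<otimes> list_prod ys"
      using Cons.IH [of k] Cons.prems by auto
    have "list_prod ys \<in> carrier G" using ys S by auto
    then have "list_prod (x # xs) = c [^] k \<otimes> list_prod ((inv (c [^] k) \<otimes> x \<otimes> c [^] k) # ys)"
      using ys(3) by (simp add: group_word_simps)
    moreover have "inv (c [^] k) \<otimes> x \<otimes> c [^] k \<in> S" using Cons.prems(1) by (intro conj) auto
    ultimately show ?thesis using ys
      by (intro exI [of _ "(inv (c [^] k) \<otimes> x \<otimes> c [^] k) # ys"]) auto
  qed
qed

text \<open>Dietzmann's argument: a product of many elements of \<open>S\<close> contains some \<open>c \<in> S\<close> at least \<open>n + 1\<close>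
  times; collecting these factors on the left makes the product one factor shorter.\<close>

lemma finite_generate_if_powers_shorten:
  assumes S: "S \<subseteq> carrier G" "finite S"
    and conj: "\<And>s g. s \<in> S \<Longrightarrow> g \<in> carrier G \<Longrightarrow> inv g \<otimes> s \<otimes> g \<in> S"
    and inv: "\<And>s. s \<in> S \<Longrightarrow> inv s \<in> S"
    and shorten: "\<And>c. c \<in> S \<Longrightarrow> \<exists>ys. set ys \<subseteq> S \<and> length ys = n \<and> c [^] Suc n = list_prod ys"
  shows "finite (generate G S)"
proof -
  \<comment> \<open>\<open>card S * n\<close> is the pigeonhole bound: a longer list contains some
    element of \<open>S\<close> more than \<open>n\<close> times.\<close>
  define W where "W = {xs. set xs \<subseteq> S \<and> length xs \<le> card S * n}"
  have short: "list_prod xs \<in> list_prod ` W" if "set xs \<subseteq> S" for xs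
    using that
  proof (induction "length xs" arbitrary: xs rule: less_induct)
    case less
    show ?case
    proof (cases "length xs \<le> card S * n")
      case True
      then show ?thesis using less.prems by (auto simp: W_def)
    next
      case False
      have "\<exists>c\<in>S. n < count_list xs c"
      proof (rule ccontr)
        assume "\<not> (\<exists>c\<in>S. n < count_list xs c)"
        then have "(\<Sum>c\<in>S. count_list xs c) \<le> card S * n"
          by (intro sum_bounded_above [where K = n, simplified]) auto
        then show False using False sum_count_set [OF less.prems S(2)] by simp
      qed
      then obtain c where c: "c \<in> S" "Suc n \<le> count_list xs c" by auto
      obtain ys where ys: "set ys \<subseteq> S" "length ys + Suc n = length xs"
        "list_prod xs = c [^] Suc n \<otimes> list_prod ys"
        using list_prod_collect [OF S(1) conj c(1) less.prems c(2)] by blast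
      obtain zs where zs: "set zs \<subseteq> S" "length zs = n" "c [^] Suc n = list_prod zs"
        using shorten c by blast
      have "list_prod xs = list_prod (zs @ ys)"
        using ys zs S by (subst list_prod_append) auto
      moreover have "list_prod (zs @ ys) \<in> list_prod ` W"
        using ys zs by (intro less.hyps) auto
      ultimately show ?thesis by simp
    qed
  qed
  have "x \<in> list_prod ` {xs. set xs \<subseteq> S}" if "x \<in> generate G S" for x
    using that
  proof (induction rule: generate.induct)
    case one
    show ?case by (rule image_eqI [of _ _ "[]"]) auto
  next
    case (incl h)
    then show ?case using S by (intro image_eqI [of _ _ "[h]"]) auto
  next
    case (inv h)
    then show ?case using S assms(4) by (intro image_eqI [of _ _ "[inv h]"]) auto
  next
    case (eng h1 h2)
    then obtain xs ys where "set xs \<subseteq> S" "h1 = list_prod xs" "set ys \<subseteq> S" "h2 = list_prod ys" by blast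
    then show ?case
      using S by (intro image_eqI [of _ _ "xs @ ys"]) (auto simp: list_prod_append)
  qed
  then have "generate G S \<subseteq> list_prod ` W" using short by blast
  moreover have "finite W" unfolding W_def using finite_lists_length_le [OF S(2)] by simp
  ultimately show ?thesis by (meson finite_imageI finite_subset)
qed

text \<open>The power \<open>c\<^sup>n\<^sup>+\<^sup>1\<close> of \<open>c = [x,y]\<close> is a product of \<open>n\<close> commutators because
  \<open>c\<^sup>n\<close> is central: \<open>c\<^sup>n\<^sup>+\<^sup>1 = (x\<^sup>-\<^sup>1y\<^sup>-\<^sup>1x) c\<^sup>n y = [x,y\<^sup>2] (y\<^sup>-\<^sup>1cy)\<^sup>n\<^sup>-\<^sup>1\<close>.\<close>

lemma finite_generate_commutators:
  assumes Z: "subgroup Z G" and central: "\<And>z x. z \<in> Z \<Longrightarrow> x \<in> carrier G \<Longrightarrow> z \<otimes> x = x \<otimes> z"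
    and fin: "finite (rcosets Z)"
  shows "finite (generate G (commutators G))"
proof -
  interpret Z: subgroup Z G by fact
  interpret Z: normal Z G
    unfolding normal_inv_iff
  proof (intro conjI ballI Z)
    fix x h assume "x \<in> carrier G" "h \<in> Z"
    then show "x \<otimes> h \<otimes> inv x \<in> Z" using central [of h x, symmetric] by (simp add: m_assoc)
  qed
  interpret Q: group "G Mod Z" by (rule Z.factorgroup_is_group)
  define n where "n = card (rcosets Z)"
  have "n > 0" unfolding n_def using fin Z.subgroup_in_rcosets [OF is_group] by (auto simp: card_gt_0_iff)
  have pow: "x [^] n \<in> Z" if "x \<in> carrier G" for x
  proof -
    have "(Z #> x) [^]\<^bsub>G Mod Z\<^esub> n = \<one>\<^bsub>G Mod Z\<^esub>"
      using Q.pow_order_eq_1 [of "Z #> x"] that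
      by (simp add: n_def Coset.order_def FactGroup_def rcosetsI Z.subset)
    then have "Z #> (x [^] n) = Z" using that by (simp add: Z.FactGroup_pow)
    then show ?thesis using that coset_join1 Z by (metis nat_pow_closed Z.subset)
  qed
  define rep where "rep X = (SOME x. x \<in> carrier G \<and> X = Z #> x)" for X
  have rep: "\<exists>z\<in>Z. x = z \<otimes> rep (Z #> x)" "rep (Z #> x) \<in> carrier G" if "x \<in> carrier G" for x
  proof -
    have r: "rep (Z #> x) \<in> carrier G \<and> Z #> x = Z #> rep (Z #> x)"
      unfolding rep_def by (rule someI [of _ x]) (use that in auto)
    then have "x \<in> Z #> rep (Z #> x)" using rcos_self [OF that Z] by auto
    then show "\<exists>z\<in>Z. x = z \<otimes> rep (Z #> x)" by (auto simp: r_coset_def)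
    show "rep (Z #> x) \<in> carrier G" using r by blast
  qed
  \<comment> \<open>A commutator depends only on the cosets of its entries modulo \<open>Z\<close>,
    so finitely many cosets leave finitely many commutators.\<close>
  have drop: "commutator G (z \<otimes> x) (w \<otimes> y) = commutator G x y"
    if "z \<in> Z" "w \<in> Z" "x \<in> carrier G" "y \<in> carrier G" for z w x y
  proof -
    have [simp]: "z \<in> carrier G" "w \<in> carrier G" using that by auto
    have "commutator G (z \<otimes> x) (w \<otimes> y) = inv x \<otimes> inv z \<otimes> inv y \<otimes> inv w \<otimes> (z \<otimes> (x \<otimes> w)) \<otimes> y"
      using that by (simp add: commutator_def group_word_simps)
    also have "z \<otimes> (x \<otimes> w) = w \<otimes> (x \<otimes> z)"
      using that by (simp add: central [symmetric] m_assoc [symmetric])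
    also have "inv x \<otimes> inv z \<otimes> inv y \<otimes> inv w \<otimes> (w \<otimes> (x \<otimes> z)) \<otimes> y = inv x \<otimes> (inv z \<otimes> (inv y \<otimes> x)) \<otimes> (z \<otimes> y)"
      using that by (simp add: group_word_simps)
    also have "\<dots> = commutator G x y"
      using that central [of "inv z" "inv y \<otimes> x"] by (simp add: commutator_def group_word_simps)
    finally show ?thesis .
  qed
  have "commutators G \<subseteq> (\<lambda>(X, Y). commutator G (rep X) (rep Y)) ` ((rcosets Z) \<times> (rcosets Z))"
  proof
    fix c assume "c \<in> commutators G"
    then obtain x y where xy: "x \<in> carrier G" "y \<in> carrier G" "c = commutator G x y"
      by (auto simp: commutators_def)
    then have "c = commutator G (rep (Z #> x)) (rep (Z #> y))"
      using rep drop by metis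
    then show "c \<in> (\<lambda>(X, Y). commutator G (rep X) (rep Y)) ` ((rcosets Z) \<times> (rcosets Z))"
      using xy Z.subset by (intro image_eqI [of _ _ "(Z #> x, Z #> y)"]) (auto intro: rcosetsI)
  qed
  then have finS: "finite (commutators G)"
    using fin by (meson finite_SigmaI finite_imageI finite_subset)
  show ?thesis
  proof (rule finite_generate_if_powers_shorten [OF _ finS, where n = n])
    show "commutators G \<subseteq> carrier G" by (auto simp: commutators_def)
    show "inv g \<otimes> s \<otimes> g \<in> commutators G" if s: "s \<in> commutators G" and g: "g \<in> carrier G" for s g
    proof -
      obtain x y where "x \<in> carrier G" "y \<in> carrier G" "s = commutator G x y"
        using s by (auto simp: commutators_def)
      then have "inv g \<otimes> s \<otimes> g = commutator G (inv g \<otimes> x \<otimes> g) (inv g \<otimes> y \<otimes> g)"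
        using conj_commutator [of x y "inv g"] g by simp
      then show ?thesis
        using \<open>x \<in> carrier G\<close> \<open>y \<in> carrier G\<close> g unfolding commutators_def by blast
    qed
    show "inv s \<in> commutators G" if "s \<in> commutators G" for s
      using that inv_commutator unfolding commutators_def by auto
    fix c assume "c \<in> commutators G"
    then obtain x y where xy [simp]: "x \<in> carrier G" "y \<in> carrier G" and c: "c = commutator G x y"
      by (auto simp: commutators_def)
    have [simp]: "c \<in> carrier G" by (simp add: c)
    \<comment> \<open>One leading commutator and \<open>m = n - 1\<close> copies of \<open>d\<close>
      will make \<open>n\<close> factors, one fewer than in \<open>c^(n+1)\<close>.\<close>
    obtain m where m: "n = Suc m" using \<open>n > 0\<close> gr0_implies_Suc by blast
    define d where "d = commutator G (inv y \<otimes> x \<otimes> y) y"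
    have d: "d = inv y \<otimes> c \<otimes> y" by (simp add: d_def c commutator_def group_word_simps)
    have [simp]: "d \<in> carrier G" by (simp add: d_def)
    have d_pow: "d [^] k = inv y \<otimes> c [^] k \<otimes> y" for k :: nat
      using conj_int_pow [of c "inv y" "int k"] by (simp add: d int_pow_int)
    have "c [^] Suc n = c [^] n \<otimes> (inv x \<otimes> inv y \<otimes> x) \<otimes> y"
      by (simp add: c commutator_def m_assoc)
    also have "\<dots> = (inv x \<otimes> inv y \<otimes> x) \<otimes> c [^] n \<otimes> y"
      by (subst central) (auto intro: pow)
    also have "\<dots> = commutator G x (y \<otimes> y) \<otimes> d [^] m"
      unfolding d_pow m nat_pow_Suc2 [OF \<open>c \<in> carrier G\<close>]
      by (simp add: c commutator_def group_word_simps)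
    also have "\<dots> = list_prod (commutator G x (y \<otimes> y) # replicate m d)"
      by (simp add: list_prod_replicate)
    finally have "c [^] Suc n = list_prod (commutator G x (y \<otimes> y) # replicate m d)" .
    moreover have "set (commutator G x (y \<otimes> y) # replicate m d) \<subseteq> commutators G"
      by (auto simp: commutators_def d_def intro!: exI)
    ultimately show "\<exists>ys. set ys \<subseteq> commutators G \<and> length ys = n \<and> c [^] Suc n = list_prod ys"
      by (intro exI [of _ "commutator G x (y \<otimes> y) # replicate m d"]) (simp add: m)
  qed
qed

end

section \<open>Profinite groups\<close>

context topological_group begin

lemma topspace_T [simp]: "topspace T = carrier G"
  by (rule topspace_eq_carrier)

lemma continuous_map_mult_group:
  assumes "continuous_map X T f" "continuous_map X T g"
  shows "continuous_map X T (\<lambda>x. f x \<otimes> g x)"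
  using continuous_map_compose [OF continuous_map_pairedI [OF assms] continuous_mult]
  by (simp add: o_def)

lemma continuous_map_inv_group:
  assumes "continuous_map X T f"
  shows "continuous_map X T (\<lambda>x. inv (f x))"
  using continuous_map_compose [OF assms continuous_inv] by (simp add: o_def)

lemma continuous_map_nat_pow: "continuous_map T T (\<lambda>x. x [^] (n::nat))"
  by (induction n) (auto intro: continuous_map_mult_group)

lemmas continuous_group_intros =
  continuous_map_mult_group continuous_map_inv_group continuous_map_fst continuous_map_snd
  continuous_map_id [unfolded id_def] continuous_map_const [THEN iffD2]

text \<open>The tube lemma. It is applied to translation, with \<open>C\<close> compact and open,
  and to conjugation, with \<open>C\<close> the whole group.\<close>

lemma openin_forall_compact:
  assumes f: "continuous_map (prod_topology T T) T (\<lambda>(c, x). f c x)" and C: "compactin T C"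
    and V: "openin T V"
  shows "openin T {x \<in> carrier G. \<forall>c\<in>C. f c x \<in> V}"
proof (subst openin_subopen, intro ballI)
  fix x assume x: "x \<in> {x \<in> carrier G. \<forall>c\<in>C. f c x \<in> V}"
  let ?W = "{p \<in> topspace (prod_topology T T). (case p of (c, x) \<Rightarrow> f c x) \<in> V}"
  have W: "openin (prod_topology T T) ?W" by (rule openin_continuous_map_preimage [OF f V])
  have CG: "C \<subseteq> carrier G" using compactin_subset_topspace [OF C] by simp
  then have sub: "C \<times> {x} \<subseteq> ?W" using x by auto
  obtain A B where AB: "openin T A" "openin T B" "C \<subseteq> A" "x \<in> B" "A \<times> B \<subseteq> ?W"
    using tube_lemma_left [OF W C _ sub] x by auto
  have "f c y \<in> V" if "c \<in> C" "y \<in> B" for c y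
    using subsetD [OF AB(5), of "(c, y)"] subsetD [OF AB(3)] that by simp
  then have "B \<subseteq> {x \<in> carrier G. \<forall>c\<in>C. f c x \<in> V}"
    using openin_subset [OF AB(2)] by auto
  then show "\<exists>B. openin T B \<and> x \<in> B \<and> B \<subseteq> {x \<in> carrier G. \<forall>c\<in>C. f c x \<in> V}"
    using AB by blast
qed

lemma openin_rcoset:
  assumes "openin T V" "x \<in> carrier G"
  shows "openin T (V #> x)"
proof -
  have V: "V \<subseteq> carrier G" using openin_subset [OF assms(1)] by simp
  have "openin T {y \<in> topspace T. y \<otimes> inv x \<in> V}"
    by (rule openin_continuous_map_preimage [OF _ assms(1)])
      (use assms in \<open>auto intro!: continuous_group_intros\<close>)
  also have "{y \<in> topspace T. y \<otimes> inv x \<in> V} = V #> x"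
  proof (intro subset_antisym subsetI)
    fix y assume "y \<in> {y \<in> topspace T. y \<otimes> inv x \<in> V}"
    then show "y \<in> V #> x" unfolding r_coset_def
      using assms by (intro UN_I [of "y \<otimes> inv x"]) (auto simp: m_assoc)
  next
    fix y assume "y \<in> V #> x"
    then show "y \<in> {y \<in> topspace T. y \<otimes> inv x \<in> V}"
      using V assms by (auto simp: r_coset_def m_assoc)
  qed
  finally show ?thesis .
qed

section \<open>Open normal subgroups\<close>

definition open_normal :: "'a set \<Rightarrow> bool" where
  "open_normal U \<longleftrightarrow> U \<lhd> G \<and> openin T U"

lemma open_normal_imp_normal: "open_normal U \<Longrightarrow> U \<lhd> G"
  by (simp add: open_normal_def)

lemma open_normal_imp_subgroup: "open_normal U \<Longrightarrow> subgroup U G"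
  by (simp add: open_normal_def normal_imp_subgroup)

lemma open_normal_carrier: "open_normal (carrier G)"
  unfolding open_normal_def using normal_self openin_topspace [of T] by simp

lemma open_normal_Int: "open_normal U \<Longrightarrow> open_normal V \<Longrightarrow> open_normal (U \<inter> V)"
  unfolding open_normal_def using normal_subgroup_intersect by (auto intro: openin_Int)

lemma open_normal_finite_Inter:
  "finite \<U> \<Longrightarrow> (\<And>U. U \<in> \<U> \<Longrightarrow> open_normal U) \<Longrightarrow> open_normal V \<Longrightarrow> open_normal (V \<inter> \<Inter>\<U>)"
proof (induction \<U> rule: finite_induct)
  case (insert U \<U>)
  have "open_normal (U \<inter> (V \<inter> \<Inter>\<U>))"
    by (rule open_normal_Int) (use insert in auto)
  moreover have "V \<inter> \<Inter>(insert U \<U>) = U \<inter> (V \<inter> \<Inter>\<U>)" by auto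
  ultimately show ?case by metis
qed auto

text \<open>The coset of \<open>x\<close> modulo an open subgroup is locally constant. Since
  \<open>A\<close> is arbitrary, passing to its complement gives the closed version.\<close>

lemma openin_rcoset_pred:
  assumes "open_normal U"
  shows "openin T {x \<in> carrier G. U #> x \<in> A}"
proof (subst openin_subopen, intro ballI)
  fix x assume x: "x \<in> {x \<in> carrier G. U #> x \<in> A}"
  have U: "subgroup U G" by (rule open_normal_imp_subgroup [OF assms])
  have xG: "x \<in> carrier G" and xA: "U #> x \<in> A" using x by auto
  have eq: "U #> y = U #> x" if "y \<in> U #> x" for y
    by (rule repr_independence [OF that xG U, symmetric])
  have "openin T (U #> x)"
    using assms xG by (auto simp: open_normal_def openin_rcoset)
  moreover have "x \<in> U #> x" by (rule rcos_self [OF xG U])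
  moreover have "U #> x \<subseteq> {x \<in> carrier G. U #> x \<in> A}"
    using eq xA openin_subset [OF \<open>openin T (U #> x)\<close>] by auto
  ultimately show "\<exists>W. openin T W \<and> x \<in> W \<and> W \<subseteq> {x \<in> carrier G. U #> x \<in> A}" by blast
qed

lemma closedin_rcoset_pred:
  assumes "open_normal U"
  shows "closedin T {x \<in> carrier G. U #> x \<in> A}"
proof -
  have "{x \<in> carrier G. U #> x \<in> A} = topspace T - {x \<in> carrier G. U #> x \<in> - A}" by auto
  then show ?thesis
    using closedin_diff [OF closedin_topspace openin_rcoset_pred [OF assms, of "- A"]] by simp
qed

end

context profinite_group begin

text \<open>In a compact Hausdorff space components are quasi-components, which yields an open and
  closed \<open>C\<close> with \<open>\<one> \<in> C \<subseteq> V\<close>. The elements whose right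
  translation maps \<open>C\<close> into itself form an open set by compactness of \<open>C\<close>;
  those whose inverse also does so form an open subgroup, contained in \<open>C\<close> because
  \<open>\<one> \<in> C\<close>.\<close>

lemma open_normal_inside:
  assumes V: "openin T V" "\<one> \<in> V"
  shows "\<exists>U. open_normal U \<and> U \<subseteq> V"
proof -
  have VG: "V \<subseteq> carrier G" using openin_subset [OF V(1)] by simp
  have comp: "compactin T K" if "closedin T K" for K
    using that compact closedin_compact_space by blast
  have quasi: "quasi_component_of T \<one> = connected_component_of T \<one>"
    using compact Hausdorff by (intro quasi_eq_connected_component_of) auto
  have "quasi_component_of_set T \<one> = {\<one>}"
    using totally_disconnected quasi by (simp add: totally_disconnected_space_def)
  then have "{\<one>} \<in> quasi_components_of T"
    unfolding quasi_components_of_def by (intro image_eqI [of _ _ \<one>]) auto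
  moreover have "compactin T (carrier G - V)"
    using V by (intro comp) (metis closedin_diff closedin_topspace topspace_T)
  ultimately have "separated_between T {\<one>} (carrier G - V)"
    using V separated_between_quasi_component_compact [of "{\<one>}" T] by (simp add: disjnt_def)
  then obtain C C' where C: "openin T C" "openin T C'" "C \<union> C' = topspace T" "disjnt C C'"
    "\<one> \<in> C" "carrier G - V \<subseteq> C'"
    unfolding separated_between_def by auto
  have CV: "C \<subseteq> V" using C openin_subset [OF C(1)] by (auto simp: disjnt_def)
  have CG: "C \<subseteq> carrier G" using CV VG by auto
  have "C = topspace T - C'" using C by (auto simp: disjnt_def)
  then have compC: "compactin T C" using C(2) by (intro comp) blast
  define W where "W = {x \<in> carrier G. \<forall>c\<in>C. c \<otimes> x \<in> C}"
  have W: "openin T W"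
    unfolding W_def using continuous_mult by (intro openin_forall_compact [OF _ compC C(1)]) simp
  define S where "S = W \<inter> {x \<in> topspace T. inv x \<in> W}"
  have S: "openin T S"
    unfolding S_def by (intro openin_Int W openin_continuous_map_preimage [OF continuous_inv W])
  have sgS: "subgroup S G"
  proof (rule subgroupI)
    show "S \<subseteq> carrier G" by (auto simp: S_def)
    have "\<one> \<in> S" using CG by (auto simp: S_def W_def)
    then show "S \<noteq> {}" by blast
    show "inv a \<in> S" if "a \<in> S" for a using that by (auto simp: S_def)
    have WW: "a \<otimes> b \<in> W" if "a \<in> W" "b \<in> W" for a b
      using that CG by (auto simp: W_def m_assoc [symmetric])
    show "a \<otimes> b \<in> S" if "a \<in> S" "b \<in> S" for a b
      using that WW [of a b] WW [of "inv b" "inv a"] by (auto simp: S_def inv_mult_group)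
  qed
  have SC: "S \<subseteq> C" using C(5) by (force simp: S_def W_def)
  \<comment> \<open>The normal core of \<open>S\<close>; it is open because the conjugating elements
    range over a compact group.\<close>
  define U where "U = {x \<in> carrier G. \<forall>g\<in>carrier G. g \<otimes> x \<otimes> inv g \<in> S}"
  have "openin T U"
    unfolding U_def
  proof (rule openin_forall_compact [OF _ _ S])
    show "continuous_map (prod_topology T T) T (\<lambda>(c, x). c \<otimes> x \<otimes> inv c)"
      unfolding case_prod_beta by (intro continuous_group_intros)
    show "compactin T (carrier G)" using compact by (simp add: compact_space_def)
  qed
  moreover have "U \<lhd> G"
  proof (subst normal_inv_iff, intro conjI ballI)
    interpret S: subgroup S G by (rule sgS)
    show "subgroup U G"
    proof (rule subgroupI)
      show "U \<subseteq> carrier G" by (auto simp: U_def)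
      have "\<one> \<in> U" by (simp add: U_def)
      then show "U \<noteq> {}" by blast
      show "inv a \<in> U" if "a \<in> U" for a
      proof -
        have "g \<otimes> inv a \<otimes> inv g \<in> S" if "g \<in> carrier G" for g
        proof -
          have "inv (g \<otimes> a \<otimes> inv g) \<in> S" using \<open>a \<in> U\<close> that by (intro S.m_inv_closed) (auto simp: U_def)
          then show ?thesis using \<open>a \<in> U\<close> that by (simp add: U_def group_word_simps)
        qed
        then show ?thesis using \<open>a \<in> U\<close> by (auto simp: U_def)
      qed
      show "a \<otimes> b \<in> U" if "a \<in> U" "b \<in> U" for a b
      proof -
        have "g \<otimes> (a \<otimes> b) \<otimes> inv g \<in> S" if "g \<in> carrier G" for g
        proof -
          have "(g \<otimes> a \<otimes> inv g) \<otimes> (g \<otimes> b \<otimes> inv g) \<in> S"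
            using \<open>a \<in> U\<close> \<open>b \<in> U\<close> that by (intro S.m_closed [of "g \<otimes> a \<otimes> inv g"]) (auto simp: U_def)
          then show ?thesis using \<open>a \<in> U\<close> \<open>b \<in> U\<close> that by (simp add: U_def group_word_simps)
        qed
        then show ?thesis using \<open>a \<in> U\<close> \<open>b \<in> U\<close> by (auto simp: U_def)
      qed
    qed
    fix x h assume xh: "x \<in> carrier G" "h \<in> U"
    have "g \<otimes> (x \<otimes> h \<otimes> inv x) \<otimes> inv g \<in> S" if "g \<in> carrier G" for g
    proof -
      have "(g \<otimes> x) \<otimes> h \<otimes> inv (g \<otimes> x) \<in> S" using xh that by (auto simp: U_def)
      then show ?thesis using xh that by (simp add: U_def group_word_simps)
    qed
    then show "x \<otimes> h \<otimes> inv x \<in> U" using xh by (auto simp: U_def)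
  qed
  moreover have "U \<subseteq> V"
  proof
    fix x assume "x \<in> U"
    then have "\<one> \<otimes> x \<otimes> inv \<one> \<in> S" "x \<in> carrier G" unfolding U_def by blast+
    then show "x \<in> V" using SC CV by auto
  qed
  ultimately show ?thesis by (auto simp: open_normal_def)
qed

section \<open>Finite quotients, closures and procyclic subgroups\<close>

lemma finite_rcosets:
  assumes "open_normal U"
  shows "finite (rcosets U)"
proof -
  have U: "subgroup U G" by (rule open_normal_imp_subgroup [OF assms])
  have "\<Union>(rcosets U) = topspace T" using rcosets_part_G [OF U] by simp
  moreover have "\<forall>X\<in>rcosets U. openin T X"
    using assms by (auto simp: RCOSETS_def open_normal_def openin_rcoset)
  ultimately obtain \<F> where F: "finite \<F>" "\<F> \<subseteq> rcosets U" "\<Union>\<F> = topspace T"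
    using compact [unfolded compact_space] by meson
  have "rcosets U \<subseteq> \<F>"
  proof
    fix X assume X: "X \<in> rcosets U"
    then obtain x where x: "x \<in> carrier G" "X = U #> x" by (auto simp: RCOSETS_def)
    then obtain Y where Y: "Y \<in> \<F>" "x \<in> Y" using F(3) by auto
    then obtain y where "y \<in> carrier G" "Y = U #> y" using F(2) by (auto simp: RCOSETS_def)
    then have "Y = X" using repr_independence [of x U y] Y x U by auto
    then show "X \<in> \<F>" using Y by simp
  qed
  then show ?thesis by (rule finite_subset) (rule F(1))
qed

text \<open>Cosets of open normal subgroups form a neighbourhood basis, so closures can be computed
  in the finite quotients.\<close>

lemma in_closure_iff:
  assumes S: "S \<subseteq> carrier G" and x: "x \<in> carrier G"
  shows "x \<in> T closure_of S \<longleftrightarrow> (\<forall>U. open_normal U \<longrightarrow> (\<exists>s\<in>S. U #> x = U #> s))"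
proof (intro iffI allI impI)
  fix U assume cl: "x \<in> T closure_of S" and U: "open_normal U"
  have sg: "subgroup U G" by (rule open_normal_imp_subgroup [OF U])
  have "openin T (U #> x)" "x \<in> U #> x"
    using U x sg rcos_self by (auto simp: open_normal_def openin_rcoset)
  then obtain s where "s \<in> S" "s \<in> U #> x" using cl unfolding in_closure_of by blast
  then show "\<exists>s\<in>S. U #> x = U #> s" using repr_independence [OF _ x sg] by blast
next
  assume R: "\<forall>U. open_normal U \<longrightarrow> (\<exists>s\<in>S. U #> x = U #> s)"
  show "x \<in> T closure_of S"
    unfolding in_closure_of
  proof (intro conjI allI impI)
    show "x \<in> topspace T" using x by simp
    fix V assume V: "x \<in> V \<and> openin T V"
    have "openin T {y \<in> topspace T. y \<otimes> x \<in> V}"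
      by (rule openin_continuous_map_preimage) (use V x in \<open>auto intro!: continuous_group_intros\<close>)
    then obtain U where U: "open_normal U" "U \<subseteq> {y \<in> topspace T. y \<otimes> x \<in> V}"
      using open_normal_inside [of "{y \<in> topspace T. y \<otimes> x \<in> V}"] V x by auto
    then obtain s where s: "s \<in> S" "U #> x = U #> s" using R by blast
    then have "s \<in> U #> x" using rcos_self [of s U] open_normal_imp_subgroup [OF U(1)] S by auto
    then have "s \<in> V" using U(2) by (auto simp: r_coset_def)
    then show "\<exists>y. y \<in> S \<and> y \<in> V" using s by blast
  qed
qed

lemma closed_memI:
  assumes "closedin T M" "x \<in> carrier G" "\<And>U. open_normal U \<Longrightarrow> \<exists>s\<in>M. U #> x = U #> s"
  shows "x \<in> M"
  using assms in_closure_iff [of M x] closedin_subset [of T M] closure_of_eq [of T M] by auto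

lemma eq_if_rcosets_eq:
  assumes "x \<in> carrier G" "y \<in> carrier G" "\<And>U. open_normal U \<Longrightarrow> U #> x = U #> y"
  shows "x = y"
proof -
  have "closedin T {y}"
    using Hausdorff assms(2) by (simp add: closedin_Hausdorff_singleton)
  then show ?thesis using closed_memI [of "{y}" x] assms by auto
qed

lemma rcoset_hom: "open_normal U \<Longrightarrow> group_hom G (G Mod U) (\<lambda>x. U #> x)"
  using normal.r_coset_hom_Mod normal.factorgroup_is_group is_group
  by (intro group_hom.intro group_hom_axioms.intro) (blast dest: open_normal_imp_normal)+

lemma quotient_pow_eq_one:
  assumes "open_normal U"
  shows "card (rcosets U) > 0"
    and "X \<in> carrier (G Mod U) \<Longrightarrow> X [^]\<^bsub>G Mod U\<^esub> card (rcosets U) = \<one>\<^bsub>G Mod U\<^esub>"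
proof -
  interpret Q: group "G Mod U"
    using normal.factorgroup_is_group [OF open_normal_imp_normal [OF assms]] .
  have c: "carrier (G Mod U) = rcosets U" by (simp add: FactGroup_def)
  have "finite (rcosets U)" by (rule finite_rcosets [OF assms])
  then show "card (rcosets U) > 0"
    using Q.one_closed c by (auto simp: card_gt_0_iff)
  show "X [^]\<^bsub>G Mod U\<^esub> card (rcosets U) = \<one>\<^bsub>G Mod U\<^esub>" if "X \<in> carrier (G Mod U)"
    using Q.pow_order_eq_1 [OF that] c by (simp add: Coset.order_def)
qed

lemma rcoset_int_pow:
  "open_normal U \<Longrightarrow> x \<in> carrier G \<Longrightarrow> U #> (x [^] (i::int)) = (U #> x) [^]\<^bsub>G Mod U\<^esub> i"
  using group_hom.hom_int_pow [OF rcoset_hom] by blast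

lemma mem_top_generate_iff:
  assumes c: "c \<in> carrier G"
  shows "x \<in> top_generate G T {c} \<longleftrightarrow>
    x \<in> carrier G \<and> (\<forall>U. open_normal U \<longrightarrow> U #> x \<in> generate (G Mod U) {U #> c})"
proof -
  have "U #> x \<in> generate (G Mod U) {U #> c} \<longleftrightarrow> (\<exists>s\<in>generate G {c}. U #> x = U #> s)"
    if "open_normal U" for U
    using group_hom.generate_img [OF rcoset_hom [OF that], of "{c}"] c by auto
  moreover have "x \<in> carrier G" if "x \<in> top_generate G T {c}"
    using that closure_of_subset_topspace [of T] by (auto simp: top_generate_def)
  ultimately show ?thesis
    using in_closure_iff [of "generate G {c}" x] generate_incl [of "{c}"] c
    by (auto simp: top_generate_def)
qed

text \<open>The sets \<open>F U\<close> are unions of cosets of \<open>U\<close> in the closed set \<open>M\<close>, hence closed, and they are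
  directed downwards.\<close>

lemma inverse_system_nonempty:
  assumes M: "closedin T M"
    and F: "\<And>U. open_normal U \<Longrightarrow> F U \<subseteq> M" "\<And>U. open_normal U \<Longrightarrow> F U \<noteq> {}"
    and saturated: "\<And>U x y. open_normal U \<Longrightarrow> x \<in> F U \<Longrightarrow> y \<in> M \<Longrightarrow> U #> x = U #> y \<Longrightarrow> y \<in> F U"
    and mono: "\<And>U V. open_normal U \<Longrightarrow> open_normal V \<Longrightarrow> V \<subseteq> U \<Longrightarrow> F V \<subseteq> F U"
  shows "\<exists>x\<in>M. \<forall>U. open_normal U \<longrightarrow> x \<in> F U"
proof -
  have closed: "closedin T (F U)" if "open_normal U" for U
  proof -
    have "F U = M \<inter> {x \<in> carrier G. U #> x \<in> (\<lambda>x. U #> x) ` F U}"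
      using F(1) [OF that] saturated [OF that] closedin_subset [OF M] by auto
    then show ?thesis using closedin_Int [OF M closedin_rcoset_pred [OF that]] by metis
  qed
  have "\<Inter>(F ` Collect open_normal) \<noteq> {}"
  proof (rule compact [unfolded compact_space_fip, rule_format], intro conjI ballI allI impI)
    fix C assume "C \<in> F ` Collect open_normal"
    then show "closedin T C" using closed by blast
  next
    fix \<F> assume "finite \<F> \<and> \<F> \<subseteq> F ` Collect open_normal"
    then obtain \<U> where U: "finite \<U>" "\<U> \<subseteq> Collect open_normal" "\<F> = F ` \<U>"
      by (meson finite_subset_image)
    let ?V = "carrier G \<inter> \<Inter>\<U>"
    have V: "open_normal ?V"
      using U by (intro open_normal_finite_Inter open_normal_carrier) auto
    have "F ?V \<subseteq> \<Inter>\<F>" using mono [OF _ V] U by blast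
    then show "\<Inter>\<F> \<noteq> {}" using F(2) [OF V] by blast
  qed
  then show ?thesis using F(1) open_normal_carrier by blast
qed

lemma subset_rcoset_eq:
  assumes "open_normal U" "open_normal V" "V \<subseteq> U" "x \<in> carrier G" "y \<in> carrier G" "V #> x = V #> y"
  shows "U #> x = U #> y"
  using assms rcoset_eq_iff open_normal_imp_subgroup by blast

text \<open>The sets \<open>F U\<close> of elements generating \<open>M\<close> modulo
  \<open>U\<close> form an inverse system: a generator modulo \<open>V\<close> is one modulo every
  larger \<open>U\<close>. A common element of all \<open>F U\<close> is a topological
  generator.\<close>

lemma procyclic_if_cyclic_quotients:
  assumes M: "closedin T M" "subgroup M G"
    and cyc: "\<And>U. open_normal U \<Longrightarrow> \<exists>c\<in>M. \<forall>x\<in>M. U #> x \<in> generate (G Mod U) {U #> c}"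
  shows "\<exists>c\<in>M. M = top_generate G T {c}"
proof -
  define F where "F U = {c \<in> M. \<forall>x\<in>M. U #> x \<in> generate (G Mod U) {U #> c}}" for U
  have MG: "M \<subseteq> carrier G" using subgroup.subset [OF M(2)] .
  have pow: "U #> x \<in> generate (G Mod U) {U #> c} \<longleftrightarrow> (\<exists>i::int. U #> x = U #> (c [^] i))"
    if "open_normal U" "c \<in> carrier G" for U x c
  proof -
    interpret Q: group "G Mod U"
      using normal.factorgroup_is_group [OF open_normal_imp_normal [OF that(1)]] .
    have "U #> c \<in> carrier (G Mod U)" using that by (auto simp: carrier_FactGroup)
    then show ?thesis using Q.mem_generate_single rcoset_int_pow that by simp
  qed
  have "\<exists>x\<in>M. \<forall>U. open_normal U \<longrightarrow> x \<in> F U"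
  proof (rule inverse_system_nonempty [OF M(1)])
    fix U V assume UV: "open_normal U" "open_normal V" "V \<subseteq> U"
    show "F V \<subseteq> F U"
    proof
      fix c assume c: "c \<in> F V"
      then have cG: "c \<in> carrier G" using MG by (auto simp: F_def)
      have "U #> x \<in> generate (G Mod U) {U #> c}" if "x \<in> M" for x
      proof -
        obtain i :: int where "V #> x = V #> (c [^] i)"
          using c \<open>x \<in> M\<close> pow [OF UV(2) cG] by (auto simp: F_def)
        then have "U #> x = U #> (c [^] i)"
          by (intro subset_rcoset_eq [OF UV]) (use that MG cG in auto)
        then show ?thesis using pow [OF UV(1) cG] by blast
      qed
      then show "c \<in> F U" using c by (auto simp: F_def)
    qed
  qed (use cyc in \<open>auto simp: F_def\<close>)
  then obtain c where c: "c \<in> M" "\<And>U. open_normal U \<Longrightarrow> c \<in> F U" by blast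
  have cG: "c \<in> carrier G" using c MG by auto
  have "M \<subseteq> top_generate G T {c}"
    using mem_top_generate_iff [OF cG] c(2) MG by (auto simp: F_def)
  moreover have "top_generate G T {c} \<subseteq> M"
    unfolding top_generate_def
    by (rule closure_of_minimal [OF _ M(1)]) (use c M generate_subgroup_incl in auto)
  ultimately show ?thesis using c by blast
qed

lemma subgroup_top_generate:
  assumes S: "S \<subseteq> carrier G"
  shows "subgroup (top_generate G T S) G"
proof -
  let ?A = "generate G S"
  interpret A: subgroup ?A G by (rule generate_is_subgroup [OF S])
  have sub: "top_generate G T S \<subseteq> carrier G"
    using closure_of_subset_topspace [of T] by (auto simp: top_generate_def)
  have iff: "x \<in> top_generate G T S \<longleftrightarrow> (\<forall>U. open_normal U \<longrightarrow> (\<exists>s\<in>?A. U #> x = U #> s))"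
    if "x \<in> carrier G" for x
    using in_closure_iff [OF A.subset that] by (simp add: top_generate_def)
  have memI: "x \<in> top_generate G T S"
    if "x \<in> carrier G" "\<And>U. open_normal U \<Longrightarrow> \<exists>s\<in>?A. U #> x = U #> s" for x
    using iff that by blast
  show ?thesis
  proof (rule subgroupI [OF sub])
    show "top_generate G T S \<noteq> {}" using iff [of \<one>] A.one_closed by blast
    fix a assume a: "a \<in> top_generate G T S"
    show "inv a \<in> top_generate G T S"
    proof (rule memI)
      fix U assume U: "open_normal U"
      interpret \<pi>: group_hom G "G Mod U" "\<lambda>x. U #> x" by (rule rcoset_hom [OF U])
      have aG: "a \<in> carrier G" using a sub by auto
      obtain s where s: "s \<in> ?A" "U #> a = U #> s" using iff [OF aG] a U by blast
      then have "U #> inv a = U #> inv s" using aG A.mem_carrier by (simp only: \<pi>.hom_inv)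
      then show "\<exists>s\<in>?A. U #> inv a = U #> s" using s by blast
    qed (use a sub in auto)
    fix b assume b: "b \<in> top_generate G T S"
    show "a \<otimes> b \<in> top_generate G T S"
    proof (rule memI)
      fix U assume U: "open_normal U"
      interpret \<pi>: group_hom G "G Mod U" "\<lambda>x. U #> x" by (rule rcoset_hom [OF U])
      have aG: "a \<in> carrier G" "b \<in> carrier G" using a b sub by auto
      obtain s t where st: "s \<in> ?A" "U #> a = U #> s" "t \<in> ?A" "U #> b = U #> t"
        using iff [OF aG(1)] iff [OF aG(2)] a b U by blast
      then have "U #> (a \<otimes> b) = U #> (s \<otimes> t)"
        using aG A.mem_carrier by (simp only: \<pi>.hom_mult)
      then show "\<exists>s\<in>?A. U #> (a \<otimes> b) = U #> s" using st by blast
    qed (use a b sub in auto)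
  qed
qed

lemma closedin_top_generate: "closedin T (top_generate G T S)"
  by (simp add: top_generate_def)

lemma incl_top_generate: "S \<subseteq> carrier G \<Longrightarrow> s \<in> S \<Longrightarrow> s \<in> top_generate G T S"
  unfolding top_generate_def
  using closure_of_subset [of "generate G S" T] generate_incl [of S] generate.incl [of s S G] by auto

lemma top_generate_minimal:
  "closedin T M \<Longrightarrow> subgroup M G \<Longrightarrow> S \<subseteq> M \<Longrightarrow> top_generate G T S \<subseteq> M"
  unfolding top_generate_def by (intro closure_of_minimal generate_subgroup_incl)

lemma top_generate_single_commute:
  assumes c: "c \<in> carrier G" and xy: "x \<in> top_generate G T {c}" "y \<in> top_generate G T {c}"
  shows "x \<otimes> y = y \<otimes> x"
proof (rule eq_if_rcosets_eq)
  have G: "x \<in> carrier G" "y \<in> carrier G" using xy mem_top_generate_iff [OF c] by auto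
  then show "x \<otimes> y \<in> carrier G" "y \<otimes> x \<in> carrier G" by auto
  fix U assume U: "open_normal U"
  interpret \<pi>: group_hom G "G Mod U" "\<lambda>x. U #> x" by (rule rcoset_hom [OF U])
  have "(U #> x) \<otimes>\<^bsub>G Mod U\<^esub> (U #> y) = (U #> y) \<otimes>\<^bsub>G Mod U\<^esub> (U #> x)"
    by (rule \<pi>.H.generate_single_commute [of "U #> c"])
      (use c xy U mem_top_generate_iff in auto)
  then show "U #> (x \<otimes> y) = U #> (y \<otimes> x)" using \<pi>.hom_mult G by simp
qed

lemma procyclic_if_cyclic_mod_primes:
  assumes X: "closedin T X" "subgroup X G"
    and comm: "\<And>x y. x \<in> X \<Longrightarrow> y \<in> X \<Longrightarrow> x \<otimes> y = y \<otimes> x"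
    and primes: "\<And>p. prime p \<Longrightarrow> \<exists>x\<in>X. X \<subseteq> mod_pow_span X p x"
  shows "\<exists>c\<in>X. X = top_generate G T {c}"
proof (rule procyclic_if_cyclic_quotients [OF X])
  fix U assume U: "open_normal U"
  interpret \<pi>: group_hom G "G Mod U" "\<lambda>x. U #> x" by (rule rcoset_hom [OF U])
  interpret X: subgroup X G by (rule X)
  let ?X = "(\<lambda>x. U #> x) ` X"
  have "\<exists>c\<in>?X. generate (G Mod U) {c} = ?X"
  proof (rule \<pi>.H.cyclic_if_cyclic_mod_primes)
    show sg: "subgroup ?X (G Mod U)" by (rule \<pi>.subgroup_img_is_subgroup [OF X(2)])
    show "card (rcosets U) > 0" by (rule quotient_pow_eq_one [OF U])
    show "x [^]\<^bsub>G Mod U\<^esub> card (rcosets U) = \<one>\<^bsub>G Mod U\<^esub>" if "x \<in> ?X" for x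
      using that subgroup.subset [OF sg] by (intro quotient_pow_eq_one [OF U]) auto
    show "x \<otimes>\<^bsub>G Mod U\<^esub> y = y \<otimes>\<^bsub>G Mod U\<^esub> x" if xy: "x \<in> ?X" "y \<in> ?X" for x y
    proof -
      obtain a b where ab: "a \<in> X" "b \<in> X" "x = U #> a" "y = U #> b" using xy by blast
      show ?thesis
        unfolding ab using \<pi>.hom_mult [of a b] \<pi>.hom_mult [of b a] comm [OF ab(1,2)] ab(1,2)
        by (simp del: mult_FactGroup)
    qed
    fix p :: nat assume "prime p"
    then obtain x where x: "x \<in> X" "X \<subseteq> mod_pow_span X p x" using primes by blast
    have "U #> a \<in> \<pi>.H.mod_pow_span ?X p (U #> x)" if a: "a \<in> X" for a
    proof -
      have "a \<in> mod_pow_span X p x" using x a by blast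
      then obtain i :: int and b where b: "b \<in> X" "a = x [^] i \<otimes> b [^] p"
        by (rule mem_mod_pow_spanE)
      have "U #> a = (U #> x) [^]\<^bsub>G Mod U\<^esub> i \<otimes>\<^bsub>G Mod U\<^esub> (U #> b) [^]\<^bsub>G Mod U\<^esub> p"
        unfolding b(2) using x(1) b(1) by (simp add: \<pi>.hom_int_pow \<pi>.hom_nat_pow del: mult_FactGroup)
      then show ?thesis
        by (rule \<pi>.H.mem_mod_pow_spanI [rotated]) (use b in auto)
    qed
    then show "\<exists>x\<in>?X. ?X \<subseteq> \<pi>.H.mod_pow_span ?X p x" using x by blast
  qed
  then show "\<exists>c\<in>X. \<forall>x\<in>X. U #> x \<in> generate (G Mod U) {U #> c}" by auto
qed

text \<open>In each finite quotient the image of \<open>F\<close> lies in a cyclic group, so the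
  pairwise criterion applies to the whole image as its own generating set, with
  \<open>U #> c\<close> serving every pair.\<close>

lemma closed_subgroup_procyclic:
  assumes F: "closedin T F" "subgroup F G" and c: "c \<in> carrier G" "F \<subseteq> top_generate G T {c}"
  shows "\<exists>d\<in>F. F = top_generate G T {d}"
proof (rule procyclic_if_cyclic_quotients [OF F])
  fix U assume U: "open_normal U"
  interpret \<pi>: group_hom G "G Mod U" "\<lambda>x. U #> x" by (rule rcoset_hom [OF U])
  let ?F = "(\<lambda>x. U #> x) ` F"
  have sg: "subgroup ?F (G Mod U)" by (rule \<pi>.subgroup_img_is_subgroup [OF F(2)])
  have gen: "generate (G Mod U) ?F = ?F"
    using \<pi>.H.generate_subgroup_incl [OF subset_refl sg] generate.incl [of _ ?F "G Mod U"] by blast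
  have "\<exists>d\<in>generate (G Mod U) ?F. generate (G Mod U) {d} = generate (G Mod U) ?F"
  proof (rule \<pi>.H.generate_cyclic_if_pairwise [OF quotient_pow_eq_one [OF U] subgroup.subset [OF sg]])
    fix s t assume "s \<in> ?F" "t \<in> ?F"
    then show "\<exists>d\<in>carrier (G Mod U). s \<in> generate (G Mod U) {d} \<and> t \<in> generate (G Mod U) {d}"
      using mem_top_generate_iff [OF c(1)] c U by (intro bexI [of _ "U #> c"]) auto
  qed
  then show "\<exists>d\<in>F. \<forall>x\<in>F. U #> x \<in> generate (G Mod U) {U #> d}" unfolding gen by auto
qed

end

section \<open>Central extensions of procyclic groups\<close>

context comm_group begin

lemma subgroup_pow_image:
  assumes "subgroup N G"
  shows "subgroup ((\<lambda>x. x [^] (n::nat)) ` N) G"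
proof (rule subgroupI)
  interpret N: subgroup N G by fact
  show "(\<lambda>x. x [^] n) ` N \<subseteq> carrier G" by auto
  show "(\<lambda>x. x [^] n) ` N \<noteq> {}" using N.one_closed by blast
  fix a assume "a \<in> (\<lambda>x. x [^] n) ` N"
  then obtain u where u: "u \<in> N" "a = u [^] n" by blast
  then have "inv a = (inv u) [^] n" by (simp add: nat_pow_inv)
  then show "inv a \<in> (\<lambda>x. x [^] n) ` N" using u by blast
  fix b assume "b \<in> (\<lambda>x. x [^] n) ` N"
  then obtain v where v: "v \<in> N" "b = v [^] n" by blast
  then have "a \<otimes> b = (u \<otimes> v) [^] n" using u by (simp add: nat_pow_distrib)
  then show "a \<otimes> b \<in> (\<lambda>x. x [^] n) ` N" using u v by blast
qed

text \<open>Let \<open>X = \<langle>y\<rangle>N\<^sup>q\<close> with \<open>q = m\<^sup>k\<close>. If \<open>p\<close> does not divide \<open>m\<close> then \<open>X = \<langle>z\<^sup>q\<rangle>X\<^sup>p\<close>, since \<open>y\<^sup>m\<^sup>q \<in> N\<^sup>q\<close>.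
  If \<open>p\<close> divides \<open>m\<close> then \<open>X = \<langle>y\<rangle>X\<^sup>p\<close>: this is clear for \<open>N = N\<^sup>p\<close>; otherwise
  \<open>y\<^sup>m \<equiv> z\<^sup>\<nu> (mod N\<^sup>p\<^sup>q)\<close> where \<open>\<nu>\<close> has \<open>p\<close>-adic valuation less than \<open>k\<close>, so that
  \<open>z\<^sup>q \<in> \<langle>y\<^sup>m\<rangle>N\<^sup>p\<^sup>q\<close>.\<close>

lemma mod_pow_span_cyclic_mod_primes:
  assumes N: "subgroup N G" and z: "z \<in> N" and gen: "\<And>n. n > 0 \<Longrightarrow> N \<subseteq> mod_pow_span N n z"
    and y [simp]: "y \<in> carrier G" and m: "m > 0" "y [^] (m::nat) \<in> N"
    and div: "\<And>p. prime p \<Longrightarrow> p dvd m \<Longrightarrow>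
      N \<subseteq> (\<lambda>x. x [^] p) ` N \<or> y [^] m \<notin> (\<lambda>x. x [^] (p ^ k)) ` N"
    and p: "prime (p::nat)"
  shows "\<exists>x \<in> mod_pow_span N (m ^ k) y.
    mod_pow_span N (m ^ k) y \<subseteq> mod_pow_span (mod_pow_span N (m ^ k) y) p x"
proof -
  interpret N: subgroup N G by fact
  define q where "q = m ^ k"
  define X where "X = mod_pow_span N q y"
  have X: "subgroup X G" unfolding X_def by (rule subgroup_mod_pow_span_comm [OF N y])
  interpret X: subgroup X G by fact
  have z' [simp]: "z \<in> carrier G" using z by simp
  have powX: "n [^] q \<in> X" if "n \<in> N" for n
    unfolding X_def by (rule mem_mod_pow_spanI [OF that, of _ _ 0]) (use that in simp)
  have yX: "y \<in> X"
    unfolding X_def by (rule mem_mod_pow_spanI [of \<one> _ _ _ 1]) auto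
  have swap: "(n [^] a) [^] b = (n [^] b) [^] a" if "n \<in> carrier G" for n and a b :: nat
    using that by (simp add: nat_pow_pow mult.commute)
  \<comment> \<open>\<open>X\<close> is generated by \<open>y\<close> and the \<open>q\<close>-th
    powers of \<open>N\<close>, so only these have to be placed in \<open><x> X^p\<close>.\<close>
  have reduce: "\<exists>x\<in>X. X \<subseteq> mod_pow_span X p x"
    if x: "x \<in> X" and ys: "y \<in> mod_pow_span X p x"
      and ns: "\<And>n. n \<in> N \<Longrightarrow> n [^] q \<in> mod_pow_span X p x" for x
  proof -
    interpret S: subgroup "mod_pow_span X p x" G
      by (rule subgroup_mod_pow_span_comm [OF X]) (use x in simp)
    have "a \<in> mod_pow_span X p x" if "a \<in> X" for a
    proof -
      have "a \<in> mod_pow_span N q y" using that by (simp add: X_def)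
      then obtain i :: int and n where "n \<in> N" "a = y [^] i \<otimes> n [^] q" by (rule mem_mod_pow_spanE)
      then show ?thesis
        using ns subgroup_int_pow_closed [OF S.subgroup_axioms ys] by simp
    qed
    then show ?thesis using x by blast
  qed
  have powspan: "a [^] p \<in> mod_pow_span X p x" if "a \<in> X" "x \<in> X" for a x
    by (rule mem_mod_pow_spanI [OF that(1), of _ _ 0]) (use that in simp)
  have selfspan: "x \<in> mod_pow_span X p x" if "x \<in> X" for x
    by (rule mem_mod_pow_spanI [of \<one> _ _ _ 1]) (use that in auto)
  have "\<exists>x\<in>X. X \<subseteq> mod_pow_span X p x"
  proof (cases "p dvd m")
    case False
    show ?thesis
    proof (rule reduce [of "z [^] q"])
      show zX: "z [^] q \<in> X" by (rule powX [OF z])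
      interpret S: subgroup "mod_pow_span X p (z [^] q)" G
        by (rule subgroup_mod_pow_span_comm [OF X]) simp
      show ns: "n [^] q \<in> mod_pow_span X p (z [^] q)" if "n \<in> N" for n
      proof -
        have "n \<in> mod_pow_span N p z" using gen [of p] that p prime_gt_0_nat by blast
        then obtain i :: int and b where b: "b \<in> N" "n = z [^] i \<otimes> b [^] p" by (rule mem_mod_pow_spanE)
        have "n [^] q = (z [^] q) [^] i \<otimes> (b [^] q) [^] p"
          unfolding b(2) using b(1)
          by (simp add: nat_pow_distrib nat_pow_int_pow int_pow_nat_pow mult.commute swap [of b p q])
        then show ?thesis by (rule mem_mod_pow_spanI [OF powX [OF b(1)]])
      qed
      have "coprime m p"
        using prime_imp_coprime [OF p False] by (simp add: coprime_commute)
      \<comment> \<open>By Bezout, \<open>y\<close> splits into a power of \<open>(y^m)^q\<close>,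
        which is a \<open>q\<close>-th power from \<open>N\<close>, and a \<open>p\<close>-th
        power.\<close>
      then have "coprime (m * q) p" by (simp add: q_def)
      then obtain u t :: int where ut: "u * int (m * q) + t * int p = 1"
        using bezout_int [of "int (m * q)" "int p"] by (auto simp del: of_nat_mult)
      have "y = y [^] (u * int (m * q) + t * int p)" by (simp add: ut del: of_nat_mult)
      also have "\<dots> = ((y [^] m) [^] q) [^] u \<otimes> (y [^] t) [^] p"
        by (simp add: int_pow_mult nat_pow_int_pow int_pow_nat_pow nat_pow_pow mult.commute)
      also have "\<dots> \<in> mod_pow_span X p (z [^] q)"
        by (intro S.m_closed subgroup_int_pow_closed [OF S.subgroup_axioms] ns m(2) powspan zX
            subgroup_int_pow_closed [OF X yX])
      finally show "y \<in> mod_pow_span X p (z [^] q)" .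
    qed
  next
    case True
    show ?thesis
    proof (rule reduce [OF yX selfspan [OF yX]])
      interpret S: subgroup "mod_pow_span X p y" G
        by (rule subgroup_mod_pow_span_comm [OF X]) simp
      fix n assume n: "n \<in> N"
      consider "N \<subseteq> (\<lambda>x. x [^] p) ` N" | "y [^] m \<notin> (\<lambda>x. x [^] (p ^ k)) ` N"
        using div [OF p True] by blast
      then show "n [^] q \<in> mod_pow_span X p y"
      proof cases
        case 1
        then obtain v where v: "v \<in> N" "n = v [^] p" using n by blast
        then have "n [^] q = (v [^] q) [^] p" by (simp add: swap [of v p q])
        then show ?thesis using powspan [OF powX [OF v(1)] yX] by simp
      next
        case 2
        have "p > 0" "q > 0" using p m by (auto simp: q_def prime_gt_0_nat)
        have pk: "p ^ k dvd q" unfolding q_def using True by (rule dvd_power_same)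
        \<comment> \<open>The exponent \<open>q * p\<close> serves twice: \<open>v^(qp)\<close> is a
          \<open>p^k\<close>-th power in \<open>N\<close>, because \<open>p^k\<close> divides
          \<open>q\<close>, and it is the \<open>p\<close>-th power of the element
          \<open>v^q\<close> of \<open>X\<close>.\<close>
        have "y [^] m \<in> mod_pow_span N (q * p) z" using gen [of "q * p"] m \<open>p > 0\<close> \<open>q > 0\<close> by auto
        then obtain \<nu> :: int and v where v: "v \<in> N" "y [^] m = z [^] \<nu> \<otimes> v [^] (q * p)"
          by (rule mem_mod_pow_spanE)
        have not_dvd: "\<not> int p ^ k dvd \<nu>"
        proof
          assume "int p ^ k dvd \<nu>"
          then obtain t where t: "\<nu> = t * int (p ^ k)" by (auto simp: dvd_def mult.commute)
          obtain r where r: "q = r * p ^ k" using pk by (auto simp: dvd_def mult.commute)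
          have "y [^] m = (z [^] t \<otimes> v [^] (r * p)) [^] (p ^ k)"
            unfolding v(2) t r using v(1)
            by (simp add: nat_pow_distrib nat_pow_int_pow nat_pow_pow mult.assoc mult.commute mult.left_commute del: of_nat_power)
          moreover have "z [^] t \<otimes> v [^] (r * p) \<in> N"
            using v(1) subgroup_int_pow_closed [OF N z] subgroup_int_pow_closed [OF N v(1), of "int (r * p)"]
            by (auto simp: int_pow_int simp del: of_nat_mult)
          ultimately show False using 2 by blast
        qed
        then have "\<nu> \<noteq> 0" by auto
        moreover have "\<not> is_unit (int p)" using p by auto
        ultimately obtain \<mu> where \<mu>: "\<nu> = int p ^ multiplicity (int p) \<nu> * \<mu>" "\<not> int p dvd \<mu>"
          by (rule multiplicity_decompose')
        define j where "j = multiplicity (int p) \<nu>"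
        have "j < k"
        proof (rule ccontr)
          assume "\<not> j < k"
          then have "int p ^ k dvd int p ^ j" by (simp add: le_imp_power_dvd)
          then show False using not_dvd \<mu>(1) unfolding j_def by (metis dvd_mult2)
        qed
        then have "p ^ j dvd q" using pk by (meson dvd_trans le_imp_power_dvd less_imp_le)
        then obtain r where r: "q = p ^ j * r" by (auto simp: dvd_def)
        have "coprime \<mu> (int p)"
          using prime_imp_coprime [OF _ \<mu>(2)] p by (simp add: coprime_commute)
        then obtain u t where ut: "u * \<mu> + t * int p = 1"
          using bezout_int [of \<mu> "int p"] by auto
        have zq: "z [^] q \<in> mod_pow_span X p y"
        proof -
          have "z [^] \<nu> = y [^] m \<otimes> inv ((v [^] q) [^] p)"
            using v by (simp add: m_assoc nat_pow_pow)
          also have "\<dots> \<in> mod_pow_span X p y"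
            using selfspan [OF yX] v(1)
            by (intro S.m_closed S.m_inv_closed powspan powX yX)
              (auto intro: S.subgroup_axioms [THEN subgroup_int_pow_closed, of y "int m", unfolded int_pow_int])
          finally have z\<nu>: "z [^] \<nu> \<in> mod_pow_span X p y" .
          \<comment> \<open>Multiplying the Bezout relation by \<open>q = p^j r\<close> writes
            \<open>q\<close> as a multiple of \<open>\<nu> = p^j \<mu>\<close> plus a multiple of
            \<open>qp\<close>.\<close>
          have "int q = \<nu> * (u * int r) + int q * t * int p"
          proof -
            have "int q = int q * (u * \<mu> + t * int p)" by (simp add: ut)
            also have "\<dots> = (int p ^ j * \<mu>) * (u * int r) + int q * t * int p"
              by (simp add: r algebra_simps)
            finally show ?thesis using \<mu>(1) by (simp add: j_def)
          qed
          then have "z [^] q = z [^] (\<nu> * (u * int r) + int q * t * int p)"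
            by (metis int_pow_int)
          also have "\<dots> = (z [^] \<nu>) [^] (u * int r) \<otimes> ((z [^] q) [^] t) [^] p"
            by (simp add: int_pow_mult int_pow_pow nat_pow_int_pow int_pow_nat_pow)
          also have "\<dots> \<in> mod_pow_span X p y"
            by (intro S.m_closed subgroup_int_pow_closed [OF S.subgroup_axioms z\<nu>] powspan yX
                subgroup_int_pow_closed [OF X powX [OF z]])
          finally show ?thesis .
        qed
        have "n \<in> mod_pow_span N p z" using gen [of p] n \<open>p > 0\<close> by blast
        then obtain i :: int and b where b: "b \<in> N" "n = z [^] i \<otimes> b [^] p" by (rule mem_mod_pow_spanE)
        have "n [^] q = (z [^] q) [^] i \<otimes> (b [^] q) [^] p"
          unfolding b(2) using b(1)
          by (simp add: nat_pow_distrib nat_pow_int_pow int_pow_nat_pow mult.commute swap [of b p q])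
        also have "\<dots> \<in> mod_pow_span X p y"
          by (intro S.m_closed subgroup_int_pow_closed [OF S.subgroup_axioms zq] powspan powX b yX)
        finally show ?thesis .
      qed
    qed
  qed
  then show ?thesis unfolding X_def q_def .
qed

lemma mod_pow_span_absorb:
  assumes N: "subgroup N G" and [simp]: "x \<in> carrier G" and n: "n \<in> N"
  shows "mod_pow_span N q (x \<otimes> n [^] (q::nat)) \<subseteq> mod_pow_span N q x"
proof
  interpret N: subgroup N G by fact
  fix a assume "a \<in> mod_pow_span N q (x \<otimes> n [^] q)"
  then obtain i :: int and b where b: "b \<in> N" "a = (x \<otimes> n [^] q) [^] i \<otimes> b [^] q"
    by (rule mem_mod_pow_spanE)
  have "a = x [^] i \<otimes> (n [^] i \<otimes> b) [^] q"
    unfolding b(2) using b(1) n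
    by (simp add: int_pow_distrib nat_pow_distrib nat_pow_int_pow int_pow_nat_pow m_assoc mult.commute)
  moreover have "n [^] i \<otimes> b \<in> N" using b n subgroup_int_pow_closed [OF N n] by simp
  ultimately show "a \<in> mod_pow_span N q x" by (rule mem_mod_pow_spanI [rotated])
qed

lemma mod_pow_span_eq:
  assumes N: "subgroup N G" and [simp]: "x \<in> carrier G" and n: "n \<in> N"
  shows "mod_pow_span N q (x \<otimes> n [^] (q::nat)) = mod_pow_span N q x"
proof (rule subset_antisym)
  interpret N: subgroup N G by fact
  show "mod_pow_span N q (x \<otimes> n [^] q) \<subseteq> mod_pow_span N q x"
    by (rule mod_pow_span_absorb [OF N _ n]) simp
  have "x = (x \<otimes> n [^] q) \<otimes> (inv n) [^] q" using n by (simp add: nat_pow_inv m_assoc)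
  then show "mod_pow_span N q x \<subseteq> mod_pow_span N q (x \<otimes> n [^] q)"
    using mod_pow_span_absorb [OF N, of "x \<otimes> n [^] q" "inv n" q] n by simp
qed

end

lemma (in group) subgroup_pow_image_abelian:
  assumes N: "subgroup N G" and comm: "\<And>x y. x \<in> N \<Longrightarrow> y \<in> N \<Longrightarrow> x \<otimes> y = y \<otimes> x"
  shows "subgroup ((\<lambda>x. x [^] (n::nat)) ` N) G"
proof -
  interpret N: comm_group "G\<lparr>carrier := N\<rparr>"
    by (rule comm_subgroup_imp_comm_group [OF N comm])
  show ?thesis
    using incl_subgroup [OF N] N.subgroup_pow_image [OF N.subgroup_self, of n] nat_pow_consistent by simp
qed

section \<open>Closed subgroups and roots in profinite groups\<close>

context profinite_group begin

lemma closedin_image: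
  assumes "continuous_map T T f" "closedin T N"
  shows "closedin T (f ` N)"
  using continuous_imp_closed_map [OF assms(1) compact Hausdorff] assms(2) by (simp add: closed_map_def)

lemma closedin_lmult: "closedin T N \<Longrightarrow> a \<in> carrier G \<Longrightarrow> closedin T ((\<lambda>x. a \<otimes> x) ` N)"
  by (rule closedin_image) (auto intro!: continuous_group_intros)

text \<open>Since \<open>y^m\<close> is a \<open>q\<close>-th power from \<open>N\<close>, the group
  \<open><y> N^q\<close> is the union of the cosets \<open>y^i N^q\<close> with
  \<open>i < m\<close>, each a continuous image of a compact set.\<close>

lemma closedin_mod_pow_span:
  assumes E: "subgroup E G" and comm: "\<And>x y. x \<in> E \<Longrightarrow> y \<in> E \<Longrightarrow> x \<otimes> y = y \<otimes> x"
    and N: "closedin T N" "subgroup N G" "N \<subseteq> E" and y: "y \<in> E"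
    and m: "(m::nat) > 0" "y [^] m \<in> (\<lambda>x. x [^] q) ` N"
  shows "closedin T (mod_pow_span N q y)"
proof -
  interpret E: subgroup E G by fact
  interpret N: subgroup N G by fact
  have [simp]: "y \<in> carrier G" using y by simp
  let ?A = "\<Union>i<m. (\<lambda>w. y [^] i \<otimes> w) ` ((\<lambda>x. x [^] q) ` N)"
  obtain c where c: "c \<in> N" "y [^] m = c [^] q" using m by blast
  have "mod_pow_span N q y = ?A"
  proof (intro subset_antisym subsetI)
    fix a assume "a \<in> mod_pow_span N q y"
    then obtain i :: int and b where b: "b \<in> N" "a = y [^] i \<otimes> b [^] q" by (rule mem_mod_pow_spanE)
    define r where "r = nat (i mod int m)"
    define t where "t = i div int m"
    have i: "i = int r + int m * t" and r: "r < m"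
      using m by (auto simp: r_def t_def nat_less_iff)
    have ct: "c [^] t \<in> N" by (rule subgroup_int_pow_closed [OF N(2) c(1)])
    have "a = y [^] r \<otimes> ((c [^] t) [^] q \<otimes> b [^] q)"
      unfolding b(2) i using b(1) c(1)
      by (simp add: int_pow_mult int_pow_int m_assoc flip: int_pow_nat_pow)
        (simp add: c(2) nat_pow_int_pow int_pow_nat_pow mult.commute)
    also have "(c [^] t) [^] q \<otimes> b [^] q = (c [^] t \<otimes> b) [^] q"
      by (rule pow_mult_distrib [OF comm, symmetric]) (use ct b(1) N(3) in auto)
    finally show "a \<in> ?A" using r b ct by blast
  next
    fix a assume "a \<in> ?A"
    then obtain i b where "b \<in> N" "a = y [^] int i \<otimes> b [^] q" by (auto simp: int_pow_int)
    then show "a \<in> mod_pow_span N q y" by (rule mem_mod_pow_spanI)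
  qed
  moreover have "closedin T ?A"
    by (intro closedin_Union) (auto intro!: closedin_lmult closedin_image [OF continuous_map_nat_pow] N(1))
  ultimately show ?thesis by simp
qed

text \<open>With \<open>N\<close> the closure of \<open><z>\<close>, the group
  \<open><z> N^n\<close> is a closed subgroup containing \<open>z\<close>, hence all of
  \<open>N\<close>.\<close>

lemma procyclic_subset_mod_pow_span:
  assumes z [simp]: "z \<in> carrier G" and n: "n > 0"
  shows "top_generate G T {z} \<subseteq> mod_pow_span (top_generate G T {z}) n z"
proof -
  let ?N = "top_generate G T {z}"
  have N: "closedin T ?N" "subgroup ?N G"
    by (auto intro: closedin_top_generate subgroup_top_generate)
  have zN: "z \<in> ?N" by (rule incl_top_generate) auto
  note comm = top_generate_single_commute [OF z]
  show ?thesis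
  proof (rule top_generate_minimal)
    show "closedin T (mod_pow_span ?N n z)"
      by (rule closedin_mod_pow_span [OF N(2) comm N subset_refl zN n]) (use zN in auto)
    show "subgroup (mod_pow_span ?N n z) G"
      by (rule subgroup_mod_pow_span [OF N(2) comm N(2) subset_refl zN])
    show "{z} \<subseteq> mod_pow_span ?N n z"
      using mem_mod_pow_spanI [of \<one> ?N z z 1 n] N(2) by (simp add: subgroup.one_closed)
  qed
qed

text \<open>Compactness: the sets of \<open>p\<close>-th roots of \<open>x\<close> in the
  \<open>N k\<close> are closed, nonempty and decreasing.\<close>

lemma pow_image_Inter:
  assumes N: "\<And>k. closedin T (N k)" "decseq N" and x: "\<And>k::nat. x \<in> (\<lambda>w. w [^] (p::nat)) ` N k"
  shows "x \<in> (\<lambda>w. w [^] p) ` (\<Inter>k. N k)"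
proof -
  have NG: "N k \<subseteq> carrier G" for k using closedin_subset [OF N(1)] by simp
  have xG: "x \<in> carrier G" using x [of 0] NG by auto
  define C where "C k = N k \<inter> {w \<in> topspace T. w [^] p \<in> {x}}" for k
  have "closedin T {x}" using Hausdorff xG by (simp add: closedin_Hausdorff_singleton)
  then have "closedin T {w \<in> topspace T. w [^] p \<in> {x}}"
    by (rule closedin_continuous_map_preimage [OF continuous_map_nat_pow])
  then have "closedin T (C k)" for k unfolding C_def by (intro closedin_Int N)
  moreover have "C k \<noteq> {}" for k using x [of k] NG [of k] by (auto simp: C_def)
  moreover have "decseq C" using N(2) by (auto simp: C_def decseq_def)
  ultimately have "(\<Inter>k. C k) \<noteq> {}" by (rule compact_space_imp_nest [OF compact])
  then obtain w where "\<And>k. w \<in> C k" by blast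
  then show ?thesis by (auto simp: C_def)
qed

text \<open>If \<open>x\<close> is infinitely \<open>p\<close>-divisible in \<open>N\<close>, pass to the intersection of the subgroups of
  \<open>p\<^sup>k\<close>-th powers of \<open>N\<close>, which still contains \<open>x\<close> and is \<open>p\<close>-divisible by compactness.\<close>

lemma finite_divisible_family:
  assumes M: "closedin T M" "subgroup M G" and comm: "\<And>x y. x \<in> M \<Longrightarrow> y \<in> M \<Longrightarrow> x \<otimes> y = y \<otimes> x"
    and "finite P"
  shows "\<exists>\<N>. finite \<N> \<and> (\<forall>N\<in>\<N>. closedin T N \<and> subgroup N G \<and> N \<subseteq> M) \<and>
    (\<forall>x\<in>M. \<exists>N\<in>\<N>. x \<in> N \<and> (\<forall>p\<in>P. N \<subseteq> (\<lambda>x. x [^] (p::nat)) ` N \<or> (\<exists>k::nat. x \<notin> (\<lambda>x. x [^] (p ^ k)) ` N)))"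
  using \<open>finite P\<close>
proof (induction P rule: finite_induct)
  case empty
  show ?case using M by (intro exI [of _ "{M}"]) auto
next
  case (insert p P)
  from insert.IH obtain \<N> where fin: "finite \<N>"
    and family: "\<forall>N\<in>\<N>. closedin T N \<and> subgroup N G \<and> N \<subseteq> M"
    and cov: "\<forall>x\<in>M. \<exists>N\<in>\<N>. x \<in> N \<and>
      (\<forall>p\<in>P. N \<subseteq> (\<lambda>x. x [^] p) ` N \<or> (\<exists>k::nat. x \<notin> (\<lambda>x. x [^] (p ^ k)) ` N))"
    by (elim exE conjE)
  note \<N> = family [rule_format]
  define D where "D N = (\<Inter>k::nat. (\<lambda>x. x [^] (p ^ k)) ` N)" for N
  have pow_closed: "closedin T ((\<lambda>x. x [^] (p ^ k)) ` N)" if "N \<in> \<N>" for N and k :: nat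
    using \<N> [OF that] closedin_image [OF continuous_map_nat_pow] by blast
  have pow_sg: "subgroup ((\<lambda>x. x [^] (p ^ k)) ` N) G" if "N \<in> \<N>" for N and k :: nat
    using \<N> [OF that] comm by (intro subgroup_pow_image_abelian) auto
  have dec: "decseq (\<lambda>k. (\<lambda>x. x [^] (p ^ k)) ` N)" if "N \<in> \<N>" for N
  proof (rule decseq_SucI, rule subsetI)
    fix k a assume "a \<in> (\<lambda>x. x [^] (p ^ Suc k)) ` N"
    then obtain x where x: "x \<in> N" "a = x [^] (p ^ Suc k)" by blast
    interpret N: subgroup N G using \<N> [OF that] by blast
    have "a = (x [^] p) [^] (p ^ k)" using x by (simp add: nat_pow_pow)
    moreover have "x [^] p \<in> N"
      using subgroup_int_pow_closed [OF N.subgroup_axioms x(1), of "int p"] by (simp add: int_pow_int)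
    ultimately show "a \<in> (\<lambda>x. x [^] (p ^ k)) ` N" by blast
  qed
  have D_sub: "D N \<subseteq> N" if "N \<in> \<N>" for N
  proof -
    interpret N: subgroup N G using \<N> [OF that] by blast
    have "D N \<subseteq> (\<lambda>x. x [^] (p ^ 0)) ` N" unfolding D_def by blast
    then show ?thesis by auto
  qed
  have D_p: "D N \<subseteq> (\<lambda>x. x [^] p) ` D N" if "N \<in> \<N>" for N
  proof
    interpret N: subgroup N G using \<N> [OF that] by blast
    fix a assume a: "a \<in> D N"
    have "a \<in> (\<lambda>w. w [^] p) ` ((\<lambda>x. x [^] (p ^ k)) ` N)" for k :: nat
    proof -
      have "a \<in> (\<lambda>x. x [^] (p ^ Suc k)) ` N" using a unfolding D_def by blast
      then obtain x where x: "x \<in> N" "a = x [^] (p ^ Suc k)" by blast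
      then have "a = (x [^] (p ^ k)) [^] p" by (simp add: nat_pow_pow mult.commute)
      then show ?thesis using x by blast
    qed
    then show "a \<in> (\<lambda>x. x [^] p) ` D N"
      unfolding D_def by (intro pow_image_Inter pow_closed dec that)
  qed
  \<comment> \<open>Divisibility by a prime treated earlier survives the passage from
    \<open>N\<close> to \<open>D N\<close>; the other alternative survives because
    \<open>D N\<close> is contained in \<open>N\<close>.\<close>
  have D_r: "D N \<subseteq> (\<lambda>x. x [^] r) ` D N" if "N \<in> \<N>" and r: "N \<subseteq> (\<lambda>x. x [^] r) ` N" for N and r :: nat
  proof
    interpret N: subgroup N G using \<N> [OF that(1)] by blast
    fix a assume a: "a \<in> D N"
    have "a \<in> (\<lambda>w. w [^] r) ` ((\<lambda>x. x [^] (p ^ k)) ` N)" for k :: nat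
    proof -
      obtain x where x: "x \<in> N" "a = x [^] (p ^ k)" using a unfolding D_def by blast
      obtain v where v: "v \<in> N" "x = v [^] r" using r x by blast
      have "a = (v [^] (p ^ k)) [^] r" using v by (simp add: x nat_pow_pow mult.commute)
      then show ?thesis using v by blast
    qed
    then show "a \<in> (\<lambda>x. x [^] r) ` D N"
      unfolding D_def by (intro pow_image_Inter pow_closed dec that)
  qed
  show ?case
  proof (intro exI [of _ "\<N> \<union> D ` \<N>"] conjI ballI)
    show "finite (\<N> \<union> D ` \<N>)" using fin by simp
    fix N assume "N \<in> \<N> \<union> D ` \<N>"
    then consider "N \<in> \<N>" | N' where "N' \<in> \<N>" "N = D N'" by blast
    then have "closedin T N \<and> subgroup N G \<and> N \<subseteq> M"
    proof cases
      case 2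
      have "closedin T (D N')" unfolding D_def using 2 by (intro closedin_Inter) (auto intro: pow_closed)
      moreover have "subgroup (D N') G"
        unfolding D_def using 2 by (intro subgroups_Inter) (auto intro: pow_sg)
      ultimately show ?thesis using 2 D_sub \<N> by blast
    qed (use \<N> in blast)
    then show "closedin T N" "subgroup N G" "N \<subseteq> M" by auto
  next
    fix x assume x: "x \<in> M"
    obtain N where N: "N \<in> \<N>" "x \<in> N"
      "\<forall>p\<in>P. N \<subseteq> (\<lambda>x. x [^] p) ` N \<or> (\<exists>k::nat. x \<notin> (\<lambda>x. x [^] (p ^ k)) ` N)"
      using bspec [OF cov x] by (elim bexE conjE)
    show "\<exists>N\<in>\<N> \<union> D ` \<N>. x \<in> N \<and>
      (\<forall>p\<in>insert p P. N \<subseteq> (\<lambda>x. x [^] p) ` N \<or> (\<exists>k::nat. x \<notin> (\<lambda>x. x [^] (p ^ k)) ` N))"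
    proof (cases "x \<in> D N")
      case False
      then have "\<exists>k::nat. x \<notin> (\<lambda>x. x [^] (p ^ k)) ` N" unfolding D_def by blast
      then show ?thesis using N by (intro bexI [of _ N] conjI ballI) (blast elim: insertE)+
    next
      case True
      have "D N \<subseteq> (\<lambda>x. x [^] r) ` D N \<or> (\<exists>k::nat. x \<notin> (\<lambda>x. x [^] (r ^ k)) ` D N)" if "r \<in> P" for r
        using bspec [OF N(3) that] D_r [OF N(1), of r] D_sub [OF N(1)] by blast
      then show ?thesis
        using N(1) True D_p [OF N(1)] by (intro bexI [of _ "D N"] conjI ballI) (blast elim: insertE)+
    qed
  qed
qed

section \<open>Covering a coset by countably many procyclic subgroups\<close>

lemma covered_mono:
  "covered_by_countably_many_procyclic G T B \<Longrightarrow> A \<subseteq> B \<Longrightarrow> covered_by_countably_many_procyclic G T A"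
  unfolding covered_by_countably_many_procyclic_def by (meson subset_trans)

lemma covered_UN:
  assumes "finite R" "\<And>r. r \<in> R \<Longrightarrow> covered_by_countably_many_procyclic G T (A r)"
  shows "covered_by_countably_many_procyclic G T (\<Union>r\<in>R. A r)"
proof -
  obtain \<F> where F: "\<And>r. r \<in> R \<Longrightarrow> countable (\<F> r) \<and> (\<forall>H\<in>\<F> r. procyclic_subgroup G T H) \<and> A r \<subseteq> \<Union>(\<F> r)"
    using assms(2) unfolding covered_by_countably_many_procyclic_def by metis
  show ?thesis
    unfolding covered_by_countably_many_procyclic_def
  proof (intro exI [of _ "\<Union>r\<in>R. \<F> r"] conjI)
    show "countable (\<Union>r\<in>R. \<F> r)" using F assms(1) by (intro countable_UN) (auto intro: countable_finite)
    show "\<forall>H\<in>\<Union>r\<in>R. \<F> r. procyclic_subgroup G T H" using F by (meson UN_E)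
    show "(\<Union>r\<in>R. A r) \<subseteq> \<Union>(\<Union>r\<in>R. \<F> r)" using F by (fastforce dest: subsetD)
  qed
qed

text \<open>An element \<open>y = dx\<close> of the coset lies in \<open>\<langle>y\<rangle>N\<^sup>q\<close>, where \<open>N \<ni> y\<^sup>m\<close> comes from the finite family
  above and \<open>q = m\<^sup>k\<close> is large. This group is procyclic, and it only depends on \<open>N\<close>, \<open>k\<close> and the
  coset \<open>yN\<^sup>q\<close>. For fixed \<open>N\<close> these are finitely many cosets, because \<open>F = {x \<in> M. x\<^sup>m \<in> N}\<close> is
  procyclic and hence \<open>F/F\<^sup>m\<close> and \<open>N/N\<^sup>q\<close> are finite.\<close>

lemma covered_coset:
  assumes d: "d \<in> carrier G" and z: "z \<in> carrier G"
    and dz: "\<And>x. x \<in> top_generate G T {z} \<Longrightarrow> d \<otimes> x = x \<otimes> d"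
    and m: "(m::nat) > 0" "d [^] m \<in> top_generate G T {z}"
  shows "covered_by_countably_many_procyclic G T ((\<lambda>x. d \<otimes> x) ` top_generate G T {z})"
proof -
  define M where "M = top_generate G T {z}"
  note dz = dz [folded M_def] and m = m [folded M_def]
  have M: "closedin T M" "subgroup M G"
    unfolding M_def using z by (auto intro: closedin_top_generate subgroup_top_generate)
  interpret M: subgroup M G by (rule M)
  have commM: "x \<otimes> y = y \<otimes> x" if "x \<in> M" "y \<in> M" for x y
    using that top_generate_single_commute [OF z] by (simp add: M_def)
  \<comment> \<open>The coset \<open>dM\<close> lies in the abelian group \<open>E\<close>, where
    the results on abelian groups apply to elements outside \<open>M\<close>.\<close>
  define E where "E = generate G (insert d M)"
  have sub: "insert d M \<subseteq> carrier G" using d M.subset by blast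
  have E: "subgroup E G" unfolding E_def by (rule generate_is_subgroup [OF sub])
  interpret E: subgroup E G by (rule E)
  have "s \<otimes> t = t \<otimes> s" if "s \<in> insert d M" "t \<in> insert d M" for s t
    using that dz [of s] dz [of t] commM [of s t] by auto
  then have commE: "x \<otimes> y = y \<otimes> x" if "x \<in> E" "y \<in> E" for x y
    using generate_commute [OF sub sub _ that [unfolded E_def]] by blast
  have dE: "d \<in> E" and ME: "M \<subseteq> E" unfolding E_def by (auto intro: generate.incl)
  interpret CE: comm_group "G\<lparr>carrier := E\<rparr>"
    by (rule comm_subgroup_imp_comm_group [OF E commE])
  have span: "CE.mod_pow_span N n x = mod_pow_span N n x" if "x \<in> E" for N n x
    by (rule mod_pow_span_consistent [OF E that])
  have pow_distrib: "(x \<otimes> y) [^] (n::nat) = x [^] n \<otimes> y [^] n" if "x \<in> E" "y \<in> E" for x y n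
    by (rule pow_mult_distrib [OF commE]) (use that in auto)
  have natE: "x [^] n \<in> S" if "subgroup S G" "x \<in> S" for S x and n :: nat
    using subgroup_int_pow_closed [OF that, of "int n"] by (simp add: int_pow_int)
  have "\<exists>\<N>. finite \<N> \<and> (\<forall>N\<in>\<N>. closedin T N \<and> subgroup N G \<and> N \<subseteq> M) \<and>
    (\<forall>x\<in>M. \<exists>N\<in>\<N>. x \<in> N \<and> (\<forall>p\<in>prime_factors m.
      N \<subseteq> (\<lambda>x. x [^] p) ` N \<or> (\<exists>k::nat. x \<notin> (\<lambda>x. x [^] (p ^ k)) ` N)))"
    by (rule finite_divisible_family [OF M commM finite_set_mset])
  then obtain \<N> where fin: "finite \<N>"
    and family: "\<forall>N\<in>\<N>. closedin T N \<and> subgroup N G \<and> N \<subseteq> M"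
    and cov: "\<forall>x\<in>M. \<exists>N\<in>\<N>. x \<in> N \<and> (\<forall>p\<in>prime_factors m.
      N \<subseteq> (\<lambda>x. x [^] p) ` N \<or> (\<exists>k::nat. x \<notin> (\<lambda>x. x [^] (p ^ k)) ` N))"
    by (elim exE conjE)
  \<comment> \<open>Two elements of \<open>dM\<close> whose \<open>m\<close>-th powers lie in
    \<open>N\<close> differ by an element of \<open>F N\<close>.\<close>
  define F where "F N = {x \<in> M. x [^] m \<in> N}" for N
  have gens: "\<exists>f g. f \<in> F N \<and> F N = top_generate G T {f} \<and> g \<in> N \<and> N = top_generate G T {g}"
    if "N \<in> \<N>" for N
  proof -
    have N: "closedin T N" "subgroup N G" "N \<subseteq> M" using family that by auto
    interpret N: subgroup N G by (rule N)
    have "F N = M \<inter> {x \<in> topspace T. x [^] m \<in> N}" using M.subset by (auto simp: F_def)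
    then have cF: "closedin T (F N)"
      using closedin_Int [OF M(1) closedin_continuous_map_preimage [OF continuous_map_nat_pow N(1)]] by simp
    have "subgroup (F N) G"
    proof (rule subgroupI)
      show "F N \<subseteq> carrier G" using M.subset by (auto simp: F_def)
      have "\<one> \<in> F N" by (simp add: F_def)
      then show "F N \<noteq> {}" by blast
      show "inv a \<in> F N" if "a \<in> F N" for a
        using that by (auto simp: F_def nat_pow_inv)
      show "a \<otimes> b \<in> F N" if "a \<in> F N" "b \<in> F N" for a b
        using that ME by (auto simp: F_def pow_distrib subset_iff)
    qed
    then obtain f where "f \<in> F N" "F N = top_generate G T {f}"
      using closed_subgroup_procyclic [OF cF _ z] by (auto simp: F_def M_def)
    moreover obtain g where "g \<in> N" "N = top_generate G T {g}"
      using closed_subgroup_procyclic [OF N(1,2) z] N(3) by (auto simp: M_def)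
    ultimately show ?thesis by blast
  qed
  obtain f g where f: "\<And>N. N \<in> \<N> \<Longrightarrow> f N \<in> F N \<and> F N = top_generate G T {f N}"
    and g: "\<And>N. N \<in> \<N> \<Longrightarrow> g N \<in> N \<and> N = top_generate G T {g N}"
    using gens by metis
  \<comment> \<open>A base point among the elements of the coset with \<open>m\<close>-th power in
    \<open>N\<close>; the others are its products with elements of \<open>F N\<close>.\<close>
  define b where "b N = (SOME y. y \<in> (\<lambda>x. d \<otimes> x) ` M \<and> y [^] m \<in> N)" for N
  define X where "X = (\<lambda>(N, k, i, j). mod_pow_span N (m ^ k) (b N \<otimes> (f N [^] (i::int) \<otimes> g N [^] (j::int))))"
  define \<F> where "\<F> = {C \<in> X ` (\<N> \<times> UNIV). procyclic_subgroup G T C}"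
  have "countable \<F>"
  proof -
    have "countable (\<N> \<times> (UNIV :: (nat \<times> int \<times> int) set))"
      using fin by (intro countable_SIGMA) (auto intro: countable_finite)
    then show ?thesis unfolding \<F>_def by (auto intro: countable_Collect countable_image)
  qed
  moreover have "y \<in> \<Union>\<F>" if y: "y \<in> (\<lambda>x. d \<otimes> x) ` M" for y
  proof -
    have coset: "u \<in> E" "u [^] m \<in> M" if "u \<in> (\<lambda>x. d \<otimes> x) ` M" for u
    proof -
      obtain x where x: "x \<in> M" "u = d \<otimes> x" using \<open>u \<in> (\<lambda>x. d \<otimes> x) ` M\<close> by blast
      then show "u \<in> E" using dE ME by auto
      have "u [^] m = d [^] m \<otimes> x [^] m" using x ME dE by (auto simp: pow_distrib)
      then show "u [^] m \<in> M" using m(2) natE [OF M(2) x(1), of m] by simp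
    qed
    obtain N where N: "N \<in> \<N>" "y [^] m \<in> N" and div: "\<forall>p\<in>prime_factors m.
      N \<subseteq> (\<lambda>x. x [^] p) ` N \<or> (\<exists>k::nat. y [^] m \<notin> (\<lambda>x. x [^] (p ^ k)) ` N)"
      using bspec [OF cov coset(2) [OF y]] by (elim bexE conjE)
    have N': "closedin T N" "subgroup N G" "N \<subseteq> M" using family N(1) by auto
    interpret N: subgroup N G by (rule N')
    have "\<exists>k. \<forall>p\<in>prime_factors m. N \<subseteq> (\<lambda>x. x [^] p) ` N \<or> y [^] m \<notin> (\<lambda>x. x [^] (p ^ (k p))) ` N"
      using div by metis
    then obtain k0 :: "nat \<Rightarrow> nat" where k0: "\<forall>p\<in>prime_factors m.
      N \<subseteq> (\<lambda>x. x [^] p) ` N \<or> y [^] m \<notin> (\<lambda>x. x [^] (p ^ (k0 p))) ` N" by blast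
    \<comment> \<open>The set of \<open>p^k\<close>-th powers of \<open>N\<close> shrinks as
      \<open>k\<close> grows, so the sum of the \<open>k0 p\<close> serves all primes dividing
      \<open>m\<close> at once.\<close>
    define k where "k = (\<Sum>p\<in>prime_factors m. k0 p)"
    have k: "N \<subseteq> (\<lambda>x. x [^] p) ` N \<or> y [^] m \<notin> (\<lambda>x. x [^] (p ^ k)) ` N"
      if p: "p \<in> prime_factors m" for p
    proof -
      have "k0 p \<le> k" unfolding k_def using p by (intro member_le_sum) auto
      then have e: "p ^ k = p ^ (k - k0 p) * p ^ k0 p" by (simp flip: power_add)
      have "x [^] (p ^ k) \<in> (\<lambda>x. x [^] (p ^ (k0 p))) ` N" if "x \<in> N" for x
      proof -
        have "x [^] (p ^ k) = (x [^] (p ^ (k - k0 p))) [^] (p ^ k0 p)"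
          unfolding e using that by (simp add: nat_pow_pow)
        then show ?thesis using natE [OF N'(2) that] by blast
      qed
      then have sub: "(\<lambda>x. x [^] (p ^ k)) ` N \<subseteq> (\<lambda>x. x [^] (p ^ (k0 p))) ` N"
        by (rule image_subsetI)
      from bspec [OF k0 p] show ?thesis
        by (elim disjE) (erule disjI1, rule disjI2, erule contra_subsetD [OF sub])
    qed
    define q where "q = m ^ k"
    have "q > 0" using m by (simp add: q_def)
    have gN: "g N \<in> N" "\<And>n. n > 0 \<Longrightarrow> N \<subseteq> mod_pow_span N n (g N)"
      using g [OF N(1)] procyclic_subset_mod_pow_span [of "g N"] N.mem_carrier by auto
    have yE: "y \<in> E" by (rule coset [OF y])
    have NE: "N \<subseteq> E" using N'(3) ME by blast
    have sgN: "subgroup N (G\<lparr>carrier := E\<rparr>)" by (rule subgroup_incl [OF N'(2) E NE])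
    have sgX: "subgroup (mod_pow_span N q y) G"
      by (rule subgroup_mod_pow_span [OF E commE N'(2) NE yE])
    have "\<exists>c\<in>mod_pow_span N q y. mod_pow_span N q y = top_generate G T {c}"
    proof (rule procyclic_if_cyclic_mod_primes)
      have "y [^] (m * q) = (y [^] m) [^] q" using yE by (simp add: nat_pow_pow)
      then show "closedin T (mod_pow_span N q y)"
        by (intro closedin_mod_pow_span [OF E commE N'(1,2) NE yE, of "m * q"])
          (use m \<open>q > 0\<close> N(2) in auto)
      show "subgroup (mod_pow_span N q y) G" by (rule sgX)
      have "mod_pow_span N q y \<subseteq> E"
      proof
        fix a assume "a \<in> mod_pow_span N q y"
        then obtain i :: int and n where "n \<in> N" "a = y [^] i \<otimes> n [^] q" by (rule mem_mod_pow_spanE)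
        then show "a \<in> E"
          using subgroup_int_pow_closed [OF E yE] natE [OF E, of n] NE by auto
      qed
      then show "u \<otimes> v = v \<otimes> u" if "u \<in> mod_pow_span N q y" "v \<in> mod_pow_span N q y" for u v
        using commE that by blast
      fix p :: nat assume p: "prime p"
      have XE: "x \<in> E" if "x \<in> mod_pow_span N q y" for x
        using \<open>mod_pow_span N q y \<subseteq> E\<close> that by blast
      have "\<exists>x\<in>CE.mod_pow_span N (m ^ k) y.
          CE.mod_pow_span N (m ^ k) y \<subseteq> CE.mod_pow_span (CE.mod_pow_span N (m ^ k) y) p x"
      proof (rule CE.mod_pow_span_cyclic_mod_primes [OF sgN gN(1) _ _ m(1) _ _ p])
        show "N \<subseteq> CE.mod_pow_span N n (g N)" if "n > 0" for n
          using gN(2) [OF that] span [of "g N" N n] gN(1) NE by auto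
        show "y \<in> carrier (G\<lparr>carrier := E\<rparr>)" using yE by simp
        show "y [^]\<^bsub>G\<lparr>carrier := E\<rparr>\<^esub> m \<in> N" using N(2) nat_pow_consistent by simp
        show "N \<subseteq> (\<lambda>x. x [^]\<^bsub>G\<lparr>carrier := E\<rparr>\<^esub> r) ` N \<or>
          y [^]\<^bsub>G\<lparr>carrier := E\<rparr>\<^esub> m \<notin> (\<lambda>x. x [^]\<^bsub>G\<lparr>carrier := E\<rparr>\<^esub> (r ^ k)) ` N"
          if "prime r" "r dvd m" for r
          using k [of r] that m(1) nat_pow_consistent by (simp add: prime_factors_dvd)
      qed
      then show "\<exists>x\<in>mod_pow_span N q y. mod_pow_span N q y \<subseteq> mod_pow_span (mod_pow_span N q y) p x"
        unfolding span [OF yE] q_def [symmetric] using span XE by auto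
    qed
    then have proc: "procyclic_subgroup G T (mod_pow_span N q y)"
      using subgroup.subset [OF sgX] unfolding procyclic_subgroup_def by blast
    have bN: "b N \<in> (\<lambda>x. d \<otimes> x) ` M" "b N [^] m \<in> N"
      unfolding b_def using someI [of "\<lambda>y. y \<in> (\<lambda>x. d \<otimes> x) ` M \<and> y [^] m \<in> N" y] y N(2) by auto
    have bE: "b N \<in> E" by (rule coset [OF bN(1)])
    define a where "a = inv (b N) \<otimes> y"
    have aE: "a \<in> E" and y_eq: "y = b N \<otimes> a"
      unfolding a_def using bE yE by (auto simp: cancel_inv_left)
    have "a \<in> M"
    proof -
      obtain u v where "u \<in> M" "b N = d \<otimes> u" "v \<in> M" "y = d \<otimes> v" using bN(1) y by blast
      then have "a = inv u \<otimes> v" using d by (simp add: a_def group_word_simps)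
      then show ?thesis using \<open>u \<in> M\<close> \<open>v \<in> M\<close> by simp
    qed
    moreover have "a [^] m \<in> N"
    proof -
      have "a [^] m = inv (b N [^] m) \<otimes> y [^] m"
        unfolding a_def using bE yE by (simp add: pow_distrib nat_pow_inv)
      then show ?thesis using bN(2) N(2) by simp
    qed
    ultimately have aF: "a \<in> F N" by (simp add: F_def)
    have fF: "f N \<in> F N" using f [OF N(1)] by blast
    have fE: "f N \<in> E" and fG: "f N \<in> carrier G" using fF ME E.mem_carrier by (auto simp: F_def)
    \<comment> \<open>Two reductions: \<open>a\<close> modulo \<open>m\<close>-th powers of
      \<open>F N\<close>, then \<open>c^m\<close>, which lies in \<open>N\<close>, modulo
      \<open>q\<close>-th powers of \<open>N\<close>. The outcome is \<open>y = y' n^q\<close>, so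
      \<open>y\<close> and \<open>y'\<close> span the same group with \<open>N^q\<close>.\<close>
    have "a \<in> mod_pow_span (F N) m (f N)"
      using aF f [OF N(1)] procyclic_subset_mod_pow_span [OF fG m(1)] by auto
    then obtain i :: int and c where c: "c \<in> F N" "a = f N [^] i \<otimes> c [^] m" by (rule mem_mod_pow_spanE)
    have "c [^] m \<in> mod_pow_span N q (g N)" using c(1) gN(2) [OF \<open>q > 0\<close>] by (auto simp: F_def)
    then obtain j :: int and n where n: "n \<in> N" "c [^] m = g N [^] j \<otimes> n [^] q" by (rule mem_mod_pow_spanE)
    define y' where "y' = b N \<otimes> (f N [^] i \<otimes> g N [^] j)"
    have gE: "g N \<in> E" using gN(1) NE by blast
    have y'E: "y' \<in> E"
      unfolding y'_def using bE subgroup_int_pow_closed [OF E fE] subgroup_int_pow_closed [OF E gE] by simp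
    have "y = y' \<otimes> n [^] q"
      unfolding y'_def y_eq c(2) n(2) using bE fG gE n(1) by (simp add: m_assoc)
    then have "mod_pow_span N q y = mod_pow_span N q y'"
      using CE.mod_pow_span_eq [OF sgN _ n(1), of y' q] y'E yE span nat_pow_consistent by simp
    moreover have "mod_pow_span N q y' = X (N, k, i, j)" by (simp add: X_def y'_def q_def)
    ultimately have "mod_pow_span N q y \<in> \<F>" using proc N(1) by (auto simp: \<F>_def)
    moreover have "y \<in> mod_pow_span N q y"
      by (rule mem_mod_pow_spanI [of \<one> _ _ _ 1]) (use yE in auto)
    ultimately show ?thesis by blast
  qed
  ultimately show ?thesis
    unfolding covered_by_countably_many_procyclic_def M_def [symmetric]
    by (intro exI [of _ \<F>]) (auto simp: \<F>_def)
qed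

end

section \<open>Commutators in profinite groups\<close>

lemma (in group_hom) hom_commutator:
  "x \<in> carrier G \<Longrightarrow> y \<in> carrier G \<Longrightarrow> h (commutator G x y) = commutator H (h x) (h y)"
  by (simp add: commutator_def)

context profinite_group begin

lemma continuous_map_commutator:
  "continuous_map (prod_topology T T) T (\<lambda>p. commutator G (fst p) (snd p))"
  unfolding commutator_def by (intro continuous_group_intros)

lemma openin_lmult_preimage:
  "openin T V \<Longrightarrow> a \<in> carrier G \<Longrightarrow> openin T {x \<in> topspace T. a \<otimes> x \<in> V}"
  by (rule openin_continuous_map_preimage) (auto intro!: continuous_group_intros)

lemma left_quotient_mem:
  assumes "N \<lhd> G" "x \<in> carrier G" "y \<in> carrier G"
  shows "inv y \<otimes> x \<in> N \<longleftrightarrow> N #> x = N #> y"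
proof -
  interpret N: normal N G by fact
  have "inv y \<otimes> x = inv y \<otimes> (x \<otimes> inv y) \<otimes> y" "x \<otimes> inv y = y \<otimes> (inv y \<otimes> x) \<otimes> inv y"
    using assms by (simp_all add: group_word_simps)
  then have "inv y \<otimes> x \<in> N \<longleftrightarrow> x \<otimes> inv y \<in> N"
    using N.inv_op_closed1 N.inv_op_closed2 assms by metis
  then show ?thesis using rcoset_eq_iff [OF N.subgroup_axioms assms(2,3)] by simp
qed

lemma commutator_box_exists:
  assumes cov: "covered_by_countably_many_procyclic G T (commutators G)"
    and H: "open_normal H" and g: "g \<in> carrier G" "g' \<in> carrier G"
  shows "\<exists>K. open_normal K \<and> K \<subseteq> H \<and> (\<exists>a\<in>carrier G. \<exists>b\<in>carrier G. \<exists>c\<in>carrier G.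
    H #> g = H #> a \<and> H #> g' = H #> b \<and>
    (\<forall>h\<in>K. \<forall>k\<in>K. commutator G (a \<otimes> h) (b \<otimes> k) \<in> top_generate G T {c}))"
proof -
  let ?X = "prod_topology T T"
  obtain \<F> where \<F>: "countable \<F>" "\<And>C. C \<in> \<F> \<Longrightarrow> procyclic_subgroup G T C" "commutators G \<subseteq> \<Union>\<F>"
    using cov unfolding covered_by_countably_many_procyclic_def by blast
  have sgH: "subgroup H G" by (rule open_normal_imp_subgroup [OF H])
  define A where "A x = {y \<in> carrier G. H #> y \<in> {H #> x}}" for x
  \<comment> \<open>Intersecting with the open and closed product of cosets forces the interior
    point supplied by Baire's theorem into the prescribed cosets.\<close>
  define P where "P C = {p \<in> topspace ?X. commutator G (fst p) (snd p) \<in> C} \<inter> (A g \<times> A g')" for C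
  have closed: "closedin ?X (P C)" if "C \<in> \<F>" for C
  proof -
    have "closedin T C"
      using \<F>(2) [OF that] closedin_top_generate by (auto simp: procyclic_subgroup_def)
    moreover have "closedin T (A x)" for x unfolding A_def by (rule closedin_rcoset_pred [OF H])
    ultimately show ?thesis
      unfolding P_def
      by (intro closedin_Int closedin_continuous_map_preimage [OF continuous_map_commutator])
        (auto simp: closedin_prod_Times_iff)
  qed
  have "\<exists>C\<in>\<F>. ?X interior_of P C \<noteq> {}"
  proof (rule ccontr)
    assume empty: "\<not> (\<exists>C\<in>\<F>. ?X interior_of P C \<noteq> {})"
    have "?X interior_of \<Union>(P ` \<F>) = {}"
    proof (rule Baire_category_alt)
      have "compact_space ?X" "Hausdorff_space ?X"
        using compact Hausdorff by (auto simp: compact_space_prod_topology Hausdorff_space_prod_topology)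
      then show "completely_metrizable_space ?X \<or> locally_compact_space ?X \<and> regular_space ?X"
        using compact_imp_locally_compact_space compact_Hausdorff_imp_regular_space by blast
      show "countable (P ` \<F>)" using \<F>(1) by simp
      show "closedin ?X S \<and> ?X interior_of S = {}" if "S \<in> P ` \<F>" for S
        using that closed empty by blast
    qed
    moreover have "A g \<times> A g' \<subseteq> ?X interior_of \<Union>(P ` \<F>)"
    proof (rule interior_of_maximal)
      show "openin ?X (A g \<times> A g')"
        unfolding A_def by (intro openin_prod_Times_iff [THEN iffD2] disjI2 conjI openin_rcoset_pred H)
      show "A g \<times> A g' \<subseteq> \<Union>(P ` \<F>)"
      proof
        fix p assume p: "p \<in> A g \<times> A g'"
        then have pG: "fst p \<in> carrier G" "snd p \<in> carrier G" by (auto simp: A_def)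
        then have "commutator G (fst p) (snd p) \<in> commutators G" by (auto simp: commutators_def)
        then obtain C where "C \<in> \<F>" "commutator G (fst p) (snd p) \<in> C" using \<F>(3) by blast
        then show "p \<in> \<Union>(P ` \<F>)" using p pG by (auto simp: P_def mem_Times_iff)
      qed
    qed
    moreover have "(g, g') \<in> A g \<times> A g'" using g by (auto simp: A_def)
    ultimately show False by blast
  qed
  then obtain C p where C: "C \<in> \<F>" and p: "p \<in> ?X interior_of P C" by blast
  obtain a b where ab: "p = (a, b)" by (cases p)
  have op: "openin ?X (?X interior_of P C)" by simp
  obtain V W where VW: "openin T V" "openin T W" "a \<in> V" "b \<in> W" "V \<times> W \<subseteq> ?X interior_of P C"
    using openin_prod_topology_alt [THEN iffD1, rule_format, OF op p [unfolded ab]] by (elim exE conjE)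
  then have VWP: "V \<times> W \<subseteq> P C" using interior_of_subset [of ?X "P C"] by blast
  have "(a, b) \<in> P C" using VWP VW by blast
  then have abG: "a \<in> carrier G" "b \<in> carrier G" "H #> a = H #> g" "H #> b = H #> g'"
    by (auto simp: P_def A_def)
  let ?V = "{x \<in> topspace T. a \<otimes> x \<in> V}" and ?W = "{x \<in> topspace T. b \<otimes> x \<in> W}"
  have "openin T (?V \<inter> ?W)" using VW abG by (intro openin_Int openin_lmult_preimage) auto
  moreover have "\<one> \<in> ?V \<inter> ?W" using VW abG by auto
  ultimately obtain U where U: "open_normal U" "U \<subseteq> ?V \<inter> ?W" using open_normal_inside by blast
  obtain c where c: "c \<in> carrier G" "C = top_generate G T {c}"
    using \<F>(2) [OF C] unfolding procyclic_subgroup_def by blast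
  have "commutator G (a \<otimes> h) (b \<otimes> k) \<in> top_generate G T {c}" if "h \<in> U" "k \<in> U" for h k
  proof -
    have "(a \<otimes> h, b \<otimes> k) \<in> P C" using that U(2) VWP by blast
    then show ?thesis using c by (simp add: P_def)
  qed
  then show ?thesis
    using open_normal_Int [OF U(1) H] abG c(1)
    by (intro exI [of _ "U \<inter> H"] conjI bexI [of _ a] bexI [of _ b] bexI [of _ c]) auto
qed

lemma finite_coset_representatives:
  assumes "open_normal H"
  shows "\<exists>R. finite R \<and> R \<subseteq> carrier G \<and> (\<forall>g\<in>carrier G. \<exists>r\<in>R. H #> g = H #> r)"
proof -
  have "rcosets H = (\<lambda>x. H #> x) ` carrier G" by (auto simp: RCOSETS_def)
  then obtain R where "R \<subseteq> carrier G" "finite R" "(\<lambda>x. H #> x) ` carrier G = (\<lambda>x. H #> x) ` R"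
    using finite_rcosets [OF assms] finite_subset_image [of "rcosets H" "\<lambda>x. H #> x" "carrier G"] by auto
  then show ?thesis by (intro exI [of _ R]) blast
qed

text \<open>A box depends only on the cosets \<open>Hg\<close> and \<open>Hg'\<close> and survives
  shrinking \<open>K\<close>. There are finitely many pairs of cosets, so the intersection of the
  corresponding subgroups serves all of them.\<close>

lemma commutator_boxes_exist:
  assumes cov: "covered_by_countably_many_procyclic G T (commutators G)" and H: "open_normal H"
  shows "\<exists>K. open_normal K \<and> K \<subseteq> H \<and> (\<forall>g\<in>carrier G. \<forall>g'\<in>carrier G.
    \<exists>a\<in>carrier G. \<exists>b\<in>carrier G. \<exists>c\<in>carrier G. inv a \<otimes> g \<in> H \<and> inv b \<otimes> g' \<in> H \<and>
      (\<forall>h\<in>K. \<forall>k\<in>K. commutator G (a \<otimes> h) (b \<otimes> k) \<in> top_generate G T {c}))"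
proof -
  obtain R where R: "finite R" "R \<subseteq> carrier G" "\<And>g. g \<in> carrier G \<Longrightarrow> \<exists>r\<in>R. H #> g = H #> r"
    using finite_coset_representatives [OF H] by blast
  define box where "box g g' K \<longleftrightarrow> (\<exists>a\<in>carrier G. \<exists>b\<in>carrier G. \<exists>c\<in>carrier G.
    H #> g = H #> a \<and> H #> g' = H #> b \<and>
    (\<forall>h\<in>K. \<forall>k\<in>K. commutator G (a \<otimes> h) (b \<otimes> k) \<in> top_generate G T {c}))" for g g' K
  have "\<forall>p\<in>R \<times> R. \<exists>K. open_normal K \<and> K \<subseteq> H \<and> box (fst p) (snd p) K"
    unfolding box_def using commutator_box_exists [OF cov H] R(2) by (auto simp: subset_iff)
  then obtain K where K: "\<And>p. p \<in> R \<times> R \<Longrightarrow> open_normal (K p) \<and> K p \<subseteq> H \<and> box (fst p) (snd p) (K p)"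
    by metis
  let ?K = "H \<inter> \<Inter>(K ` (R \<times> R))"
  have "open_normal ?K"
    by (rule open_normal_finite_Inter) (use R K H in auto)
  moreover have "\<exists>a\<in>carrier G. \<exists>b\<in>carrier G. \<exists>c\<in>carrier G. inv a \<otimes> g \<in> H \<and> inv b \<otimes> g' \<in> H \<and>
      (\<forall>h\<in>?K. \<forall>k\<in>?K. commutator G (a \<otimes> h) (b \<otimes> k) \<in> top_generate G T {c})"
    if g: "g \<in> carrier G" "g' \<in> carrier G" for g g'
  proof -
    obtain r s where rs: "r \<in> R" "s \<in> R" "H #> g = H #> r" "H #> g' = H #> s" using R(3) g by metis
    have "box r s (K (r, s))" using K [of "(r, s)"] rs by simp
    then obtain a b c where abc: "a \<in> carrier G" "b \<in> carrier G" "c \<in> carrier G"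
      "H #> r = H #> a" "H #> s = H #> b"
      "\<forall>h\<in>K (r, s). \<forall>k\<in>K (r, s). commutator G (a \<otimes> h) (b \<otimes> k) \<in> top_generate G T {c}"
      unfolding box_def by blast
    have in_H: "inv a \<otimes> g \<in> H" "inv b \<otimes> g' \<in> H"
      using left_quotient_mem [OF open_normal_imp_normal [OF H]] g abc rs by auto
    have "?K \<subseteq> K (r, s)" using rs by blast
    then have bx: "\<forall>h\<in>?K. \<forall>k\<in>?K. commutator G (a \<otimes> h) (b \<otimes> k) \<in> top_generate G T {c}"
      using abc(6) by (meson subsetD)
    show ?thesis
      by (rule bexI [OF _ abc(1)], rule bexI [OF _ abc(2)], rule bexI [OF _ abc(3)], intro conjI in_H bx)
  qed
  ultimately show ?thesis by (intro exI [of _ ?K] conjI ballI) auto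
qed

lemma rcoset_image_normal:
  assumes "open_normal U" "N \<lhd> G"
  shows "(\<lambda>x. U #> x) ` N \<lhd> G Mod U"
  by (rule normal.surj_hom_normal_subgroup [OF assms(2) rcoset_hom [OF assms(1)]])
    (simp add: carrier_FactGroup)

text \<open>\<open>H\<close>, \<open>K\<close> and \<open>L\<close> are chosen once in
  \<open>G\<close>. In every finite quotient their boxes become boxes in cyclic groups, so the
  theorem on finite groups applies to the images of the same three subgroups.\<close>

lemma commutator_subgroup_open_normal_procyclic:
  assumes cov: "covered_by_countably_many_procyclic G T (commutators G)"
  shows "\<exists>L c. open_normal L \<and> c \<in> carrier G \<and>
    top_generate G T {commutator G l g | l g. l \<in> L \<and> g \<in> carrier G} = top_generate G T {c}"
proof -
  obtain H where H: "open_normal H" and boxH: "\<forall>g\<in>carrier G. \<forall>g'\<in>carrier G.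
    \<exists>a\<in>carrier G. \<exists>b\<in>carrier G. \<exists>c\<in>carrier G. inv a \<otimes> g \<in> carrier G \<and> inv b \<otimes> g' \<in> carrier G \<and>
      (\<forall>h\<in>H. \<forall>k\<in>H. commutator G (a \<otimes> h) (b \<otimes> k) \<in> top_generate G T {c})"
    using commutator_boxes_exist [OF cov open_normal_carrier] by blast
  obtain K where K: "open_normal K" "K \<subseteq> H" and boxK: "\<forall>g\<in>carrier G. \<forall>g'\<in>carrier G.
    \<exists>a\<in>carrier G. \<exists>b\<in>carrier G. \<exists>c\<in>carrier G. inv a \<otimes> g \<in> H \<and> inv b \<otimes> g' \<in> H \<and>
      (\<forall>h\<in>K. \<forall>k\<in>K. commutator G (a \<otimes> h) (b \<otimes> k) \<in> top_generate G T {c})"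
    using commutator_boxes_exist [OF cov H] by blast
  obtain L where L: "open_normal L" "L \<subseteq> K" and boxL: "\<forall>g\<in>carrier G. \<forall>g'\<in>carrier G.
    \<exists>a\<in>carrier G. \<exists>b\<in>carrier G. \<exists>c\<in>carrier G. inv a \<otimes> g \<in> K \<and> inv b \<otimes> g' \<in> K \<and>
      (\<forall>h\<in>L. \<forall>k\<in>L. commutator G (a \<otimes> h) (b \<otimes> k) \<in> top_generate G T {c})"
    using commutator_boxes_exist [OF cov K(1)] by blast
  define S where "S = {commutator G l g | l g. l \<in> L \<and> g \<in> carrier G}"
  have LG: "L \<subseteq> carrier G" using subgroup.subset [OF open_normal_imp_subgroup [OF L(1)]] .
  have S: "S \<subseteq> carrier G" using LG by (auto simp: S_def)
  have "\<exists>c\<in>top_generate G T S. top_generate G T S = top_generate G T {c}"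
  proof (rule procyclic_if_cyclic_quotients [OF closedin_top_generate subgroup_top_generate [OF S]])
    fix U assume U: "open_normal U"
    interpret \<pi>: group_hom G "G Mod U" "\<lambda>x. U #> x" by (rule rcoset_hom [OF U])
    let ?\<pi> = "\<lambda>x. U #> x"
    have box: "\<exists>d\<in>carrier (G Mod U). (\<forall>k\<in>?\<pi> ` N.
          commutator (G Mod U) k (?\<pi> a) \<in> generate (G Mod U) {d} \<and>
          commutator (G Mod U) k (?\<pi> b) \<in> generate (G Mod U) {d} \<and>
          (\<forall>k'\<in>?\<pi> ` N. commutator (G Mod U) k k' \<in> generate (G Mod U) {d}))"
      if N: "open_normal N" and abc: "a \<in> carrier G" "b \<in> carrier G" "c \<in> carrier G"
        and bx: "\<forall>h\<in>N. \<forall>k\<in>N. commutator G (a \<otimes> h) (b \<otimes> k) \<in> top_generate G T {c}" for N a b c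
    proof (rule \<pi>.H.commutator_box_cyclic)
      have NG: "N \<subseteq> carrier G" using subgroup.subset [OF open_normal_imp_subgroup [OF N]] .
      show "?\<pi> ` N \<lhd> G Mod U" by (rule rcoset_image_normal [OF U open_normal_imp_normal [OF N]])
      show "?\<pi> a \<in> carrier (G Mod U)" "?\<pi> b \<in> carrier (G Mod U)" "?\<pi> c \<in> carrier (G Mod U)"
        using abc by auto
      fix h k assume "h \<in> ?\<pi> ` N" "k \<in> ?\<pi> ` N"
      then obtain x y where xy: "x \<in> N" "h = ?\<pi> x" "y \<in> N" "k = ?\<pi> y" by blast
      have "?\<pi> (commutator G (a \<otimes> x) (b \<otimes> y)) \<in> generate (G Mod U) {?\<pi> c}"
        using mem_top_generate_iff [OF abc(3)] bx xy U by blast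
      moreover have "?\<pi> (commutator G (a \<otimes> x) (b \<otimes> y)) =
          commutator (G Mod U) (?\<pi> a \<otimes>\<^bsub>G Mod U\<^esub> h) (?\<pi> b \<otimes>\<^bsub>G Mod U\<^esub> k)"
        using xy NG abc by (simp add: \<pi>.hom_commutator subset_iff del: mult_FactGroup)
      ultimately show "commutator (G Mod U) (?\<pi> a \<otimes>\<^bsub>G Mod U\<^esub> h) (?\<pi> b \<otimes>\<^bsub>G Mod U\<^esub> k)
          \<in> generate (G Mod U) {?\<pi> c}" by simp
    qed
    have rep: "\<exists>g\<in>carrier G. x = ?\<pi> g" if "x \<in> carrier (G Mod U)" for x
      using that by (auto simp: carrier_FactGroup)
    have quot: "inv\<^bsub>G Mod U\<^esub> ?\<pi> a \<otimes>\<^bsub>G Mod U\<^esub> ?\<pi> g \<in> ?\<pi> ` N"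
      if "a \<in> carrier G" "g \<in> carrier G" "inv a \<otimes> g \<in> N" for a g N
    proof -
      have "?\<pi> (inv a \<otimes> g) = inv\<^bsub>G Mod U\<^esub> ?\<pi> a \<otimes>\<^bsub>G Mod U\<^esub> ?\<pi> g"
        using that by (simp del: mult_FactGroup)
      then show ?thesis using that(3) by (metis imageI)
    qed
    let ?S = "{commutator (G Mod U) l g | l g. l \<in> ?\<pi> ` L \<and> g \<in> carrier (G Mod U)}"
    \<comment> \<open>The first level has a single coset, so \<open>g = g' = \<one>\<close> supplies
      a cyclic group containing all commutators from the image of \<open>H\<close>.\<close>
    obtain c0 where c0: "c0 \<in> carrier (G Mod U)"
      "\<forall>k\<in>?\<pi> ` H. \<forall>k'\<in>?\<pi> ` H. commutator (G Mod U) k k' \<in> generate (G Mod U) {c0}"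
    proof -
      obtain a b c where abc: "a \<in> carrier G" "b \<in> carrier G" "c \<in> carrier G"
        "\<forall>h\<in>H. \<forall>k\<in>H. commutator G (a \<otimes> h) (b \<otimes> k) \<in> top_generate G T {c}"
        using bspec [OF bspec [OF boxH one_closed] one_closed] by blast
      show thesis using box [OF H abc] that by blast
    qed
    have "\<exists>x\<in>generate (G Mod U) ?S. generate (G Mod U) {x} = generate (G Mod U) ?S"
    proof (rule \<pi>.H.commutators_generate_cyclic [where n = "card (rcosets U)" and H = "?\<pi> ` H" and K = "?\<pi> ` K" and ?c0.0 = c0])
      show "card (rcosets U) > 0" by (rule quotient_pow_eq_one(1) [OF U])
      show "x [^]\<^bsub>G Mod U\<^esub> card (rcosets U) = \<one>\<^bsub>G Mod U\<^esub>" if "x \<in> carrier (G Mod U)" for x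
        by (rule quotient_pow_eq_one(2) [OF U that])
      show "?\<pi> ` H \<lhd> G Mod U" "?\<pi> ` K \<lhd> G Mod U" "?\<pi> ` L \<lhd> G Mod U"
        using H K L by (auto intro: rcoset_image_normal [OF U] open_normal_imp_normal)
      show "?\<pi> ` K \<subseteq> ?\<pi> ` H" "?\<pi> ` L \<subseteq> ?\<pi> ` K" using K L by auto
      show "c0 \<in> carrier (G Mod U)" by (rule c0)
      show "commutator (G Mod U) h h' \<in> generate (G Mod U) {c0}" if "h \<in> ?\<pi> ` H" "h' \<in> ?\<pi> ` H" for h h'
        using c0(2) that by blast
      show "\<exists>a\<in>carrier (G Mod U). \<exists>c\<in>carrier (G Mod U). inv\<^bsub>G Mod U\<^esub> a \<otimes>\<^bsub>G Mod U\<^esub> g \<in> ?\<pi> ` H \<and>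
        (\<forall>k\<in>?\<pi> ` K. commutator (G Mod U) k a \<in> generate (G Mod U) {c} \<and>
          (\<forall>k'\<in>?\<pi> ` K. commutator (G Mod U) k k' \<in> generate (G Mod U) {c}))"
        if "g \<in> carrier (G Mod U)" for g
      proof -
        obtain x where x: "x \<in> carrier G" "g = ?\<pi> x" using rep \<open>g \<in> carrier (G Mod U)\<close> by blast
        obtain a b c where abc: "a \<in> carrier G" "b \<in> carrier G" "c \<in> carrier G" "inv a \<otimes> x \<in> H"
          "\<forall>h\<in>K. \<forall>k\<in>K. commutator G (a \<otimes> h) (b \<otimes> k) \<in> top_generate G T {c}"
          using bspec [OF bspec [OF boxK x(1)] x(1)] by blast
        obtain d where "d \<in> carrier (G Mod U)" "\<forall>k\<in>?\<pi> ` K.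
          commutator (G Mod U) k (?\<pi> a) \<in> generate (G Mod U) {d} \<and>
          (\<forall>k'\<in>?\<pi> ` K. commutator (G Mod U) k k' \<in> generate (G Mod U) {d})"
          using box [OF K(1) abc(1,2,3,5)] by blast
        moreover have "?\<pi> a \<in> carrier (G Mod U)" using abc by simp
        ultimately show ?thesis using quot [OF abc(1) x(1) abc(4)] x(2) by blast
      qed
      show "\<exists>a\<in>carrier (G Mod U). \<exists>b\<in>carrier (G Mod U). \<exists>c\<in>carrier (G Mod U).
        inv\<^bsub>G Mod U\<^esub> a \<otimes>\<^bsub>G Mod U\<^esub> g \<in> ?\<pi> ` K \<and> inv\<^bsub>G Mod U\<^esub> b \<otimes>\<^bsub>G Mod U\<^esub> g' \<in> ?\<pi> ` K \<and>
        (\<forall>l\<in>?\<pi> ` L. commutator (G Mod U) l a \<in> generate (G Mod U) {c} \<and>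
          commutator (G Mod U) l b \<in> generate (G Mod U) {c})"
        if "g \<in> carrier (G Mod U)" "g' \<in> carrier (G Mod U)" for g g'
      proof -
        obtain x where x: "x \<in> carrier G" "g = ?\<pi> x" using rep \<open>g \<in> carrier (G Mod U)\<close> by blast
        obtain y where y: "y \<in> carrier G" "g' = ?\<pi> y" using rep \<open>g' \<in> carrier (G Mod U)\<close> by blast
        obtain a b c where abc: "a \<in> carrier G" "b \<in> carrier G" "c \<in> carrier G" "inv a \<otimes> x \<in> K" "inv b \<otimes> y \<in> K"
          "\<forall>h\<in>L. \<forall>k\<in>L. commutator G (a \<otimes> h) (b \<otimes> k) \<in> top_generate G T {c}"
          using bspec [OF bspec [OF boxL x(1)] y(1)] by blast
        obtain d where "d \<in> carrier (G Mod U)" "\<forall>k\<in>?\<pi> ` L.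
          commutator (G Mod U) k (?\<pi> a) \<in> generate (G Mod U) {d} \<and>
          commutator (G Mod U) k (?\<pi> b) \<in> generate (G Mod U) {d}"
          using box [OF L(1) abc(1,2,3,6)] by blast
        moreover have "?\<pi> a \<in> carrier (G Mod U)" "?\<pi> b \<in> carrier (G Mod U)" using abc by auto
        ultimately show ?thesis
          using quot [OF abc(1) x(1) abc(4)] quot [OF abc(2) y(1) abc(5)] x(2) y(2) by blast
      qed
    qed
    moreover have "?S = ?\<pi> ` S"
    proof (intro subset_antisym subsetI)
      fix s assume "s \<in> ?S"
      then obtain l X where l: "l \<in> L" "X \<in> carrier (G Mod U)" "s = commutator (G Mod U) (?\<pi> l) X" by blast
      moreover obtain g where "g \<in> carrier G" "X = ?\<pi> g" using rep l by blast
      ultimately have "s = ?\<pi> (commutator G l g)" "commutator G l g \<in> S"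
        using LG by (auto simp: \<pi>.hom_commutator S_def)
      then show "s \<in> ?\<pi> ` S" by blast
    next
      fix s assume "s \<in> ?\<pi> ` S"
      then obtain l g where l: "l \<in> L" "g \<in> carrier G" "s = ?\<pi> (commutator G l g)" by (auto simp: S_def)
      then have "s = commutator (G Mod U) (?\<pi> l) (?\<pi> g)" using LG by (auto simp: \<pi>.hom_commutator)
      then show "s \<in> ?S" using l \<pi>.hom_closed by blast
    qed
    ultimately obtain x where x: "x \<in> generate G S" "generate (G Mod U) {?\<pi> x} = ?\<pi> ` generate G S"
      using \<pi>.generate_img [OF S] by auto
    have "x \<in> top_generate G T S"
      unfolding top_generate_def
      using x(1) closure_of_subset [of "generate G S" T] generate_incl [OF S] by auto
    moreover have "?\<pi> y \<in> generate (G Mod U) {?\<pi> x}" if "y \<in> top_generate G T S" for y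
    proof -
      have yG: "y \<in> carrier G"
        using that subgroup.subset [OF subgroup_top_generate [OF S]] by blast
      have "\<exists>s\<in>generate G S. ?\<pi> y = ?\<pi> s"
        using that U in_closure_iff [OF generate_incl [OF S] yG] by (simp add: top_generate_def)
      then show ?thesis unfolding x(2) by blast
    qed
    ultimately show "\<exists>c\<in>top_generate G T S. \<forall>y\<in>top_generate G T S. ?\<pi> y \<in> generate (G Mod U) {?\<pi> c}"
      by blast
  qed
  then show ?thesis
    using L(1) subgroup.subset [OF subgroup_top_generate [OF S]] unfolding S_def by blast
qed

end

section \<open>Assembling the cover of the commutator subgroup\<close>

context profinite_group begin

lemma normal_top_generate:
  assumes S: "S \<subseteq> carrier G" and norm: "generate G S \<lhd> G"
  shows "top_generate G T S \<lhd> G"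
proof (subst normal_inv_iff, intro conjI ballI)
  interpret N: normal "generate G S" G by (rule norm)
  show sg: "subgroup (top_generate G T S) G" by (rule subgroup_top_generate [OF S])
  fix x h assume x: "x \<in> carrier G" and h: "h \<in> top_generate G T S"
  have hG: "h \<in> carrier G" using h subgroup.subset [OF sg] by blast
  show "x \<otimes> h \<otimes> inv x \<in> top_generate G T S"
    unfolding top_generate_def
  proof (rule in_closure_iff [OF N.subset, THEN iffD2], safe)
    show "x \<otimes> h \<otimes> inv x \<in> carrier G" using x hG by simp
    fix U assume U: "open_normal U"
    interpret \<pi>: group_hom G "G Mod U" "\<lambda>x. U #> x" by (rule rcoset_hom [OF U])
    obtain s where s: "s \<in> generate G S" "U #> h = U #> s"
      using h U in_closure_iff [OF N.subset hG] by (auto simp: top_generate_def)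
    have "U #> (x \<otimes> h \<otimes> inv x) = U #> (x \<otimes> s \<otimes> inv x)"
      using x hG s by (simp del: mult_FactGroup)
    then show "\<exists>s\<in>generate G S. U #> (x \<otimes> h \<otimes> inv x) = U #> s"
      using N.inv_op_closed2 [OF x s(1)] by blast
  qed
qed

lemma commutators_centralize_procyclic:
  assumes z: "z \<in> carrier G" and norm: "top_generate G T {z} \<lhd> G"
    and d: "d \<in> generate G (commutators G)" and x: "x \<in> top_generate G T {z}"
  shows "d \<otimes> x = x \<otimes> d"
proof -
  interpret N: normal "top_generate G T {z}" G by (rule norm)
  have comm: "s \<otimes> y = y \<otimes> s" if s: "s \<in> commutators G" and y: "y \<in> top_generate G T {z}" for s y
  proof (rule eq_if_rcosets_eq)
    obtain a b where ab: "a \<in> carrier G" "b \<in> carrier G" "s = commutator G a b"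
      using s by (auto simp: commutators_def)
    have yG: "y \<in> carrier G" by (rule N.mem_carrier [OF y])
    show "s \<otimes> y \<in> carrier G" "y \<otimes> s \<in> carrier G" using ab yG by auto
    fix U assume U: "open_normal U"
    interpret \<pi>: group_hom G "G Mod U" "\<lambda>x. U #> x" by (rule rcoset_hom [OF U])
    let ?\<pi> = "\<lambda>x. U #> x"
    have "?\<pi> ` top_generate G T {z} = generate (G Mod U) {?\<pi> z}"
    proof (rule subset_antisym)
      show "?\<pi> ` top_generate G T {z} \<subseteq> generate (G Mod U) {?\<pi> z}"
        using mem_top_generate_iff [OF z] U by blast
      have "subgroup (?\<pi> ` top_generate G T {z}) (G Mod U)"
        by (rule \<pi>.subgroup_img_is_subgroup [OF N.subgroup_axioms])
      then show "generate (G Mod U) {?\<pi> z} \<subseteq> ?\<pi> ` top_generate G T {z}"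
        using incl_top_generate [of "{z}" z] z by (intro \<pi>.H.generate_subgroup_incl) auto
    qed
    then have "generate (G Mod U) {?\<pi> z} \<lhd> G Mod U"
      using rcoset_image_normal [OF U norm] by simp
    then have sz: "?\<pi> s \<otimes>\<^bsub>G Mod U\<^esub> ?\<pi> z = ?\<pi> z \<otimes>\<^bsub>G Mod U\<^esub> ?\<pi> s"
      unfolding ab(3) \<pi>.hom_commutator [OF ab(1,2)]
      by (rule \<pi>.H.conj_by_commutator_trivial [rotated]) (use ab z in auto)
    have "?\<pi> s \<otimes>\<^bsub>G Mod U\<^esub> ?\<pi> y = ?\<pi> y \<otimes>\<^bsub>G Mod U\<^esub> ?\<pi> s"
    proof (rule \<pi>.H.generate_commute [of "{?\<pi> s}" "{?\<pi> z}"])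
      show "?\<pi> y \<in> generate (G Mod U) {?\<pi> z}" using y mem_top_generate_iff [OF z] U by blast
      show "?\<pi> s \<in> generate (G Mod U) {?\<pi> s}" by (auto intro: generate.incl)
    qed (use sz ab z in \<open>auto simp del: mult_FactGroup\<close>)
    then show "U #> (s \<otimes> y) = U #> (y \<otimes> s)" using ab yG by (simp del: mult_FactGroup)
  qed
  have "commutators G \<subseteq> carrier G" by (auto simp: commutators_def)
  then show ?thesis
    by (rule generate_commute [OF _ N.subset comm d]) (auto intro: generate.incl x)
qed

text \<open>In \<open>G/M\<close> the image of \<open>L\<close> is central because
  \<open>lg = gl [l,g]\<close>, and it has finite index, so Schur's theorem applies. The abstract
  group generated by the commutators suffices here: it lies in finitely many cosets of
  \<open>M\<close>, and for closed \<open>M\<close> their union is closed and so contains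
  \<open>G'\<close>.\<close>

lemma finite_derived_modulo:
  assumes L: "open_normal L" and M: "M \<lhd> G"
    and LM: "\<And>l g. l \<in> L \<Longrightarrow> g \<in> carrier G \<Longrightarrow> commutator G l g \<in> M"
  shows "finite ((\<lambda>x. M #> x) ` generate G (commutators G))"
    and "\<exists>m::nat>0. \<forall>d\<in>generate G (commutators G). d [^] m \<in> M"
proof -
  interpret M: normal M G by (rule M)
  interpret Q: group "G Mod M" by (rule M.factorgroup_is_group)
  let ?\<pi> = "\<lambda>x. M #> x"
  interpret \<pi>: group_hom G "G Mod M" ?\<pi>
    using M.r_coset_hom_Mod by unfold_locales
  have sgL: "subgroup L G" by (rule open_normal_imp_subgroup [OF L])
  interpret L: subgroup L G by (rule sgL)
  have C: "commutators G \<subseteq> carrier G" by (auto simp: commutators_def)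
  have fin: "finite (generate (G Mod M) (commutators (G Mod M)))"
  proof (rule Q.finite_generate_commutators)
    show sgZ: "subgroup (?\<pi> ` L) (G Mod M)" by (rule \<pi>.subgroup_img_is_subgroup [OF sgL])
    show "z \<otimes>\<^bsub>G Mod M\<^esub> x = x \<otimes>\<^bsub>G Mod M\<^esub> z"
      if zx: "z \<in> ?\<pi> ` L" "x \<in> carrier (G Mod M)" for z x
    proof -
      obtain l g where l: "l \<in> L" "z = ?\<pi> l" "g \<in> carrier G" "x = ?\<pi> g"
        using zx by (auto simp: carrier_FactGroup)
      have "(l \<otimes> g) \<otimes> inv (g \<otimes> l) = (g \<otimes> l) \<otimes> commutator G l g \<otimes> inv (g \<otimes> l)"
        using l by (simp add: commutator_def group_word_simps)
      also have "\<dots> \<in> M" by (rule M.inv_op_closed2) (use l LM in auto)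
      finally have "?\<pi> (l \<otimes> g) = ?\<pi> (g \<otimes> l)"
        using l by (subst rcoset_eq_iff [OF M.subgroup_axioms]) auto
      then show ?thesis using l by (simp del: mult_FactGroup)
    qed
    obtain R where R: "finite R" "R \<subseteq> carrier G" "\<And>g. g \<in> carrier G \<Longrightarrow> \<exists>r\<in>R. L #> g = L #> r"
      using finite_coset_representatives [OF L] by blast
    have "rcosets\<^bsub>G Mod M\<^esub> (?\<pi> ` L) \<subseteq> (\<lambda>r. ?\<pi> ` L #>\<^bsub>G Mod M\<^esub> ?\<pi> r) ` R"
    proof
      fix X assume "X \<in> rcosets\<^bsub>G Mod M\<^esub> (?\<pi> ` L)"
      then obtain g where g: "g \<in> carrier G" "X = ?\<pi> ` L #>\<^bsub>G Mod M\<^esub> ?\<pi> g"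
        by (auto simp: RCOSETS_def carrier_FactGroup)
      obtain r where r: "r \<in> R" "L #> g = L #> r" using R(3) g by blast
      have rG: "r \<in> carrier G" using r R by blast
      have "g \<otimes> inv r \<in> L" using r(2) rcoset_eq_iff [OF sgL g(1) rG] by simp
      moreover have "?\<pi> g \<otimes>\<^bsub>G Mod M\<^esub> inv\<^bsub>G Mod M\<^esub> ?\<pi> r = ?\<pi> (g \<otimes> inv r)"
        using g rG by (simp del: mult_FactGroup)
      ultimately have "?\<pi> g \<otimes>\<^bsub>G Mod M\<^esub> inv\<^bsub>G Mod M\<^esub> ?\<pi> r \<in> ?\<pi> ` L" by simp
      then have "X = ?\<pi> ` L #>\<^bsub>G Mod M\<^esub> ?\<pi> r"
        unfolding g(2) using Q.rcoset_eq_iff [OF sgZ, of "?\<pi> g" "?\<pi> r"] g rG by auto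
      then show "X \<in> (\<lambda>r. ?\<pi> ` L #>\<^bsub>G Mod M\<^esub> ?\<pi> r) ` R" using r by blast
    qed
    then show "finite (rcosets\<^bsub>G Mod M\<^esub> (?\<pi> ` L))" using R(1) finite_surj by blast
  qed
  have "?\<pi> ` commutators G \<subseteq> commutators (G Mod M)"
  proof
    fix s assume "s \<in> ?\<pi> ` commutators G"
    then obtain x y where "x \<in> carrier G" "y \<in> carrier G" "s = ?\<pi> (commutator G x y)"
      by (auto simp: commutators_def)
    then show "s \<in> commutators (G Mod M)"
      using \<pi>.hom_commutator \<pi>.hom_closed unfolding commutators_def by blast
  qed
  then have "?\<pi> ` generate G (commutators G) \<subseteq> generate (G Mod M) (commutators (G Mod M))"
    unfolding \<pi>.generate_img [OF C, symmetric] by (rule Q.mono_generate)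
  then show finD: "finite (?\<pi> ` generate G (commutators G))" using fin by (rule finite_subset)
  let ?D = "?\<pi> ` generate G (commutators G)"
  have sgD: "subgroup ?D (G Mod M)"
    by (rule \<pi>.subgroup_img_is_subgroup [OF generate_is_subgroup [OF C]])
  interpret D: group "(G Mod M)\<lparr>carrier := ?D\<rparr>" by (rule Q.subgroup_imp_group [OF sgD])
  have "card ?D > 0" using finD generate.one [of G "commutators G"] by (auto simp: card_gt_0_iff)
  moreover have "d [^] card ?D \<in> M" if d: "d \<in> generate G (commutators G)" for d
  proof -
    have dG: "d \<in> carrier G" using d generate_incl [OF C] by blast
    have "?\<pi> d [^]\<^bsub>(G Mod M)\<lparr>carrier := ?D\<rparr>\<^esub> card ?D = \<one>\<^bsub>(G Mod M)\<lparr>carrier := ?D\<rparr>\<^esub>"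
      using D.pow_order_eq_1 [of "?\<pi> d"] d by (simp add: Coset.order_def)
    then have "?\<pi> d [^]\<^bsub>G Mod M\<^esub> card ?D = M"
      using Q.nat_pow_consistent by simp
    then have "?\<pi> (d [^] card ?D) = M" using \<pi>.hom_nat_pow [OF dG] by simp
    then show ?thesis using dG coset_join1 [OF _ _ M.subgroup_axioms] M.subset by simp
  qed
  ultimately show "\<exists>m::nat>0. \<forall>d\<in>generate G (commutators G). d [^] m \<in> M" by blast
qed

lemma covered_commutator_subgroup:
  assumes cov: "covered_by_countably_many_procyclic G T (commutators G)"
  shows "covered_by_countably_many_procyclic G T (commutator_subgroup G T)"
proof -
  let ?D = "generate G (commutators G)"
  have C: "commutators G \<subseteq> carrier G" by (auto simp: commutators_def)
  obtain L z where L: "open_normal L" and z: "z \<in> carrier G"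
    and Lz: "top_generate G T {commutator G l g | l g. l \<in> L \<and> g \<in> carrier G} = top_generate G T {z}"
    using commutator_subgroup_open_normal_procyclic [OF cov] by blast
  define M where "M = top_generate G T {z}"
  have nL: "L \<lhd> G" by (rule open_normal_imp_normal [OF L])
  interpret L: normal L G by (rule nL)
  have S: "{commutator G l g | l g. l \<in> L \<and> g \<in> carrier G} \<subseteq> carrier G" by auto
  have nM: "M \<lhd> G"
    unfolding M_def Lz [symmetric] by (rule normal_top_generate [OF S normal_generate_commutators [OF nL]])
  interpret M: normal M G by (rule nM)
  have LM: "commutator G l g \<in> M" if "l \<in> L" "g \<in> carrier G" for l g
    unfolding M_def Lz [symmetric] by (rule incl_top_generate [OF S]) (use that in blast)
  have fin: "finite ((\<lambda>x. M #> x) ` ?D)" by (rule finite_derived_modulo [OF L nM LM])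
  obtain m :: nat where m: "m > 0" "\<And>d. d \<in> ?D \<Longrightarrow> d [^] m \<in> M"
    using finite_derived_modulo(2) [OF L nM LM] by blast
  \<comment> \<open>The representatives are taken from the group generated by the commutators, so
    that they centralize \<open>M\<close> and have their \<open>m\<close>-th powers in
    \<open>M\<close>.\<close>
  obtain R where R: "R \<subseteq> ?D" "finite R" "(\<lambda>x. M #> x) ` ?D = (\<lambda>x. M #> x) ` R"
    using fin finite_subset_image [OF fin subset_refl] by blast
  let ?A = "\<Union>r\<in>R. (\<lambda>x. r \<otimes> x) ` M"
  have RG: "r \<in> carrier G" if "r \<in> R" for r
    using that R(1) generate_incl [OF C] by blast
  have "?D \<subseteq> ?A"
  proof
    fix d assume d: "d \<in> ?D"
    then have dG: "d \<in> carrier G" using generate_incl [OF C] by blast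
    have "M #> d \<in> (\<lambda>x. M #> x) ` R" using d R(3) by blast
    then obtain r where r: "r \<in> R" "M #> d = M #> r" by blast
    have "inv r \<otimes> d \<in> M" using left_quotient_mem [OF nM dG RG] r by simp
    moreover have "d = r \<otimes> (inv r \<otimes> d)" using dG RG [OF r(1)] by (simp add: cancel_inv_left)
    ultimately show "d \<in> ?A" using r(1) by blast
  qed
  moreover have "closedin T ?A"
    using R(2) by (intro closedin_Union) (auto intro!: closedin_lmult RG simp: M_def closedin_top_generate)
  ultimately have "commutator_subgroup G T \<subseteq> ?A"
    unfolding commutator_subgroup_def top_generate_def by (rule closure_of_minimal)
  moreover have "covered_by_countably_many_procyclic G T ?A"
  proof (rule covered_UN [OF R(2)])
    fix r assume r: "r \<in> R"
    then have rD: "r \<in> ?D" using R(1) by blast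
    show "covered_by_countably_many_procyclic G T ((\<lambda>x. r \<otimes> x) ` M)"
      unfolding M_def
    proof (rule covered_coset [OF RG [OF r] z _ m(1)])
      show "r [^] m \<in> top_generate G T {z}" using m(2) [OF rD] by (simp add: M_def)
      show "r \<otimes> x = x \<otimes> r" if "x \<in> top_generate G T {z}" for x
        by (rule commutators_centralize_procyclic [OF z nM [unfolded M_def] rD that])
    qed
  qed
  ultimately show ?thesis using covered_mono by blast
qed

end

theorem mainTheorem3:
  fixes G :: "('a, 'b) monoid_scheme" and T :: "'a topology"
  assumes "profinite_group G T"
    and "covered_by_countably_many_procyclic G T (commutators G)"
  shows "covered_by_countably_many_procyclic G T (commutator_subgroup G T)"
  using profinite_group.covered_commutator_subgroup [OF assms] .

end
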